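(* Let $(M,h)$ be a complete Riemannian manifold and let $(M,F:A\to\mathbb{R}^+)$ be the strong Kropina manifold with navigation data $(h,W)$, where $W$ is a unit Killing field with flow $\varphi_t$. Let $\mathcal P(t)$ be an $F$-unit speed geodesic with $\mathcal P(0)=p$ and let $\rho(t)=\varphi_{-t}(\mathcal P(t))$ be the corresponding unit speed $h$-geodesic. Then, for $l>0$, the point $q=\mathcal P(l)$ is an $F$-cut point of $p=\mathcal P(0)$ along the $F$-geodesic segment $\mathcal P|_{[0,l]}$ if and only if $\hat q=\rho(l)$ is an $h$-cut point of $p=\rho(0)$ along the $h$-geodesic segment $\rho|_{[0,l]}$.
   Context: The strong Kropina metric with navigation data $(h,W)$, where $W$ is a Killing field of $(M,h)$ with $|W|_h=1$ everywhere, is $F(x,y)=\frac{|y|_h^2}{2h(y,W)}$, defined on $A=\{(x,y)\in TM: h(y,W)>0\}$, $A_x=A\cap T_xM$. A piecewise smooth curve $c$ is $F$-admissible if $\dot c(t)\in A_{c(t)}$ for all $t$; its $F$-length is $\int F(c,\dot c)dt$. An $F$-geodesic is a smooth $F$-admissible curve satisfying $\ddot c^i+2G^i(c,\dot c)=0$, where $G^i=\tfrac14 g^{ij}\big(\tfrac{\partial^2F^2}{\partial y^j\partial x^k}y^k-\tfrac{\partial F^2}{\partial x^j}\big)$, $g_{ij}=\tfrac12\tfrac{\partial^2F^2}{\partial y^i\partial y^j}$; unit speed means $F(c,\dot c)=1$. The curve $\rho(t)=\varphi_{-t}(\mathcal P(t))$ is a unit speed $h$-geodesic with $\dot\rho(0)=\dot{\mathcal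 P}(0)-W_p$. The $F$-separation $d_F(p,q)$ is the infimum of $F$-lengths of piecewise smooth $F$-admissible curves from $p$ to $q$ ($\infty$ if there are none, and $d_F(p,p)=0$). A geodesic segment is minimizing if its length equals the $d_F$-separation of its initial point from its endpoint. The point $\mathcal P(l)$ is an $F$-cut point of $p$ along $\mathcal P$ if $l=\sup\{t>0:\mathcal P|_{[0,t]}\text{ is minimizing}\}$; $h$-cut points are defined in the same way with the Riemannian distance of $h$. *)

theory Defs
  imports "HOL-Analysis.Analysis"
begin

text \<open>
  Tensor calculus on a smooth manifold in local coordinates. The manifold is a whole type
  \<open>'a\<close> (Hausdorff, second countable) with a given atlas modelled on \<open>real ^ 'n\<close>. It is not
  required to be connected.
\<close>

fun Ck_on :: "nat \<Rightarrow> 'b::euclidean_space set \<Rightarrow> ('b \<Rightarrow> 'c::real_normed_vector) \<Rightarrow> bool" where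
  "Ck_on 0 S f \<longleftrightarrow> continuous_on S f"
| "Ck_on (Suc k) S f \<longleftrightarrow>
     (\<forall>x\<in>S. f differentiable (at x)) \<and> (\<forall>v. Ck_on k S (\<lambda>x. frechet_derivative f (at x) v))"

text \<open>\<open>C\<^sup>\<infinity>\<close> on an open set; only ever applied to open \<open>S\<close>.\<close>
definition smooth_on :: "'b::euclidean_space set \<Rightarrow> ('b \<Rightarrow> 'c::real_normed_vector) \<Rightarrow> bool" where
  "smooth_on S f \<longleftrightarrow> (\<forall>k. Ck_on k S f)"


subsection \<open>Manifolds, tangent vectors\<close>

text \<open>A chart is a domain together with a coordinate map; the values of the map outside
  the domain are irrelevant.\<close>
type_synonym ('a, 'n) chart = "'a set \<times> ('a \<Rightarrow> (real, 'n) vec)"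

abbreviation chart_dom :: "('a, 'n) chart \<Rightarrow> 'a set" where
  "chart_dom \<equiv> fst"

abbreviation chart_map :: "('a, 'n) chart \<Rightarrow> 'a \<Rightarrow> (real, 'n) vec" where
  "chart_map \<equiv> snd"

definition chart_inv :: "('a, 'n) chart \<Rightarrow> (real, 'n) vec \<Rightarrow> 'a" where
  "chart_inv \<kappa> = inv_into (chart_dom \<kappa>) (chart_map \<kappa>)"

definition chart_img :: "('a, 'n) chart \<Rightarrow> (real, 'n) vec set" where
  "chart_img \<kappa> = chart_map \<kappa> ` chart_dom \<kappa>"

definition smooth_atlas ::
  "('a::{t2_space,second_countable_topology}, 'n::finite) chart set \<Rightarrow> bool" where
  "smooth_atlas \<A> \<longleftrightarrow>
     (\<Union>\<kappa>\<in>\<A>. chart_dom \<kappa>) = UNIV \<and>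
     (\<forall>\<kappa>\<in>\<A>. open (chart_dom \<kappa>) \<and> open (chart_img \<kappa>) \<and>
        homeomorphism (chart_dom \<kappa>) (chart_img \<kappa>) (chart_map \<kappa>) (chart_inv \<kappa>)) \<and>
     (\<forall>\<kappa>\<in>\<A>. \<forall>\<mu>\<in>\<A>. smooth_on (chart_map \<kappa> ` (chart_dom \<kappa> \<inter> chart_dom \<mu>))
        (chart_map \<mu> \<circ> chart_inv \<kappa>))"

text \<open>
  A tangent vector at \<open>x\<close> is the family of its coordinate vectors in all charts of the atlas
  around \<open>x\<close>, related by the derivatives of the transition maps; the components in all other
  charts are set to 0 so that a tangent vector is determined by its coordinates.
\<close>
type_synonym ('a, 'n) tvec = "('a, 'n) chart \<Rightarrow> (real, 'n) vec"

definition tangent_space :: "('a, 'n::finite) chart set \<Rightarrow> 'a \<Rightarrow> ('a, 'n) tvec set" where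
  "tangent_space \<A> x = {y.
     (\<forall>\<kappa>\<in>\<A>. \<forall>\<mu>\<in>\<A>. x \<in> chart_dom \<kappa> \<longrightarrow> x \<in> chart_dom \<mu> \<longrightarrow>
        y \<mu> = frechet_derivative (chart_map \<mu> \<circ> chart_inv \<kappa>) (at (chart_map \<kappa> x)) (y \<kappa>)) \<and>
     (\<forall>\<kappa>. \<not> (\<kappa> \<in> \<A> \<and> x \<in> chart_dom \<kappa>) \<longrightarrow> y \<kappa> = 0)}"

text \<open>The tangent vector \<open>\<Sum>i. u\<^sup>i \<partial>/\<partial>x\<^sup>i\<close> at the point with coordinates \<open>\<xi>\<close> in the chart \<open>\<kappa>\<close>.\<close>
definition coord_vec ::
  "('a, 'n::finite) chart set \<Rightarrow> ('a, 'n) chart \<Rightarrow> real ^ 'n \<Rightarrow> real ^ 'n \<Rightarrow> ('a, 'n) tvec" where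
  "coord_vec \<A> \<kappa> \<xi> u = (\<lambda>\<mu>. if \<mu> \<in> \<A> \<and> chart_inv \<kappa> \<xi> \<in> chart_dom \<mu>
     then frechet_derivative (chart_map \<mu> \<circ> chart_inv \<kappa>) (at \<xi>) u else 0)"

text \<open>The velocity of a curve at \<open>t\<close>; with \<open>S\<close> a nondegenerate closed interval this is the one-sided
  velocity at its end points.\<close>
definition velocity ::
  "('a, 'n::finite) chart set \<Rightarrow> (real \<Rightarrow> 'a) \<Rightarrow> real set \<Rightarrow> real \<Rightarrow> ('a, 'n) tvec" where
  "velocity \<A> c S t = (\<lambda>\<kappa>. if \<kappa> \<in> \<A> \<and> c t \<in> chart_dom \<kappa>
     then vector_derivative (chart_map \<kappa> \<circ> c) (at t within S) else 0)"

definition smooth_vector_field ::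
  "('a, 'n::finite) chart set \<Rightarrow> ('a \<Rightarrow> ('a, 'n) tvec) \<Rightarrow> bool" where
  "smooth_vector_field \<A> W \<longleftrightarrow>
     (\<forall>x. W x \<in> tangent_space \<A> x) \<and>
     (\<forall>\<kappa>\<in>\<A>. smooth_on (chart_img \<kappa>) (\<lambda>\<xi>. W (chart_inv \<kappa> \<xi>) \<kappa>))"

text \<open>\<open>\<phi>\<close> is the (global) flow of \<open>W\<close>: a smooth action of the reals with infinitesimal generator \<open>W\<close>.\<close>
definition global_flow ::
  "('a::topological_space, 'n::finite) chart set \<Rightarrow> ('a \<Rightarrow> ('a, 'n) tvec) \<Rightarrow> (real \<Rightarrow> 'a \<Rightarrow> 'a) \<Rightarrow> bool"
  where
  "global_flow \<A> W \<phi> \<longleftrightarrow>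
     continuous_on UNIV (\<lambda>(t, x). \<phi> t x) \<and>
     (\<forall>\<kappa>\<in>\<A>. \<forall>\<mu>\<in>\<A>. smooth_on
        {(t, \<xi>). \<xi> \<in> chart_img \<kappa> \<and> \<phi> t (chart_inv \<kappa> \<xi>) \<in> chart_dom \<mu>}
        (\<lambda>(t, \<xi>). chart_map \<mu> (\<phi> t (chart_inv \<kappa> \<xi>)))) \<and>
     (\<forall>x. \<phi> 0 x = x) \<and>
     (\<forall>s t x. \<phi> (s + t) x = \<phi> s (\<phi> t x)) \<and>
     (\<forall>t x. velocity \<A> (\<lambda>s. \<phi> s x) UNIV t = W (\<phi> t x))"


subsection \<open>Curves, length, separation\<close>

text \<open>For open \<open>J\<close>.\<close>
definition smooth_curve_on ::
  "('a::topological_space, 'n::finite) chart set \<Rightarrow> real set \<Rightarrow> (real \<Rightarrow> 'a) \<Rightarrow> bool" where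
  "smooth_curve_on \<A> J c \<longleftrightarrow> continuous_on J c \<and>
     (\<forall>\<kappa>\<in>\<A>. smooth_on {t\<in>J. c t \<in> chart_dom \<kappa>} (chart_map \<kappa> \<circ> c))"

text \<open>
  \<open>D x\<close> is the set of admissible velocities at \<open>x\<close>. On each closed piece the curve extends smoothly
  to an open neighbourhood, and at a break point both one-sided velocities have to be admissible.
\<close>
definition piecewise_smooth_curve ::
  "('a::topological_space, 'n::finite) chart set \<Rightarrow> ('a \<Rightarrow> ('a, 'n) tvec set)
    \<Rightarrow> (real \<Rightarrow> 'a) \<Rightarrow> real \<Rightarrow> real \<Rightarrow> bool" where
  "piecewise_smooth_curve \<A> D c a b \<longleftrightarrow> a < b \<and> continuous_on {a..b} c \<and>
     (\<exists>m \<tau>. \<tau> 0 = a \<and> \<tau> m = b \<and>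
       (\<forall>i<m::nat. \<tau> i < \<tau> (Suc i) \<and>
         (\<exists>J e. open J \<and> {\<tau> i..\<tau> (Suc i)} \<subseteq> J \<and> smooth_curve_on \<A> J e \<and>
            (\<forall>t\<in>{\<tau> i..\<tau> (Suc i)}. e t = c t)) \<and>
         (\<forall>t\<in>{\<tau> i..\<tau> (Suc i)}. velocity \<A> c {\<tau> i..\<tau> (Suc i)} t \<in> D (c t))))"

definition curve_length ::
  "('a, 'n::finite) chart set \<Rightarrow> ('a \<Rightarrow> ('a, 'n) tvec \<Rightarrow> real) \<Rightarrow> (real \<Rightarrow> 'a) \<Rightarrow> real \<Rightarrow> real \<Rightarrow> real"
  where
  "curve_length \<A> F c a b = integral {a..b} (\<lambda>t. F (c t) (velocity \<A> c {a..b} t))"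

text \<open>The infimum is \<open>\<infinity>\<close> if there is no curve.\<close>
definition separation ::
  "('a::topological_space, 'n::finite) chart set \<Rightarrow> ('a \<Rightarrow> ('a, 'n) tvec set)
    \<Rightarrow> ('a \<Rightarrow> ('a, 'n) tvec \<Rightarrow> real) \<Rightarrow> 'a \<Rightarrow> 'a \<Rightarrow> ereal" where
  "separation \<A> D F p q = (if p = q then 0 else
     Inf {ereal (curve_length \<A> F c a b) | c a b.
            piecewise_smooth_curve \<A> D c a b \<and> c a = p \<and> c b = q})"

definition minimizing ::
  "('a::topological_space, 'n::finite) chart set \<Rightarrow> ('a \<Rightarrow> ('a, 'n) tvec set)
    \<Rightarrow> ('a \<Rightarrow> ('a, 'n) tvec \<Rightarrow> real) \<Rightarrow> (real \<Rightarrow> 'a) \<Rightarrow> real \<Rightarrow> real \<Rightarrow> bool" where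
  "minimizing \<A> D F c a b \<longleftrightarrow> ereal (curve_length \<A> F c a b) = separation \<A> D F (c a) (c b)"

text \<open>\<open>c l\<close> is a cut point of \<open>c 0\<close> along the geodesic \<open>c\<close> with domain \<open>I\<close>. The supremum is taken in
  the extended reals.\<close>
definition cut_point ::
  "('a::topological_space, 'n::finite) chart set \<Rightarrow> ('a \<Rightarrow> ('a, 'n) tvec set)
    \<Rightarrow> ('a \<Rightarrow> ('a, 'n) tvec \<Rightarrow> real) \<Rightarrow> real set \<Rightarrow> (real \<Rightarrow> 'a) \<Rightarrow> real \<Rightarrow> bool" where
  "cut_point \<A> D F I c l \<longleftrightarrow>
     ereal l = Sup (ereal ` {t\<in>I. 0 < t \<and> minimizing \<A> D F c 0 t})"


subsection \<open>Riemannian metrics and Killing fields\<close>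

definition metric_coord ::
  "('a, 'n::finite) chart set \<Rightarrow> ('a \<Rightarrow> ('a, 'n) tvec \<Rightarrow> ('a, 'n) tvec \<Rightarrow> real)
    \<Rightarrow> ('a, 'n) chart \<Rightarrow> real ^ 'n \<Rightarrow> real ^ 'n \<Rightarrow> real ^ 'n \<Rightarrow> real" where
  "metric_coord \<A> h \<kappa> \<xi> u v = h (chart_inv \<kappa> \<xi>) (coord_vec \<A> \<kappa> \<xi> u) (coord_vec \<A> \<kappa> \<xi> v)"

definition riemannian_metric ::
  "('a, 'n::finite) chart set \<Rightarrow> ('a \<Rightarrow> ('a, 'n) tvec \<Rightarrow> ('a, 'n) tvec \<Rightarrow> real) \<Rightarrow> bool" where
  "riemannian_metric \<A> h \<longleftrightarrow> (\<forall>\<kappa>\<in>\<A>.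
     (\<forall>\<xi>\<in>chart_img \<kappa>.
        bilinear (metric_coord \<A> h \<kappa> \<xi>) \<and>
        (\<forall>u v. metric_coord \<A> h \<kappa> \<xi> u v = metric_coord \<A> h \<kappa> \<xi> v u) \<and>
        (\<forall>u. u \<noteq> 0 \<longrightarrow> metric_coord \<A> h \<kappa> \<xi> u u > 0)) \<and>
     (\<forall>u v. smooth_on (chart_img \<kappa>) (\<lambda>\<xi>. metric_coord \<A> h \<kappa> \<xi> u v)))"

definition riem_norm ::
  "('a \<Rightarrow> ('a, 'n) tvec \<Rightarrow> ('a, 'n) tvec \<Rightarrow> real) \<Rightarrow> 'a \<Rightarrow> ('a, 'n) tvec \<Rightarrow> real" where
  "riem_norm h x y = sqrt (h x y y)"

definition riem_dist ::
  "('a::topological_space, 'n::finite) chart set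
    \<Rightarrow> ('a \<Rightarrow> ('a, 'n) tvec \<Rightarrow> ('a, 'n) tvec \<Rightarrow> real) \<Rightarrow> 'a \<Rightarrow> 'a \<Rightarrow> ereal" where
  "riem_dist \<A> h = separation \<A> (tangent_space \<A>) (riem_norm h)"

definition riem_complete ::
  "('a::topological_space, 'n::finite) chart set
    \<Rightarrow> ('a \<Rightarrow> ('a, 'n) tvec \<Rightarrow> ('a, 'n) tvec \<Rightarrow> real) \<Rightarrow> bool" where
  "riem_complete \<A> h \<longleftrightarrow> (\<forall>X :: nat \<Rightarrow> 'a.
     (\<forall>\<epsilon>>0. \<exists>N. \<forall>m\<ge>N. \<forall>n\<ge>N. riem_dist \<A> h (X m) (X n) < ereal \<epsilon>) \<longrightarrow>
     (\<exists>x. (\<lambda>n. riem_dist \<A> h (X n) x) \<longlonglongrightarrow> 0))"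

text \<open>
  Vanishing of the Lie derivative \<open>L\<^sub>W h\<close>, in coordinates
  \<open>W\<^sup>k \<partial>\<^sub>k h\<^sub>i\<^sub>j + h\<^sub>k\<^sub>j \<partial>\<^sub>i W\<^sup>k + h\<^sub>i\<^sub>k \<partial>\<^sub>j W\<^sup>k = 0\<close>, contracted with arbitrary \<open>u\<^sup>i\<close>, \<open>v\<^sup>j\<close>.
\<close>
definition killing_field ::
  "('a, 'n::finite) chart set \<Rightarrow> ('a \<Rightarrow> ('a, 'n) tvec \<Rightarrow> ('a, 'n) tvec \<Rightarrow> real)
    \<Rightarrow> ('a \<Rightarrow> ('a, 'n) tvec) \<Rightarrow> bool" where
  "killing_field \<A> h W \<longleftrightarrow> smooth_vector_field \<A> W \<and>
     (\<forall>\<kappa>\<in>\<A>. \<forall>\<xi>\<in>chart_img \<kappa>. \<forall>u v.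
        let w = (\<lambda>\<eta>. W (chart_inv \<kappa> \<eta>) \<kappa>); dw = frechet_derivative w (at \<xi>) in
        frechet_derivative (\<lambda>\<eta>. metric_coord \<A> h \<kappa> \<eta> u v) (at \<xi>) (w \<xi>)
          + metric_coord \<A> h \<kappa> \<xi> (dw u) v + metric_coord \<A> h \<kappa> \<xi> u (dw v) = 0)"


subsection \<open>The strong Kropina metric and its geodesics\<close>

text \<open>The values outside \<open>kropina_dom\<close> are irrelevant.\<close>
definition kropina ::
  "('a \<Rightarrow> ('a, 'n) tvec \<Rightarrow> ('a, 'n) tvec \<Rightarrow> real) \<Rightarrow> ('a \<Rightarrow> ('a, 'n) tvec)
    \<Rightarrow> 'a \<Rightarrow> ('a, 'n) tvec \<Rightarrow> real" where
  "kropina h W x y = (riem_norm h x y)\<^sup>2 / (2 * h x y (W x))"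

definition kropina_dom ::
  "('a, 'n::finite) chart set \<Rightarrow> ('a \<Rightarrow> ('a, 'n) tvec \<Rightarrow> ('a, 'n) tvec \<Rightarrow> real)
    \<Rightarrow> ('a \<Rightarrow> ('a, 'n) tvec) \<Rightarrow> 'a \<Rightarrow> ('a, 'n) tvec set" where
  "kropina_dom \<A> h W x = {y \<in> tangent_space \<A> x. h x y (W x) > 0}"

definition partial_deriv :: "'n::finite \<Rightarrow> (real ^ 'n \<Rightarrow> real) \<Rightarrow> real ^ 'n \<Rightarrow> real" where
  "partial_deriv i f x = frechet_derivative f (at x) (axis i 1)"

text \<open>\<open>F\<^sup>2\<close> as a function of the coordinates \<open>x\<close>, \<open>y\<close> of the tangent bundle induced by a chart.\<close>
definition energy_coord ::
  "('a, 'n::finite) chart set \<Rightarrow> ('a \<Rightarrow> ('a, 'n) tvec \<Rightarrow> real)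
    \<Rightarrow> ('a, 'n) chart \<Rightarrow> real ^ 'n \<Rightarrow> real ^ 'n \<Rightarrow> real" where
  "energy_coord \<A> F \<kappa> x y = (F (chart_inv \<kappa> x) (coord_vec \<A> \<kappa> x y))\<^sup>2"

definition fundamental_tensor ::
  "('a, 'n::finite) chart set \<Rightarrow> ('a \<Rightarrow> ('a, 'n) tvec \<Rightarrow> real)
    \<Rightarrow> ('a, 'n) chart \<Rightarrow> real ^ 'n \<Rightarrow> real ^ 'n \<Rightarrow> real ^ 'n ^ 'n" where
  "fundamental_tensor \<A> F \<kappa> x y = (\<chi> i j.
     (1/2) * partial_deriv i (\<lambda>z. partial_deriv j (energy_coord \<A> F \<kappa> x) z) y)"

definition spray_coeff ::
  "('a, 'n::finite) chart set \<Rightarrow> ('a \<Rightarrow> ('a, 'n) tvec \<Rightarrow> real)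
    \<Rightarrow> ('a, 'n) chart \<Rightarrow> real ^ 'n \<Rightarrow> real ^ 'n \<Rightarrow> real ^ 'n" where
  "spray_coeff \<A> F \<kappa> x y = (\<chi> i. (1/4) *
     (\<Sum>j\<in>UNIV. matrix_inv (fundamental_tensor \<A> F \<kappa> x y) $ i $ j *
        ((\<Sum>k\<in>UNIV. partial_deriv j (\<lambda>z. partial_deriv k (\<lambda>x'. energy_coord \<A> F \<kappa> x' z) x) y * y $ k)
         - partial_deriv j (\<lambda>x'. energy_coord \<A> F \<kappa> x' y) x)))"

text \<open>For open \<open>I\<close>.\<close>
definition finsler_geodesic ::
  "('a::topological_space, 'n::finite) chart set \<Rightarrow> ('a \<Rightarrow> ('a, 'n) tvec set)
    \<Rightarrow> ('a \<Rightarrow> ('a, 'n) tvec \<Rightarrow> real) \<Rightarrow> real set \<Rightarrow> (real \<Rightarrow> 'a) \<Rightarrow> bool" where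
  "finsler_geodesic \<A> D F I c \<longleftrightarrow>
     smooth_curve_on \<A> I c \<and>
     (\<forall>t\<in>I. velocity \<A> c I t \<in> D (c t)) \<and>
     (\<forall>\<kappa>\<in>\<A>. \<forall>t\<in>I. c t \<in> chart_dom \<kappa> \<longrightarrow>
        (let x = chart_map \<kappa> \<circ> c; x' = (\<lambda>s. vector_derivative x (at s)) in
         \<forall>i. vector_derivative x' (at t) $ i + 2 * spray_coeff \<A> F \<kappa> (x t) (x' t) $ i = 0))"

end

theory Submission
  imports Defs
begin

text \<open>
  The theorem rests on the navigation picture of a Kropina metric: a unit speed curve for \<open>F\<close> is a unit
  speed curve for \<open>h\<close> that is carried along by the flow of \<open>W\<close>. Precisely, let \<open>f\<close> be a function of
  time, let \<open>y\<close> be the velocity of a curve \<open>c\<close> and let \<open>y'\<close> be the velocity of the dragged curve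
  \<open>t \<mapsto> \<phi> (f t) (c t)\<close>. The flow of a Killing field consists of isometries which preserve the field, and
  \<open>W\<close> has length 1, so \<open>|y'|\<^sup>2 = |y|\<^sup>2 + 2 f' h(y, W) + f'\<^sup>2\<close> and
  \<open>h(y', W) = h(y, W) + f'\<close> (\<open>norm_velocity_flow\<close>, \<open>inner_W_velocity_flow\<close>). Isometry follows by
  differentiating the pulled back metric in time: the differential of the flow satisfies a linear
  equation along each orbit, and the derivative of the metric cancels by the Killing equation
  (\<open>push_isometry\<close>).

  These identities compare the two separations. If \<open>f\<close> grows faster than the \<open>F\<close>-length of an admissible
  curve, then dragging the curve backwards by \<open>f\<close> gives a curve whose \<open>h\<close>-speed is at most \<open>f'\<close>
  (\<open>riemannian_le_kropina\<close>). If \<open>f\<close> grows faster than the \<open>h\<close>-length of any curve, then dragging it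
  forwards gives an admissible curve whose \<open>F\<close>-speed is less than \<open>f'\<close> (\<open>kropina_less_riemannian\<close>). Working
  with such strict majorants, instead of reparametrizing by arc length, has two advantages: \<open>f\<close> may be
  chosen to be a polynomial on each piece, and the second curve is admissible even where the given one
  runs against \<open>W\<close> or stops. In terms of separations, for \<open>r > 0\<close>, if \<open>d\<^sub>F(p, q) < r\<close> then
  \<open>d\<^sub>h(p, \<phi> (- r) q) \<le> r\<close>, and if \<open>d\<^sub>h(p, q) < r\<close> then \<open>d\<^sub>F(p, \<phi> r q) < r\<close>.

  Now \<open>P\<close> and \<open>\<rho>\<close> both have length \<open>t\<close> on \<open>[0, t]\<close>. If \<open>\<rho>\<close> is not minimizing on \<open>[0, t]\<close>, then the second
  comparison with \<open>q = \<rho> t\<close> and \<open>r = t\<close> shows that \<open>P\<close> is not minimizing either. For the converse suppose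
  that \<open>P\<close> is not minimizing on \<open>[0, s]\<close> and let \<open>s < t\<close>. The first comparison yields a path of length
  \<open>r < s\<close> from \<open>p\<close> to \<open>\<phi> (s - r) (\<rho> s)\<close>. Continue it backwards along the flow line to \<open>\<rho> s\<close>, which takes
  length \<open>s - r\<close>, and then along \<open>\<rho>\<close> to \<open>\<rho> t\<close>. The result has length \<open>t\<close>, like \<open>\<rho>\<close> itself. But it has a
  corner at \<open>\<rho> s\<close>, because the velocity of \<open>\<rho>\<close> is never \<open>- W\<close>, and a corner can be cut
  (\<open>corner_shortcut\<close>); so \<open>\<rho>\<close> is not minimizing on \<open>[0, t]\<close>.

  The loss of the final instant in the converse is real. For the Hopf field on the round sphere of
  dimension 3 every \<open>\<rho>\<close> is minimizing on \<open>[0, \<pi>]\<close>, whereas \<open>P \<pi> = P 0\<close> has separation 0 from itself. It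
  does not affect the suprema of the minimizing times, which define the cut points.
\<close>

section \<open>Differential calculus\<close>

lemma Ck_on_subset: "Ck_on k S f \<Longrightarrow> T \<subseteq> S \<Longrightarrow> Ck_on k T f"
proof (induction k arbitrary: f)
  case 0 then show ?case by (auto intro: continuous_on_subset)
next
  case (Suc k) then show ?case by (auto simp: subset_eq)
qed

text \<open>
  The derivatives of \<open>f\<close> at a point of an open set only see the values of \<open>f\<close> on that set.
\<close>
lemma Ck_on_cong:
  assumes "open S" "\<And>x. x \<in> S \<Longrightarrow> f x = g x"
  shows "Ck_on k S f \<longleftrightarrow> Ck_on k S g"
  using assms(2)
proof (induction k arbitrary: f g)
  case 0 then show ?case by (simp cong: continuous_on_cong)
next
  case (Suc k)
  have imp: "Ck_on (Suc k) S g" if "Ck_on (Suc k) S f" and eq: "\<And>x. x \<in> S \<Longrightarrow> f x = g x" for f g :: "'a \<Rightarrow> 'b"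
  proof -
    have d: "(g has_derivative frechet_derivative f (at x)) (at x)" if "x \<in> S" for x
    proof -
      have "(f has_derivative frechet_derivative f (at x)) (at x)"
        using \<open>Ck_on (Suc k) S f\<close> that by (auto simp: frechet_derivative_works)
      then show ?thesis
        using has_derivative_transform_within_open[OF _ assms(1) that] eq by metis
    qed
    have "frechet_derivative g (at x) = frechet_derivative f (at x)" if "x \<in> S" for x
      using d[OF that] frechet_derivative_at by metis
    then have "Ck_on k S (\<lambda>x. frechet_derivative g (at x) v)" for v
      using Suc.IH[of "\<lambda>x. frechet_derivative g (at x) v" "\<lambda>x. frechet_derivative f (at x) v"]
        \<open>Ck_on (Suc k) S f\<close> by simp
    with d show ?thesis
      unfolding Ck_on.simps differentiable_def by blast
  qed
  show ?case using imp[of f g] imp[of g f] Suc.prems by metis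
qed

lemma Ck_on_local:
  assumes "\<And>x. x \<in> S \<Longrightarrow> \<exists>U. open U \<and> x \<in> U \<and> Ck_on k U f"
  shows "Ck_on k S f"
  using assms
proof (induction k arbitrary: f)
  case 0
  then have "isCont f x" if "x \<in> S" for x
    using that by (metis Ck_on.simps(1) continuous_on_eq_continuous_at)
  then show ?case by (simp add: continuous_at_imp_continuous_on)
next
  case (Suc k)
  then show ?case unfolding Ck_on.simps by meson
qed

lemma Ck_on_SucD: "Ck_on (Suc k) S f \<Longrightarrow> Ck_on k S f"
proof (induction k arbitrary: f)
  case 0 
  then show ?case
    by (auto intro!: continuous_at_imp_continuous_on differentiable_imp_continuous_within)
next
  case (Suc k) then show ?case by (metis Ck_on.simps(2))
qed

lemma Ck_on_const: "Ck_on k S (\<lambda>x. c)"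
  by (induction k arbitrary: c) auto

lemma Ck_on_bounded_linear: "bounded_linear f \<Longrightarrow> Ck_on k S f"
proof (cases k)
  case (Suc j)
  assume f: "bounded_linear f"
  have "frechet_derivative f (at x) = f" for x
    using frechet_derivative_at[OF bounded_linear_imp_has_derivative[OF f]] by simp
  with f Suc show ?thesis by (auto simp: bounded_linear_imp_differentiable Ck_on_const)
qed (auto intro: linear_continuous_on)

lemma Ck_on_add:
  assumes "open S" "Ck_on k S f" "Ck_on k S g"
  shows "Ck_on k S (\<lambda>x. f x + g x)"
  using assms(2,3)
proof (induction k arbitrary: f g)
  case 0 then show ?case by (auto intro: continuous_intros)
next
  case (Suc k)
  have d: "((\<lambda>x. f x + g x) has_derivative
      (\<lambda>v. frechet_derivative f (at x) v + frechet_derivative g (at x) v)) (at x)" if "x \<in> S" for x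
    using Suc.prems that by (intro has_derivative_add) (auto simp: frechet_derivative_works)
  have "Ck_on k S (\<lambda>x. frechet_derivative (\<lambda>x. f x + g x) (at x) v)" for v
    using Suc.IH[of "\<lambda>x. frechet_derivative f (at x) v" "\<lambda>x. frechet_derivative g (at x) v"] Suc.prems
    by (subst Ck_on_cong[OF assms(1), of _ "\<lambda>x. frechet_derivative f (at x) v + frechet_derivative g (at x) v"])
       (auto simp: frechet_derivative_at[OF d, symmetric])
  with d show ?case unfolding Ck_on.simps differentiable_def by blast
qed

lemma Ck_on_sum:
  assumes "open S" "\<And>i. i \<in> A \<Longrightarrow> Ck_on k S (f i)"
  shows "Ck_on k S (\<lambda>x. \<Sum>i\<in>A. f i x)"
  using assms(2)
  by (induction A rule: infinite_finite_induct) (auto simp: Ck_on_const intro: Ck_on_add assms(1))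

lemma Ck_on_scaleR:
  assumes "open S" "Ck_on k S f" "Ck_on k S g"
  shows "Ck_on k S (\<lambda>x. f x *\<^sub>R g x)"
  using assms(2,3)
proof (induction k arbitrary: f g)
  case 0 then show ?case by (auto intro: continuous_intros)
next
  case (Suc k)
  have d: "((\<lambda>x. f x *\<^sub>R g x) has_derivative
      (\<lambda>v. f x *\<^sub>R frechet_derivative g (at x) v + frechet_derivative f (at x) v *\<^sub>R g x)) (at x)" if "x \<in> S" for x
    using Suc.prems that by (intro has_derivative_scaleR) (auto simp: frechet_derivative_works)
  have "Ck_on k S (\<lambda>x. f x *\<^sub>R frechet_derivative g (at x) v + frechet_derivative f (at x) v *\<^sub>R g x)" for v
    using Suc.prems by (intro Ck_on_add Suc.IH assms(1)) (auto intro: Ck_on_SucD)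
  then have "Ck_on k S (\<lambda>x. frechet_derivative (\<lambda>x. f x *\<^sub>R g x) (at x) v)" for v
    by (subst Ck_on_cong[OF assms(1)]) (auto simp: frechet_derivative_at[OF d, symmetric])
  with d show ?case unfolding Ck_on.simps differentiable_def by blast
qed

lemma Ck_on_bounded_linear_compose:
  assumes "open S" "Ck_on k S f" "bounded_linear L"
  shows "Ck_on k S (\<lambda>x. L (f x))"
  using assms(2)
proof (induction k arbitrary: f)
  case 0 then show ?case using assms(3) by (auto intro: bounded_linear.continuous_on)
next
  case (Suc k)
  have d: "((\<lambda>x. L (f x)) has_derivative (\<lambda>v. L (frechet_derivative f (at x) v))) (at x)" if "x \<in> S" for x
    using Suc.prems that by (intro bounded_linear.has_derivative[OF assms(3)]) (auto simp: frechet_derivative_works)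
  have "Ck_on k S (\<lambda>x. L (frechet_derivative f (at x) v))" for v
    using Suc.prems by (intro Suc.IH) auto
  then have "Ck_on k S (\<lambda>x. frechet_derivative (\<lambda>x. L (f x)) (at x) v)" for v
    by (subst Ck_on_cong[OF assms(1)]) (auto simp: frechet_derivative_at[OF d, symmetric])
  with d show ?case unfolding Ck_on.simps differentiable_def by blast
qed

text \<open>
  The derivative of \<open>g \<circ> f\<close> along \<open>v\<close> is expanded over a basis: its coefficients are components of a
  derivative of \<open>f\<close>, and what they multiply is a partial derivative of \<open>g\<close> composed with \<open>f\<close>. So
  the induction only needs sums, products and compositions with the same \<open>f\<close>.
\<close>
lemma Ck_on_compose:
  fixes f :: "'a::euclidean_space \<Rightarrow> 'b::euclidean_space" and g :: "'b \<Rightarrow> 'c::real_normed_vector"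
  assumes "open S" "open T" "f ` S \<subseteq> T" "Ck_on k S f" "Ck_on k T g"
  shows "Ck_on k S (\<lambda>x. g (f x))"
  using assms(4,5)
proof (induction k arbitrary: g)
  case 0 then show ?case using assms(3) continuous_on_compose2[of T g S f] by simp
next
  case (Suc k)
  have d: "((\<lambda>x. g (f x)) has_derivative
      (\<lambda>v. frechet_derivative g (at (f x)) (frechet_derivative f (at x) v))) (at x)" if "x \<in> S" for x
    using Suc.prems that assms(3)
    by - (rule has_derivative_compose[of f], auto simp: frechet_derivative_works)
  have eq: "frechet_derivative (\<lambda>x. g (f x)) (at x) v =
      (\<Sum>b\<in>Basis. (frechet_derivative f (at x) v \<bullet> b) *\<^sub>R frechet_derivative g (at (f x)) b)" if "x \<in> S" for x v
  proof -
    have "frechet_derivative (\<lambda>x. g (f x)) (at x) v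
        = frechet_derivative g (at (f x)) (\<Sum>b\<in>Basis. (frechet_derivative f (at x) v \<bullet> b) *\<^sub>R b)"
      by (simp add: frechet_derivative_at[OF d[OF that], symmetric] euclidean_representation)
    moreover have lin: "linear (frechet_derivative g (at (f x)))"
    proof (rule linear_frechet_derivative)
      show "g differentiable at (f x)"
        using Suc.prems(2) that assms(3) unfolding Ck_on.simps by blast
    qed
    ultimately show ?thesis by (simp add: linear_sum[OF lin] linear_scale[OF lin])
  qed
  have "Ck_on k S (\<lambda>x. \<Sum>b\<in>Basis. (frechet_derivative f (at x) v \<bullet> b) *\<^sub>R frechet_derivative g (at (f x)) b)" for v
  proof (intro Ck_on_sum Ck_on_scaleR assms(1))
    fix b :: 'b
    show "Ck_on k S (\<lambda>x. frechet_derivative f (at x) v \<bullet> b)"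
      using Suc.prems(1)
      by (intro Ck_on_bounded_linear_compose[OF assms(1) _ bounded_linear_inner_left]) simp
    show "Ck_on k S (\<lambda>x. frechet_derivative g (at (f x)) b)"
      using Suc.prems by (intro Suc.IH[OF Ck_on_SucD]) auto
  qed
  moreover have "Ck_on k S (\<lambda>x. frechet_derivative (\<lambda>x. g (f x)) (at x) v) \<longleftrightarrow>
      Ck_on k S (\<lambda>x. \<Sum>b\<in>Basis. (frechet_derivative f (at x) v \<bullet> b) *\<^sub>R frechet_derivative g (at (f x)) b)" for v
    by (rule Ck_on_cong[OF assms(1)]) (rule eq)
  ultimately have "Ck_on k S (\<lambda>x. frechet_derivative (\<lambda>x. g (f x)) (at x) v)" for v
    by blast
  with d show ?case unfolding Ck_on.simps differentiable_def by blast
qed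

lemma Ck_on_Pair:
  assumes "open S" "Ck_on k S f" "Ck_on k S g"
  shows "Ck_on k S (\<lambda>x. (f x, g x))"
proof -
  have "bounded_linear (\<lambda>a. (a, 0 :: 'c))" "bounded_linear (\<lambda>b. (0 :: 'b, b))"
    by (intro bounded_linear_Pair bounded_linear_ident bounded_linear_zero)+
  then have "Ck_on k S (\<lambda>x. (f x, 0) + (0, g x))"
    by (intro Ck_on_add assms(1) Ck_on_bounded_linear_compose[OF assms(1,2), where L = "\<lambda>a. (a, 0)"]
        Ck_on_bounded_linear_compose[OF assms(1,3), where L = "\<lambda>b. (0, b)"])
  then show ?thesis by simp
qed

lemma smooth_on_subset: "smooth_on S f \<Longrightarrow> T \<subseteq> S \<Longrightarrow> smooth_on T f"
  by (auto simp: smooth_on_def intro: Ck_on_subset)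

lemma smooth_on_cong:
  "open S \<Longrightarrow> (\<And>x. x \<in> S \<Longrightarrow> f x = g x) \<Longrightarrow> smooth_on S f \<longleftrightarrow> smooth_on S g"
  unfolding smooth_on_def using Ck_on_cong by metis

lemma smooth_on_local:
  assumes "\<And>x. x \<in> S \<Longrightarrow> \<exists>U. open U \<and> x \<in> U \<and> smooth_on U f"
  shows "smooth_on S f"
  unfolding smooth_on_def
proof
  fix k show "Ck_on k S f"
    by (rule Ck_on_local) (metis assms smooth_on_def)
qed

lemma smooth_on_compose:
  fixes f :: "'a::euclidean_space \<Rightarrow> 'b::euclidean_space" and g :: "'b \<Rightarrow> 'c::real_normed_vector"
  shows "open S \<Longrightarrow> open T \<Longrightarrow> f ` S \<subseteq> T \<Longrightarrow> smooth_on S f \<Longrightarrow> smooth_on T g \<Longrightarrow> smooth_on S (\<lambda>x. g (f x))"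
  by (simp add: smooth_on_def Ck_on_compose)

lemma smooth_on_Pair: "open S \<Longrightarrow> smooth_on S f \<Longrightarrow> smooth_on S g \<Longrightarrow> smooth_on S (\<lambda>x. (f x, g x))"
  by (simp add: smooth_on_def Ck_on_Pair)

lemma smooth_on_const: "smooth_on S (\<lambda>x. c)"
  by (simp add: smooth_on_def Ck_on_const)

lemma smooth_on_bounded_linear: "bounded_linear f \<Longrightarrow> smooth_on S f"
  by (simp add: smooth_on_def Ck_on_bounded_linear)

lemma smooth_on_add: "open S \<Longrightarrow> smooth_on S f \<Longrightarrow> smooth_on S g \<Longrightarrow> smooth_on S (\<lambda>x. f x + g x)"
  by (simp add: smooth_on_def Ck_on_add)

lemma smooth_on_cmult:
  fixes f :: "'a::euclidean_space \<Rightarrow> real"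
  assumes "open S" "smooth_on S f"
  shows "smooth_on S (\<lambda>x. c * f x)"
  unfolding smooth_on_def
proof
  fix k
  have "Ck_on k S f" using assms(2) by (simp add: smooth_on_def)
  then show "Ck_on k S (\<lambda>x. c * f x)"
    by (rule Ck_on_bounded_linear_compose[OF assms(1) _ bounded_linear_mult_right])
qed

lemma smooth_on_real_polynomial:
  fixes f :: "real \<Rightarrow> real"
  assumes "real_polynomial_function f"
  shows "smooth_on UNIV f"
  using assms
proof induction
  case (linear f)
  then show ?case by (rule smooth_on_bounded_linear)
next
  case (const c)
  show ?case by (rule smooth_on_const)
next
  case (add f g)
  then show ?case by (intro smooth_on_add open_UNIV)
next
  case (mult f g)
  then show ?case by (auto simp: smooth_on_def intro: Ck_on_scaleR[of UNIV _ f g, simplified])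
qed

lemma smooth_on_has_derivative:
  assumes "smooth_on S f" "x \<in> S"
  shows "(f has_derivative frechet_derivative f (at x)) (at x)"
proof -
  have "Ck_on (Suc 0) S f" using assms(1) unfolding smooth_on_def by (rule spec)
  then have "f differentiable (at x)" using assms(2) by simp
  then show ?thesis by (simp add: frechet_derivative_works)
qed

lemma smooth_on_derivative:
  assumes "smooth_on S f"
  shows "smooth_on S (\<lambda>x. frechet_derivative f (at x) v)"
  unfolding smooth_on_def
proof
  fix k
  have "Ck_on (Suc k) S f" using assms(1) unfolding smooth_on_def by (rule spec)
  then show "Ck_on k S (\<lambda>x. frechet_derivative f (at x) v)" by simp
qed

lemma smooth_on_continuous_on:
  assumes "smooth_on S f"
  shows "continuous_on S f"
proof -
  have "Ck_on 0 S f" using assms(1) unfolding smooth_on_def by (rule spec)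
  then show ?thesis by simp
qed

lemma smooth_on_has_vector_derivative:
  fixes f :: "real \<Rightarrow> 'a::real_normed_vector"
  assumes "smooth_on S f" "x \<in> S"
  shows "(f has_vector_derivative frechet_derivative f (at x) 1) (at x)"
proof -
  have d: "(f has_derivative frechet_derivative f (at x)) (at x)"
    by (rule smooth_on_has_derivative[OF assms])
  have "frechet_derivative f (at x) v = v *\<^sub>R frechet_derivative f (at x) 1" for v
    using linear_scale[OF has_derivative_linear[OF d], of v 1] by (simp only: real_scaleR_def mult_1_right)
  then show ?thesis
    unfolding has_vector_derivative_def by (intro has_derivative_eq_rhs[OF d] ext)
qed

lemma MVT_direction:
  fixes f :: "'b::real_normed_vector \<Rightarrow> real"
  assumes "s > 0"
    and d: "\<And>\<theta>. 0 \<le> \<theta> \<Longrightarrow> \<theta> \<le> s \<Longrightarrow> (f has_derivative D (y + \<theta> *\<^sub>R a)) (at (y + \<theta> *\<^sub>R a))"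
  obtains \<theta> where "0 < \<theta>" "\<theta> < s" "f (y + s *\<^sub>R a) - f y = s * D (y + \<theta> *\<^sub>R a) a"
proof -
  have "((\<lambda>r. f (y + r *\<^sub>R a)) has_real_derivative D (y + \<theta> *\<^sub>R a) a) (at \<theta>)" if "0 \<le> \<theta>" "\<theta> \<le> s" for \<theta>
  proof -
    have "((\<lambda>r. y + r *\<^sub>R a) has_derivative (\<lambda>r. r *\<^sub>R a)) (at \<theta>)"
      by (auto intro!: derivative_eq_intros)
    from has_derivative_compose[of "\<lambda>r. y + r *\<^sub>R a" _ \<theta> UNIV f "D (y + \<theta> *\<^sub>R a)", OF this d[OF that]]
    have "((\<lambda>r. f (y + r *\<^sub>R a)) has_derivative (\<lambda>r. D (y + \<theta> *\<^sub>R a) (r *\<^sub>R a))) (at \<theta>)" .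
    moreover have "D (y + \<theta> *\<^sub>R a) (r *\<^sub>R a) = D (y + \<theta> *\<^sub>R a) a * r" for r
      using linear_scale[OF has_derivative_linear[OF d[OF that]], of r a] by simp
    ultimately show ?thesis
      by (simp add: has_field_derivative_def)
  qed
  from MVT2[OF assms(1) this] obtain \<theta> where "0 < \<theta>" "\<theta> < s"
    "f (y + s *\<^sub>R a) - f (y + 0 *\<^sub>R a) = (s - 0) * D (y + \<theta> *\<^sub>R a) a" by blast
  then show ?thesis by (intro that) auto
qed

text \<open>
  Two mean values in a row: first along \<open>a\<close> for the increment of \<open>f\<close> along \<open>b\<close>, then along \<open>b\<close> for
  the derivative of \<open>f\<close> along \<open>a\<close>. The second difference on the left is symmetric in \<open>a\<close> and \<open>b\<close>,
  whereas the right-hand side is not, and this is what makes mixed derivatives commute.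
\<close>
lemma second_difference_quotient:
  fixes f :: "'b::euclidean_space \<Rightarrow> real"
  assumes S: "open S" "smooth_on S f" and s: "s > 0"
    and in_S: "\<And>\<theta> \<eta>. 0 \<le> \<theta> \<Longrightarrow> \<theta> \<le> s \<Longrightarrow> 0 \<le> \<eta> \<Longrightarrow> \<eta> \<le> s \<Longrightarrow> x + \<theta> *\<^sub>R a + \<eta> *\<^sub>R b \<in> S"
  obtains \<theta> \<eta> where "0 < \<theta>" "\<theta> < s" "0 < \<eta>" "\<eta> < s"
    "f (x + s *\<^sub>R a + s *\<^sub>R b) - f (x + s *\<^sub>R a) - f (x + s *\<^sub>R b) + f x
      = s * s * frechet_derivative (\<lambda>y. frechet_derivative f (at y) a) (at (x + \<theta> *\<^sub>R a + \<eta> *\<^sub>R b)) b"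
proof -
  let ?D = "\<lambda>y. frechet_derivative f (at y)"
  have "((\<lambda>y. f (y + s *\<^sub>R b) - f y) has_derivative (\<lambda>v. ?D (y + s *\<^sub>R b) v - ?D y v)) (at y)"
    if "y = x + \<theta> *\<^sub>R a" "0 \<le> \<theta>" "\<theta> \<le> s" for \<theta> y
  proof -
    have "y + s *\<^sub>R b \<in> S" "y \<in> S"
      using in_S[of \<theta> s] in_S[of \<theta> 0] that s by auto
    have shift: "((\<lambda>y. y + s *\<^sub>R b) has_derivative (\<lambda>v. v)) (at y)"
      by (auto intro!: derivative_eq_intros)
    have "((\<lambda>y. f (y + s *\<^sub>R b)) has_derivative ?D (y + s *\<^sub>R b)) (at y)"
      by (rule has_derivative_compose[of "\<lambda>y. y + s *\<^sub>R b" "\<lambda>v. v" y UNIV f, OF shift])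
        (rule smooth_on_has_derivative[OF S(2) \<open>y + s *\<^sub>R b \<in> S\<close>])
    then show ?thesis
      by (rule has_derivative_diff[OF _ smooth_on_has_derivative[OF S(2) \<open>y \<in> S\<close>]])
  qed
  from MVT_direction[OF s this[OF refl]] obtain \<theta> where \<theta>: "0 < \<theta>" "\<theta> < s"
    and 1: "f (x + s *\<^sub>R a + s *\<^sub>R b) - f (x + s *\<^sub>R a) - (f (x + s *\<^sub>R b) - f x)
      = s * (?D (x + \<theta> *\<^sub>R a + s *\<^sub>R b) a - ?D (x + \<theta> *\<^sub>R a) a)"
    by blast
  have "((\<lambda>y. ?D y a) has_derivative frechet_derivative (\<lambda>y. ?D y a) (at (x + \<theta> *\<^sub>R a + \<eta> *\<^sub>R b)))
      (at (x + \<theta> *\<^sub>R a + \<eta> *\<^sub>R b))" if "0 \<le> \<eta>" "\<eta> \<le> s" for \<eta>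
    using that \<theta> in_S by (intro smooth_on_has_derivative[OF smooth_on_derivative[OF S(2)]]) auto
  from MVT_direction[OF s this] obtain \<eta> where "0 < \<eta>" "\<eta> < s"
    "?D (x + \<theta> *\<^sub>R a + s *\<^sub>R b) a - ?D (x + \<theta> *\<^sub>R a) a
      = s * frechet_derivative (\<lambda>y. ?D y a) (at (x + \<theta> *\<^sub>R a + \<eta> *\<^sub>R b)) b"
    by blast
  with 1 \<theta> show ?thesis by (intro that[of \<theta> \<eta>]) auto
qed

lemma mixed_derivatives_commute_real:
  fixes f :: "'b::euclidean_space \<Rightarrow> real"
  assumes S: "open S" "smooth_on S f" "x \<in> S"
  shows "frechet_derivative (\<lambda>y. frechet_derivative f (at y) a) (at x) b
       = frechet_derivative (\<lambda>y. frechet_derivative f (at y) b) (at x) a"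
proof -
  let ?A = "\<lambda>y. frechet_derivative (\<lambda>y. frechet_derivative f (at y) a) (at y) b"
  let ?B = "\<lambda>y. frechet_derivative (\<lambda>y. frechet_derivative f (at y) b) (at y) a"
  have lim: "continuous_on S ?A" "continuous_on S ?B"
    by (intro smooth_on_continuous_on smooth_on_derivative S(2))+
  have "\<bar>?A x - ?B x\<bar> < e" if "e > 0" for e
  proof -
    have "isCont ?A x" "isCont ?B x"
      using lim S by (auto simp: continuous_on_eq_continuous_at)
    then have cA: "\<forall>\<epsilon>>0. \<exists>\<delta>>0. \<forall>y. dist y x < \<delta> \<longrightarrow> dist (?A y) (?A x) < \<epsilon>"
      and cB: "\<forall>\<epsilon>>0. \<exists>\<delta>>0. \<forall>y. dist y x < \<delta> \<longrightarrow> dist (?B y) (?B x) < \<epsilon>"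
      by (simp_all only: continuous_at_eps_delta)
    have "e / 2 > 0" using \<open>e > 0\<close> by simp
    obtain d1 where d1: "d1 > 0" "\<And>y. dist y x < d1 \<Longrightarrow> dist (?A y) (?A x) < e/2"
      using cA[rule_format, OF \<open>e / 2 > 0\<close>] by auto
    obtain d2 where d2: "d2 > 0" "\<And>y. dist y x < d2 \<Longrightarrow> dist (?B y) (?B x) < e/2"
      using cB[rule_format, OF \<open>e / 2 > 0\<close>] by auto
    obtain d3 where d3: "d3 > 0" "ball x d3 \<subseteq> S"
      using openE[OF S(1,3)] by auto
    define d where "d = min d1 (min d2 d3)"
    define s where "s = d / (2 * (norm a + norm b + 1))"
    have nn: "norm a + norm b + 1 > 0" using norm_ge_zero[of a] norm_ge_zero[of b] by linarith
    have d0: "d > 0" using d1 d2 d3 by (auto simp: d_def)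
    then have s: "s > 0" using nn by (simp add: s_def)
    have near: "dist (x + \<theta> *\<^sub>R a + \<eta> *\<^sub>R b) x < d" if "0 \<le> \<theta>" "\<theta> \<le> s" "0 \<le> \<eta>" "\<eta> \<le> s" for \<theta> \<eta>
    proof -
      have "dist (x + \<theta> *\<^sub>R a + \<eta> *\<^sub>R b) x \<le> \<theta> * norm a + \<eta> * norm b"
        using that norm_triangle_ineq[of "\<theta> *\<^sub>R a" "\<eta> *\<^sub>R b"] by (simp add: dist_norm add.assoc)
      also have "\<dots> \<le> s * norm a + s * norm b"
        using that by (intro add_mono mult_right_mono) auto
      also have "\<dots> \<le> s * (norm a + norm b + 1)" using s by (simp add: algebra_simps)
      also have "\<dots> = d / 2" unfolding s_def using nn by (simp add: field_simps)
      finally show ?thesis using d0 by simp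
    qed
    have in_S: "x + \<theta> *\<^sub>R a + \<eta> *\<^sub>R b \<in> S" if "0 \<le> \<theta>" "\<theta> \<le> s" "0 \<le> \<eta>" "\<eta> \<le> s" for \<theta> \<eta>
      using near[OF that] d3 by (auto simp: d_def dist_commute)
    have in_S': "x + \<theta> *\<^sub>R b + \<eta> *\<^sub>R a \<in> S" if "0 \<le> \<theta>" "\<theta> \<le> s" "0 \<le> \<eta>" "\<eta> \<le> s" for \<theta> \<eta>
      using in_S[OF that(3,4,1,2)] by (simp add: algebra_simps)
    obtain \<theta> \<eta> where 1: "0 < \<theta>" "\<theta> < s" "0 < \<eta>" "\<eta> < s"
      "f (x + s *\<^sub>R a + s *\<^sub>R b) - f (x + s *\<^sub>R a) - f (x + s *\<^sub>R b) + f x = s * s * ?A (x + \<theta> *\<^sub>R a + \<eta> *\<^sub>R b)"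
      using second_difference_quotient[OF S(1,2) s in_S] by blast
    obtain \<theta>' \<eta>' where 2: "0 < \<theta>'" "\<theta>' < s" "0 < \<eta>'" "\<eta>' < s"
      "f (x + s *\<^sub>R b + s *\<^sub>R a) - f (x + s *\<^sub>R b) - f (x + s *\<^sub>R a) + f x = s * s * ?B (x + \<theta>' *\<^sub>R b + \<eta>' *\<^sub>R a)"
      using second_difference_quotient[OF S(1,2) s in_S'] by blast
    have eq: "x + s *\<^sub>R b + s *\<^sub>R a = x + s *\<^sub>R a + s *\<^sub>R b" by (simp add: algebra_simps)
    have "s * s * ?A (x + \<theta> *\<^sub>R a + \<eta> *\<^sub>R b) = s * s * ?B (x + \<theta>' *\<^sub>R b + \<eta>' *\<^sub>R a)"
      using 1(5) 2(5)[unfolded eq] by linarith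
    then have h1: "?A (x + \<theta> *\<^sub>R a + \<eta> *\<^sub>R b) = ?B (x + \<theta>' *\<^sub>R b + \<eta>' *\<^sub>R a)"
      using s by simp
    have h2: "dist (?A (x + \<theta> *\<^sub>R a + \<eta> *\<^sub>R b)) (?A x) < e/2"
      using near[of \<theta> \<eta>] 1 by (intro d1) (auto simp: d_def)
    have h3: "dist (?B (x + \<theta>' *\<^sub>R b + \<eta>' *\<^sub>R a)) (?B x) < e/2"
      using near[of \<eta>' \<theta>'] 2 by (intro d2) (auto simp: d_def algebra_simps)
    show ?thesis using h1 h2 h3 unfolding dist_real_def by linarith
  qed
  from this[of "\<bar>?A x - ?B x\<bar>"] show ?thesis by auto
qed

lemma mixed_derivatives_commute:
  fixes f :: "'b::euclidean_space \<Rightarrow> 'c::euclidean_space"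
  assumes S: "open S" "smooth_on S f" "x \<in> S"
  shows "frechet_derivative (\<lambda>y. frechet_derivative f (at y) a) (at x) b
       = frechet_derivative (\<lambda>y. frechet_derivative f (at y) b) (at x) a"
proof (rule euclidean_eqI)
  fix i :: 'c assume i: "i \<in> Basis"
  have sm: "smooth_on S (\<lambda>y. f y \<bullet> i)"
    using S(2) Ck_on_bounded_linear_compose[OF S(1) _ bounded_linear_inner_left] unfolding smooth_on_def by metis
  have inner: "frechet_derivative (\<lambda>y. g y \<bullet> i) (at y) = (\<lambda>v. frechet_derivative g (at y) v \<bullet> i)"
    if "smooth_on S g" "y \<in> S" for g :: "'b \<Rightarrow> 'c" and y
    by (rule frechet_derivative_at[symmetric, OF has_derivative_inner_left[OF smooth_on_has_derivative[OF that]]])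
  have *: "frechet_derivative (\<lambda>y. frechet_derivative f (at y) a) (at x) b \<bullet> i
      = frechet_derivative (\<lambda>y. frechet_derivative (\<lambda>y. f y \<bullet> i) (at y) a) (at x) b" for a b
  proof -
    have "frechet_derivative (\<lambda>y. frechet_derivative f (at y) a \<bullet> i) (at x)
       = frechet_derivative (\<lambda>y. frechet_derivative (\<lambda>y. f y \<bullet> i) (at y) a) (at x)"
    proof (rule frechet_derivative_transform_within_open[OF _ S(1) S(3)])
      show "(\<lambda>y. frechet_derivative f (at y) a \<bullet> i) differentiable at x"
        by (rule differentiableI[OF has_derivative_inner_left[OF smooth_on_has_derivative[OF
          smooth_on_derivative[OF S(2)] S(3)]]])
    qed (simp add: inner[OF S(2)])
    from fun_cong[OF this, of b] show ?thesis
      by (simp add: inner[OF smooth_on_derivative[OF S(2)] S(3)])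
  qed
  show "frechet_derivative (\<lambda>y. frechet_derivative f (at y) a) (at x) b \<bullet> i
       = frechet_derivative (\<lambda>y. frechet_derivative f (at y) b) (at x) a \<bullet> i"
    unfolding * by (rule mixed_derivatives_commute_real[OF S(1) sm S(3)])
qed

lemma has_vector_derivative_shift:
  fixes f :: "real \<Rightarrow> 'b::real_normed_vector"
  shows "((\<lambda>x. f (x - s)) has_vector_derivative v) (at (t + s) within {a + s..b + s})
     \<longleftrightarrow> (f has_vector_derivative v) (at t within {a..b})"
proof -
  have *: "((\<lambda>x. g (x - r)) has_vector_derivative v) (at (u + r) within {c + r..d + r})"
    if "(g has_vector_derivative v) (at u within {c..d})" for g :: "real \<Rightarrow> 'b" and r u c d
  proof -
    have 1: "((\<lambda>x. x - r) has_vector_derivative 1) (at (u + r) within {c + r..d + r})"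
      by (auto intro!: derivative_eq_intros)
    have "(\<lambda>x. x - r) ` {c + r..d + r} = {c..d}"
    proof
      show "{c..d} \<subseteq> (\<lambda>x. x - r) ` {c + r..d + r}"
      proof
        fix x assume "x \<in> {c..d}"
        then show "x \<in> (\<lambda>x. x - r) ` {c + r..d + r}" by (intro rev_image_eqI[of "x + r"]) auto
      qed
    qed auto
    then have 2: "(g has_vector_derivative v) (at (u + r - r) within (\<lambda>x. x - r) ` {c + r..d + r})"
      using that by simp
    from vector_diff_chain_within[OF 1 2] show ?thesis by (simp add: o_def)
  qed
  show ?thesis
  proof
    assume "((\<lambda>x. f (x - s)) has_vector_derivative v) (at (t + s) within {a + s..b + s})"
    from *[OF this, of "- s"] show "(f has_vector_derivative v) (at t within {a..b})" by simp
  qed (rule *)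
qed

lemma difference_quotient_tendsto:
  fixes f :: "real \<Rightarrow> 'b::real_normed_vector"
  assumes "(f has_vector_derivative v) (at 0)" "f 0 = 0"
  shows "((\<lambda>\<epsilon>. (1 / \<epsilon>) *\<^sub>R f \<epsilon>) \<longlongrightarrow> v) (at 0)"
proof -
  have "((\<lambda>y. norm ((f y - f 0) - (y - 0) *\<^sub>R v) / norm (y - 0)) \<longlongrightarrow> 0) (at 0)"
    using assms(1) unfolding has_vector_derivative_def has_derivative_iff_norm by blast
  moreover have "norm ((f y - f 0) - (y - 0) *\<^sub>R v) / norm (y - 0) = norm ((1 / y) *\<^sub>R f y - v)" if "y \<noteq> 0" for y
  proof -
    have "(1 / y) *\<^sub>R f y - v = (1 / y) *\<^sub>R (f y - y *\<^sub>R v)" using that by (simp add: scaleR_diff_right)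
    then show ?thesis using assms(2) by (simp add: divide_inverse mult.commute)
  qed
  then have "\<forall>\<^sub>F y in at 0. norm ((f y - f 0) - (y - 0) *\<^sub>R v) / norm (y - 0) = norm ((1 / y) *\<^sub>R f y - v)"
    by (auto simp: eventually_at_filter)
  ultimately have "((\<lambda>y. norm ((1 / y) *\<^sub>R f y - v)) \<longlongrightarrow> 0) (at 0)"
    by (rule Lim_transform_eventually)
  then show ?thesis by (simp only: tendsto_norm_zero_iff LIM_zero_iff)
qed

text \<open>
  A curve is going to be dragged along the flow for a time that has to grow faster than its length
  grows. Since the derivative of that time only has to exceed the speed \<open>u\<close>, and does not have to
  be equal to it, it can be taken to be a polynomial; so a merely continuous \<open>u\<close> causes no loss of
  smoothness. The slack between \<open>r\<close> and the integral of \<open>u\<close> pays for the approximation error.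
\<close>
lemma smooth_majorant_primitive:
  fixes u :: "real \<Rightarrow> real"
  assumes "a < b" "continuous_on {a..b} u" "integral {a..b} u < r"
  obtains f g where "smooth_on UNIV f" "\<And>t. (f has_real_derivative g t) (at t)" "\<And>t. t \<in> {a..b} \<Longrightarrow> u t < g t"
    "continuous_on {a..b} g" "f a = s" "f b = s + r"
proof -
  define \<epsilon> where "\<epsilon> = (r - integral {a..b} u) / (2 * (b - a))"
  have \<epsilon>: "\<epsilon> > 0" using assms by (simp add: \<epsilon>_def)
  obtain p where p: "real_polynomial_function p" "\<And>t. t \<in> {a..b} \<Longrightarrow> \<bar>u t - p t\<bar> < \<epsilon>"
    using Stone_Weierstrass_real_polynomial_function[OF compact_Icc assms(2) \<epsilon>] by metis
  obtain c n where c: "p = (\<lambda>t. \<Sum>i\<le>n. c i * t ^ i)"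
    using p(1) real_polynomial_function_iff_sum by metis
  define P where "P t = (\<Sum>i\<le>n. c i / real (Suc i) * t ^ Suc i)" for t
  have P: "(P has_real_derivative p t) (at t)" for t
  proof -
    have "((\<lambda>t. c i / real (Suc i) * t ^ Suc i) has_real_derivative c i * t ^ i) (at t)" for i
      by (rule DERIV_cong[OF DERIV_cmult[OF DERIV_pow]]) simp
    then show ?thesis unfolding P_def c by (intro DERIV_sum)
  qed
  have polyP: "real_polynomial_function P"
    unfolding P_def
    by (intro real_polynomial_function_sum real_polynomial_function.intros(4) real_polynomial_function.intros(2)
        real_polynomial_function_power real_polynomial_function.intros(1) bounded_linear_ident) auto
  \<comment> \<open>Raising the polynomial by a constant makes its integral equal to \<open>r\<close>; that constant is at least
    the approximation error, so the raised polynomial lies above \<open>u\<close>.\<close>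
  define k where "k = (r - (P b - P a)) / (b - a)"
  define f where "f t = s + (P t - P a) + k * (t - a)" for t
  have "(p has_integral (P b - P a)) {a..b}"
    using assms(1) P
    by (intro fundamental_theorem_of_calculus)
      (auto simp: has_real_derivative_iff_has_vector_derivative has_vector_derivative_at_within)
  moreover have "((\<lambda>t. u t + \<epsilon>) has_integral (integral {a..b} u + \<epsilon> * (b - a))) {a..b}"
    using has_integral_add[OF integrable_integral[OF integrable_continuous_real[OF assms(2)]]
        has_integral_const_real[of \<epsilon> a b]] assms(1) by (simp add: mult.commute)
  moreover have "p t \<le> u t + \<epsilon>" if "t \<in> {a..b}" for t
    using p(2)[OF that] by linarith
  ultimately have "P b - P a \<le> integral {a..b} u + \<epsilon> * (b - a)" by (rule has_integral_le)
  also have "\<dots> = r - \<epsilon> * (b - a)" using assms(1) by (simp add: \<epsilon>_def field_simps)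
  finally have k: "\<epsilon> \<le> k" using assms(1) by (simp add: k_def field_simps)
  show ?thesis
  proof
    have "real_polynomial_function f"
      unfolding f_def
      by (intro real_polynomial_function.intros(3) real_polynomial_function.intros(4) real_polynomial_function.intros(2)
          real_polynomial_function_diff polyP real_polynomial_function.intros(1) bounded_linear_ident)
    then show "smooth_on UNIV f" by (rule smooth_on_real_polynomial)
    show "(f has_real_derivative p t + k) (at t)" for t
      unfolding f_def by (auto intro!: derivative_eq_intros P)
    show "u t < p t + k" if "t \<in> {a..b}" for t using p(2)[OF that] k by linarith
    show "continuous_on {a..b} (\<lambda>t. p t + k)"
      unfolding c by (intro continuous_intros)
    show "f a = s" by (simp add: f_def)
    show "f b = s + r" using assms(1) by (simp add: f_def k_def)
  qed
qed

lemma bilinear_expand_axis: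
  fixes B :: "real ^ 'n \<Rightarrow> real ^ 'n \<Rightarrow> real"
  assumes "bilinear B"
  shows "B u v = (\<Sum>i\<in>UNIV. \<Sum>j\<in>UNIV. u $ i * v $ j * B (axis i 1) (axis j 1))"
proof -
  have l: "linear (\<lambda>a. B a z)" "linear (B z)" for z
    using assms by (auto simp: bilinear_def)
  have e: "z = (\<Sum>i\<in>UNIV. (z $ i) *\<^sub>R axis i 1)" for z :: "real ^ 'n"
    using basis_expansion[of z] by (simp add: scalar_mult_eq_scaleR)
  have "B u v = B (\<Sum>i\<in>UNIV. (u $ i) *\<^sub>R axis i 1) v" using e[of u] by simp
  also have "\<dots> = (\<Sum>i\<in>UNIV. u $ i * B (axis i 1) v)"
    by (simp add: linear_sum[OF l(1)] linear_scale[OF l(1)])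
  also have "\<dots> = (\<Sum>i\<in>UNIV. u $ i * B (axis i 1) (\<Sum>j\<in>UNIV. (v $ j) *\<^sub>R axis j 1))"
    using e[of v] by simp
  also have "\<dots> = (\<Sum>i\<in>UNIV. \<Sum>j\<in>UNIV. u $ i * v $ j * B (axis i 1) (axis j 1))"
    by (simp add: linear_sum[OF l(2)] linear_scale[OF l(2)] sum_distrib_left mult.assoc)
  finally show ?thesis .
qed

section \<open>Charts and tangent vectors\<close>

locale atlas =
  fixes \<A> :: "('a::{t2_space,second_countable_topology}, 'n::finite) chart set"
  assumes smooth_atlas: "smooth_atlas \<A>"
begin

lemma chart_around: obtains \<kappa> where "\<kappa> \<in> \<A>" "x \<in> chart_dom \<kappa>"
proof -
  have "x \<in> (\<Union>\<kappa>\<in>\<A>. chart_dom \<kappa>)" using smooth_atlas by (simp add: smooth_atlas_def)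
  then show ?thesis using that by blast
qed

context
  fixes \<kappa> assumes \<kappa>: "\<kappa> \<in> \<A>"
begin

lemma chart_homeomorphism: "homeomorphism (chart_dom \<kappa>) (chart_img \<kappa>) (chart_map \<kappa>) (chart_inv \<kappa>)"
  using smooth_atlas \<kappa> by (simp add: smooth_atlas_def)

lemma open_chart_dom: "open (chart_dom \<kappa>)"
  using smooth_atlas \<kappa> by (simp add: smooth_atlas_def)

lemma open_chart_img: "open (chart_img \<kappa>)"
  using smooth_atlas \<kappa> by (simp add: smooth_atlas_def)

lemma chart_inv_map [simp]: "x \<in> chart_dom \<kappa> \<Longrightarrow> chart_inv \<kappa> (chart_map \<kappa> x) = x"
  using chart_homeomorphism by (simp add: homeomorphism_def)

lemma chart_map_inv [simp]: "\<xi> \<in> chart_img \<kappa> \<Longrightarrow> chart_map \<kappa> (chart_inv \<kappa> \<xi>) = \<xi>"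
  using chart_homeomorphism by (simp add: homeomorphism_def)

lemma chart_map_in_img [simp]: "x \<in> chart_dom \<kappa> \<Longrightarrow> chart_map \<kappa> x \<in> chart_img \<kappa>"
  by (simp add: chart_img_def)

lemma chart_inv_in_dom [simp]: "\<xi> \<in> chart_img \<kappa> \<Longrightarrow> chart_inv \<kappa> \<xi> \<in> chart_dom \<kappa>"
  using chart_homeomorphism by (auto simp: homeomorphism_def)

lemma continuous_on_chart_inv: "continuous_on (chart_img \<kappa>) (chart_inv \<kappa>)"
  using chart_homeomorphism by (simp add: homeomorphism_def)

end

lemma overlap_image:
  assumes "\<kappa> \<in> \<A>"
  shows "chart_map \<kappa> ` (chart_dom \<kappa> \<inter> U) = chart_img \<kappa> \<inter> chart_inv \<kappa> -` U"
proof
  show "chart_map \<kappa> ` (chart_dom \<kappa> \<inter> U) \<subseteq> chart_img \<kappa> \<inter> chart_inv \<kappa> -` U"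
    using assms by auto
  show "chart_img \<kappa> \<inter> chart_inv \<kappa> -` U \<subseteq> chart_map \<kappa> ` (chart_dom \<kappa> \<inter> U)"
  proof
    fix \<xi> assume "\<xi> \<in> chart_img \<kappa> \<inter> chart_inv \<kappa> -` U"
    then show "\<xi> \<in> chart_map \<kappa> ` (chart_dom \<kappa> \<inter> U)"
      using assms by (intro image_eqI[of _ _ "chart_inv \<kappa> \<xi>"]) auto
  qed
qed

lemma open_overlap:
  assumes "\<kappa> \<in> \<A>" "open U"
  shows "open (chart_img \<kappa> \<inter> chart_inv \<kappa> -` U)"
  using continuous_open_preimage[OF continuous_on_chart_inv[OF assms(1)] open_chart_img[OF assms(1)] assms(2)] .

lemma smooth_transition:
  assumes "\<kappa> \<in> \<A>" "\<mu> \<in> \<A>"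
  shows "smooth_on (chart_img \<kappa> \<inter> chart_inv \<kappa> -` chart_dom \<mu>) (chart_map \<mu> \<circ> chart_inv \<kappa>)"
proof -
  have "smooth_on (chart_map \<kappa> ` (chart_dom \<kappa> \<inter> chart_dom \<mu>)) (chart_map \<mu> \<circ> chart_inv \<kappa>)"
    using smooth_atlas assms by (simp add: smooth_atlas_def)
  then show ?thesis by (simp only: overlap_image[OF assms(1)])
qed

abbreviation transition_deriv where
  "transition_deriv \<kappa> \<mu> \<xi> \<equiv> frechet_derivative (chart_map \<mu> \<circ> chart_inv \<kappa>) (at \<xi>)"

lemma transition_has_derivative:
  assumes "\<kappa> \<in> \<A>" "\<mu> \<in> \<A>" "x \<in> chart_dom \<kappa>" "x \<in> chart_dom \<mu>"
  shows "((chart_map \<mu> \<circ> chart_inv \<kappa>) has_derivative transition_deriv \<kappa> \<mu> (chart_map \<kappa> x)) (at (chart_map \<kappa> x))"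
  by (rule smooth_on_has_derivative[OF smooth_transition[OF assms(1,2)]]) (use assms in simp)

lemma linear_transition_deriv:
  assumes "\<kappa> \<in> \<A>" "\<mu> \<in> \<A>" "x \<in> chart_dom \<kappa>" "x \<in> chart_dom \<mu>"
  shows "linear (transition_deriv \<kappa> \<mu> (chart_map \<kappa> x))"
  by (rule has_derivative_linear[OF transition_has_derivative[OF assms]])

text \<open>
  The chain rule behind every change of coordinates below. It is stated for a family of points
  \<open>g q\<close> with parameters in an arbitrary space, so that it applies to curves, to inverse charts and
  to the flow alike.
\<close>
lemma change_of_chart:
  assumes "\<kappa> \<in> \<A>" "\<mu> \<in> \<A>" and U: "open U" "p \<in> U" "\<And>q. q \<in> U \<Longrightarrow> g q \<in> chart_dom \<kappa> \<inter> chart_dom \<mu>"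
    and G: "((\<lambda>q. chart_map \<kappa> (g q)) has_derivative G) (at p)"
  shows "((\<lambda>q. chart_map \<mu> (g q)) has_derivative (\<lambda>v. transition_deriv \<kappa> \<mu> (chart_map \<kappa> (g p)) (G v))) (at p)"
proof -
  have D: "((chart_map \<mu> \<circ> chart_inv \<kappa>) has_derivative transition_deriv \<kappa> \<mu> (chart_map \<kappa> (g p)))
      (at (chart_map \<kappa> (g p)))"
    by (rule transition_has_derivative) (use assms in auto)
  have "((\<lambda>q. (chart_map \<mu> \<circ> chart_inv \<kappa>) (chart_map \<kappa> (g q))) has_derivative
      (\<lambda>v. transition_deriv \<kappa> \<mu> (chart_map \<kappa> (g p)) (G v))) (at p)"
    by (rule has_derivative_compose[of "\<lambda>q. chart_map \<kappa> (g q)" G p UNIV "chart_map \<mu> \<circ> chart_inv \<kappa>", OF G D])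
  then show ?thesis
    by (rule has_derivative_transform_within_open[OF _ U(1,2)]) (use assms in auto)
qed

lemma transition_deriv_compose:
  assumes "\<kappa> \<in> \<A>" "\<mu> \<in> \<A>" "\<nu> \<in> \<A>" "x \<in> chart_dom \<kappa>" "x \<in> chart_dom \<mu>" "x \<in> chart_dom \<nu>"
  shows "transition_deriv \<mu> \<nu> (chart_map \<mu> x) (transition_deriv \<kappa> \<mu> (chart_map \<kappa> x) v)
       = transition_deriv \<kappa> \<nu> (chart_map \<kappa> x) v"
proof -
  let ?U = "chart_img \<kappa> \<inter> chart_inv \<kappa> -` (chart_dom \<mu> \<inter> chart_dom \<nu>)"
  have "((\<lambda>q. chart_map \<nu> (chart_inv \<kappa> q)) has_derivative
     (\<lambda>v. transition_deriv \<mu> \<nu> (chart_map \<mu> (chart_inv \<kappa> (chart_map \<kappa> x)))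
        (transition_deriv \<kappa> \<mu> (chart_map \<kappa> x) v))) (at (chart_map \<kappa> x))"
  proof (rule change_of_chart[of \<mu> \<nu> ?U])
    show "open ?U" by (intro open_overlap open_Int open_chart_dom assms)
    show "((\<lambda>q. chart_map \<mu> (chart_inv \<kappa> q)) has_derivative transition_deriv \<kappa> \<mu> (chart_map \<kappa> x)) (at (chart_map \<kappa> x))"
      using transition_has_derivative[OF assms(1,2,4,5)] by (simp add: o_def)
  qed (use assms in auto)
  from frechet_derivative_at[OF this] show ?thesis
    using assms by (simp add: o_def fun_eq_iff)
qed

lemma coord_vec_apply:
  assumes "\<kappa> \<in> \<A>" "x \<in> chart_dom \<kappa>" "\<mu> \<in> \<A>" "x \<in> chart_dom \<mu>"
  shows "coord_vec \<A> \<kappa> (chart_map \<kappa> x) u \<mu> = transition_deriv \<kappa> \<mu> (chart_map \<kappa> x) u"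
  using assms by (simp add: coord_vec_def)

lemma coord_vec_tangent:
  assumes "\<kappa> \<in> \<A>" "x \<in> chart_dom \<kappa>"
  shows "coord_vec \<A> \<kappa> (chart_map \<kappa> x) u \<in> tangent_space \<A> x"
  unfolding tangent_space_def
  using assms by (auto simp: coord_vec_apply transition_deriv_compose) (auto simp: coord_vec_def)

lemma tangent_space_transition:
  assumes "y \<in> tangent_space \<A> x" "\<kappa> \<in> \<A>" "\<mu> \<in> \<A>" "x \<in> chart_dom \<kappa>" "x \<in> chart_dom \<mu>"
  shows "y \<mu> = transition_deriv \<kappa> \<mu> (chart_map \<kappa> x) (y \<kappa>)"
  using assms unfolding tangent_space_def by blast

lemma tangent_space_outside:
  assumes "y \<in> tangent_space \<A> x" "\<not> (\<kappa> \<in> \<A> \<and> x \<in> chart_dom \<kappa>)"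
  shows "y \<kappa> = 0"
  using assms unfolding tangent_space_def by blast

lemma tangent_eqI:
  assumes "y \<in> tangent_space \<A> x" "z \<in> tangent_space \<A> x" "\<kappa> \<in> \<A>" "x \<in> chart_dom \<kappa>" "y \<kappa> = z \<kappa>"
  shows "y = z"
proof
  fix \<mu>
  show "y \<mu> = z \<mu>"
  proof (cases "\<mu> \<in> \<A> \<and> x \<in> chart_dom \<mu>")
    case True
    then show ?thesis
      using tangent_space_transition[OF assms(1,3) _ assms(4)] tangent_space_transition[OF assms(2,3) _ assms(4)]
        assms(5) by metis
  next
    case False
    then show ?thesis using tangent_space_outside assms(1,2) by metis
  qed
qed

lemma transition_deriv_self:
  assumes "\<kappa> \<in> \<A>" "x \<in> chart_dom \<kappa>"
  shows "transition_deriv \<kappa> \<kappa> (chart_map \<kappa> x) u = u"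
proof -
  have "((\<lambda>\<xi>. \<xi>) has_derivative (\<lambda>v. v)) (at (chart_map \<kappa> x))" by (rule has_derivative_ident)
  then have "((chart_map \<kappa> \<circ> chart_inv \<kappa>) has_derivative (\<lambda>v. v)) (at (chart_map \<kappa> x))"
    by (rule has_derivative_transform_within_open[OF _ open_chart_img[OF assms(1)]]) (use assms in auto)
  from frechet_derivative_at[OF this] show ?thesis by metis
qed

lemma coord_vec_tangent_eq:
  assumes "y \<in> tangent_space \<A> x" "\<kappa> \<in> \<A>" "x \<in> chart_dom \<kappa>"
  shows "coord_vec \<A> \<kappa> (chart_map \<kappa> x) (y \<kappa>) = y"
  by (rule tangent_eqI[OF coord_vec_tangent[OF assms(2,3)] assms])
    (simp add: coord_vec_apply[OF assms(2,3,2,3)] transition_deriv_self[OF assms(2,3)])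

lemma tangent_space_add_scaleR:
  assumes "y \<in> tangent_space \<A> x" "z \<in> tangent_space \<A> x"
  shows "(\<lambda>\<mu>. y \<mu> + r *\<^sub>R z \<mu>) \<in> tangent_space \<A> x"
proof -
  have "y \<mu> + r *\<^sub>R z \<mu> = transition_deriv \<kappa> \<mu> (chart_map \<kappa> x) (y \<kappa> + r *\<^sub>R z \<kappa>)"
    if "\<kappa> \<in> \<A>" "\<mu> \<in> \<A>" "x \<in> chart_dom \<kappa>" "x \<in> chart_dom \<mu>" for \<kappa> \<mu>
    using linear_transition_deriv[OF that] tangent_space_transition[OF assms(1) that]
      tangent_space_transition[OF assms(2) that] by (simp only: linear_add linear_scale)
  moreover have "y \<kappa> + r *\<^sub>R z \<kappa> = 0" if "\<not> (\<kappa> \<in> \<A> \<and> x \<in> chart_dom \<kappa>)" for \<kappa>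
    using tangent_space_outside[OF assms(1) that] tangent_space_outside[OF assms(2) that] by simp
  ultimately show ?thesis unfolding tangent_space_def by blast
qed

lemma velocity_tangent_eqI:
  assumes \<kappa>: "\<kappa> \<in> \<A>" and t: "open J" "t \<in> J" "continuous_on J c" "c t \<in> chart_dom \<kappa>"
    and y: "y \<in> tangent_space \<A> (c t)"
    and v: "((\<lambda>s. chart_map \<kappa> (c s)) has_vector_derivative y \<kappa>) (at t)"
  shows "velocity \<A> c J t = y"
proof
  fix \<mu>
  show "velocity \<A> c J t \<mu> = y \<mu>"
  proof (cases "\<mu> \<in> \<A> \<and> c t \<in> chart_dom \<mu>")
    case True
    let ?U = "J \<inter> c -` (chart_dom \<kappa> \<inter> chart_dom \<mu>)"
    have "open ?U"
      by (intro continuous_open_preimage open_Int open_chart_dom \<kappa> t conjunct1[OF True])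
    then have "((\<lambda>s. chart_map \<mu> (c s)) has_derivative
        (\<lambda>r. transition_deriv \<kappa> \<mu> (chart_map \<kappa> (c t)) (r *\<^sub>R y \<kappa>))) (at t)"
      using True t v[unfolded has_vector_derivative_def]
      by (intro change_of_chart[OF \<kappa> _ \<open>open ?U\<close>]) auto
    moreover have "transition_deriv \<kappa> \<mu> (chart_map \<kappa> (c t)) (r *\<^sub>R y \<kappa>) = r *\<^sub>R y \<mu>" for r
      using linear_scale[OF linear_transition_deriv[OF \<kappa> _ t(4), of \<mu>], of r "y \<kappa>"] True
        tangent_space_transition[OF y \<kappa> _ t(4), of \<mu>] by simp
    ultimately have "((\<lambda>s. chart_map \<mu> (c s)) has_vector_derivative y \<mu>) (at t)"
      unfolding has_vector_derivative_def by (simp only:)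
    then have "vector_derivative (\<lambda>s. chart_map \<mu> (c s)) (at t) = y \<mu>"
      by (rule vector_derivative_at)
    moreover have "at t within J = at t" by (rule at_within_open[OF t(2,1)])
    ultimately show ?thesis
      using True by (simp add: velocity_def o_def)
  next
    case False
    then show ?thesis using tangent_space_outside[OF y] by (auto simp: velocity_def)
  qed
qed

lemma open_chart_preimage:
  assumes "continuous_on J c" "open J" "\<kappa> \<in> \<A>"
  shows "open {t \<in> J. c t \<in> chart_dom \<kappa>}"
  using continuous_open_preimage[OF assms(1,2) open_chart_dom[OF assms(3)]]
  by (simp add: vimage_def Int_def)

lemma velocity_has_vector_derivative:
  assumes "open J" "smooth_curve_on \<A> J c" "t \<in> J" "\<kappa> \<in> \<A>" "c t \<in> chart_dom \<kappa>"
  shows "((\<lambda>s. chart_map \<kappa> (c s)) has_vector_derivative velocity \<A> c J t \<kappa>) (at t)"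
proof -
  have "smooth_on {t \<in> J. c t \<in> chart_dom \<kappa>} (chart_map \<kappa> \<circ> c)"
    using assms by (simp add: smooth_curve_on_def)
  then have D: "((\<lambda>s. chart_map \<kappa> (c s)) has_vector_derivative frechet_derivative (chart_map \<kappa> \<circ> c) (at t) 1) (at t)"
    using smooth_on_has_vector_derivative[of _ "chart_map \<kappa> \<circ> c" t] assms by (simp add: o_def)
  moreover have "at t within J = at t" by (rule at_within_open[OF assms(3,1)])
  ultimately have "velocity \<A> c J t \<kappa> = frechet_derivative (chart_map \<kappa> \<circ> c) (at t) 1"
    using vector_derivative_at[OF D] assms by (simp add: velocity_def o_def)
  with D show ?thesis by simp
qed

lemma velocity_tangent:
  assumes "open J" "smooth_curve_on \<A> J c" "t \<in> J"
  shows "velocity \<A> c J t \<in> tangent_space \<A> (c t)"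
proof -
  obtain \<kappa> where \<kappa>: "\<kappa> \<in> \<A>" "c t \<in> chart_dom \<kappa>" by (rule chart_around)
  define y where "y = coord_vec \<A> \<kappa> (chart_map \<kappa> (c t)) (velocity \<A> c J t \<kappa>)"
  have y: "y \<in> tangent_space \<A> (c t)" unfolding y_def by (rule coord_vec_tangent[OF \<kappa>])
  have "y \<kappa> = velocity \<A> c J t \<kappa>"
    unfolding y_def by (simp add: coord_vec_apply[OF \<kappa> \<kappa>] transition_deriv_self[OF \<kappa>])
  then have "velocity \<A> c J t = y"
    using velocity_has_vector_derivative[OF assms \<kappa>] assms \<kappa> y
    by (intro velocity_tangent_eqI[OF \<kappa>(1)]) (auto simp: smooth_curve_on_def)
  with y show ?thesis by simp
qed

text \<open>
  The one-sided velocities of a piece of a curve are the two-sided velocities of any smooth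
  extension of it, and only the latter are computed with.
\<close>
lemma velocity_within_eq:
  assumes "open J" "smooth_curve_on \<A> J e" "{a..b} \<subseteq> J" "a < b" "t \<in> {a..b}"
    and eq: "\<And>s. s \<in> {a..b} \<Longrightarrow> e s = c s"
  shows "velocity \<A> c {a..b} t = velocity \<A> e J t"
proof
  fix \<kappa>
  have et: "e t = c t" using assms by blast
  show "velocity \<A> c {a..b} t \<kappa> = velocity \<A> e J t \<kappa>"
  proof (cases "\<kappa> \<in> \<A> \<and> c t \<in> chart_dom \<kappa>")
    case True
    have "((\<lambda>s. chart_map \<kappa> (e s)) has_vector_derivative velocity \<A> e J t \<kappa>) (at t within {a..b})"
    proof (rule has_vector_derivative_at_within[OF velocity_has_vector_derivative[OF assms(1,2)]])
      show "t \<in> J" using assms(3,5) by blast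
    qed (use True et in auto)
    then have "((\<lambda>s. chart_map \<kappa> (c s)) has_vector_derivative velocity \<A> e J t \<kappa>) (at t within {a..b})"
      by (rule has_vector_derivative_transform[OF assms(5), rotated]) (simp add: eq)
    then have "vector_derivative (\<lambda>s. chart_map \<kappa> (c s)) (at t within {a..b}) = velocity \<A> e J t \<kappa>"
      by (rule vector_derivative_within_closed_interval[OF assms(4,5)])
    moreover have "velocity \<A> c {a..b} t \<kappa> = vector_derivative (\<lambda>s. chart_map \<kappa> (c s)) (at t within {a..b})"
      using True by (simp add: velocity_def o_def)
    ultimately show ?thesis by simp
  next
    case False
    then show ?thesis using et by (auto simp: velocity_def)
  qed
qed

lemma smooth_curve_on_reparametrize:
  assumes e: "open J" "smooth_curve_on \<A> J e" and g: "open K" "smooth_on K g" "g ` K \<subseteq> J"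
  shows "smooth_curve_on \<A> K (\<lambda>t. e (g t))"
  unfolding smooth_curve_on_def
proof (intro conjI ballI)
  have contg: "continuous_on K g" by (rule smooth_on_continuous_on[OF g(2)])
  show cont: "continuous_on K (\<lambda>t. e (g t))"
    using e(2) by (intro continuous_on_compose2[OF _ contg g(3)]) (simp add: smooth_curve_on_def)
  fix \<kappa> assume \<kappa>: "\<kappa> \<in> \<A>"
  have "smooth_on {t \<in> J. e t \<in> chart_dom \<kappa>} (chart_map \<kappa> \<circ> e)"
    using e(2) \<kappa> by (simp add: smooth_curve_on_def)
  moreover have "smooth_on {t \<in> K. e (g t) \<in> chart_dom \<kappa>} g"
    by (rule smooth_on_subset[OF g(2)]) auto
  moreover have "continuous_on J e" using e(2) by (simp add: smooth_curve_on_def)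
  moreover have "g ` {t \<in> K. e (g t) \<in> chart_dom \<kappa>} \<subseteq> {t \<in> J. e t \<in> chart_dom \<kappa>}"
    using g(3) by auto
  ultimately have "smooth_on {t \<in> K. e (g t) \<in> chart_dom \<kappa>} (\<lambda>t. (chart_map \<kappa> \<circ> e) (g t))"
    using smooth_on_compose[OF open_chart_preimage[OF cont g(1) \<kappa>] open_chart_preimage[OF _ e(1) \<kappa>]]
    by blast
  then show "smooth_on {t \<in> K. e (g t) \<in> chart_dom \<kappa>} (chart_map \<kappa> \<circ> (\<lambda>t. e (g t)))"
    by (simp add: o_def)
qed

lemma velocity_reparametrize:
  assumes e: "open J" "smooth_curve_on \<A> J e" and g: "open K" "smooth_on K g" "g ` K \<subseteq> J"
    and t: "t \<in> K" "(g has_real_derivative r) (at t)"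
  shows "velocity \<A> (\<lambda>s. e (g s)) K t = (\<lambda>\<kappa>. r *\<^sub>R velocity \<A> e J (g t) \<kappa>)"
proof -
  obtain \<kappa> where \<kappa>: "\<kappa> \<in> \<A>" "e (g t) \<in> chart_dom \<kappa>" by (rule chart_around)
  have sm: "smooth_curve_on \<A> K (\<lambda>t. e (g t))" by (rule smooth_curve_on_reparametrize[OF e g])
  have gt: "g t \<in> J" using g t by auto
  have y: "velocity \<A> e J (g t) \<in> tangent_space \<A> (e (g t))" by (rule velocity_tangent[OF e gt])
  have z: "(\<lambda>\<kappa>. 0) \<in> tangent_space \<A> (e (g t))"
    using tangent_space_add_scaleR[OF y y, of "-1"] by simp
  have yr: "(\<lambda>\<kappa>. r *\<^sub>R velocity \<A> e J (g t) \<kappa>) \<in> tangent_space \<A> (e (g t))"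
    using tangent_space_add_scaleR[OF z y, of r] by simp
  have "((\<lambda>s. chart_map \<kappa> (e (g s))) has_vector_derivative r *\<^sub>R velocity \<A> e J (g t) \<kappa>) (at t)"
    using vector_diff_chain_at[of g r t "\<lambda>s. chart_map \<kappa> (e s)"]
      velocity_has_vector_derivative[OF e gt \<kappa>] t(2)
    by (simp add: o_def has_real_derivative_iff_has_vector_derivative)
  then show ?thesis
    using sm by (intro velocity_tangent_eqI[where c = "\<lambda>s. e (g s)", OF \<kappa>(1) g(1) t(1) _ \<kappa>(2) yr]) (auto simp: smooth_curve_on_def)
qed

end

section \<open>Riemannian metrics in coordinates\<close>

locale riemannian = atlas \<A>
  for \<A> :: "('a::{t2_space,second_countable_topology}, 'n::finite) chart set" +
  fixes h :: "'a \<Rightarrow> ('a, 'n) tvec \<Rightarrow> ('a, 'n) tvec \<Rightarrow> real"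
  assumes riemannian_metric: "riemannian_metric \<A> h"
begin

abbreviation metric where "metric \<equiv> metric_coord \<A> h"

lemma
  assumes "\<kappa> \<in> \<A>" "\<xi> \<in> chart_img \<kappa>"
  shows bilinear_metric: "bilinear (metric \<kappa> \<xi>)"
    and metric_sym: "metric \<kappa> \<xi> u v = metric \<kappa> \<xi> v u"
    and metric_pos: "u \<noteq> 0 \<Longrightarrow> metric \<kappa> \<xi> u u > 0"
  using riemannian_metric assms unfolding riemannian_metric_def by blast+

lemma smooth_metric: "\<kappa> \<in> \<A> \<Longrightarrow> smooth_on (chart_img \<kappa>) (\<lambda>\<xi>. metric \<kappa> \<xi> u v)"
  using riemannian_metric unfolding riemannian_metric_def by blast

lemmas metric_expand = bilinear_expand_axis[OF bilinear_metric]

lemma metric_tangent: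
  assumes "y \<in> tangent_space \<A> x" "z \<in> tangent_space \<A> x" "\<kappa> \<in> \<A>" "x \<in> chart_dom \<kappa>"
  shows "h x y z = metric \<kappa> (chart_map \<kappa> x) (y \<kappa>) (z \<kappa>)"
  using assms by (simp add: metric_coord_def coord_vec_tangent_eq)

lemma inner_sym:
  assumes "y \<in> tangent_space \<A> x" "z \<in> tangent_space \<A> x"
  shows "h x y z = h x z y"
proof -
  obtain \<kappa> where \<kappa>: "\<kappa> \<in> \<A>" "x \<in> chart_dom \<kappa>" by (rule chart_around)
  then show ?thesis
    using metric_sym[OF \<kappa>(1), of "chart_map \<kappa> x"] assms by (simp add: metric_tangent[OF _ _ \<kappa>])
qed

lemma inner_add_scaleR:
  assumes "y \<in> tangent_space \<A> x" "z \<in> tangent_space \<A> x" "w \<in> tangent_space \<A> x"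
  shows "h x (\<lambda>\<mu>. y \<mu> + r *\<^sub>R z \<mu>) w = h x y w + r * h x z w"
proof -
  obtain \<kappa> where \<kappa>: "\<kappa> \<in> \<A>" "x \<in> chart_dom \<kappa>" by (rule chart_around)
  have l: "linear (\<lambda>a. metric \<kappa> (chart_map \<kappa> x) a (w \<kappa>))"
    using bilinear_metric[OF \<kappa>(1), of "chart_map \<kappa> x"] \<kappa> by (simp add: bilinear_def)
  show ?thesis
    using assms tangent_space_add_scaleR[OF assms(1,2), of r]
    by (simp add: metric_tangent[OF _ _ \<kappa>] linear_add[OF l] linear_scale[OF l])
qed

lemma inner_nonneg:
  assumes "y \<in> tangent_space \<A> x"
  shows "h x y y \<ge> 0"
proof -
  obtain \<kappa> where \<kappa>: "\<kappa> \<in> \<A>" "x \<in> chart_dom \<kappa>" by (rule chart_around)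
  have "metric \<kappa> (chart_map \<kappa> x) 0 0 = 0"
    using bilinear_lzero[OF bilinear_metric[OF \<kappa>(1)]] \<kappa> by simp
  then show ?thesis
    using metric_pos[OF \<kappa>(1), of "chart_map \<kappa> x" "y \<kappa>"] assms \<kappa>
    by (cases "y \<kappa> = 0") (simp_all add: metric_tangent[OF _ _ \<kappa>] less_imp_le)
qed

lemma norm_combination:
  assumes "y \<in> tangent_space \<A> x" "z \<in> tangent_space \<A> x"
  shows "h x (\<lambda>\<mu>. y \<mu> + r *\<^sub>R z \<mu>) (\<lambda>\<mu>. y \<mu> + r *\<^sub>R z \<mu>) = h x y y + 2 * r * h x y z + r\<^sup>2 * h x z z"
proof -
  note yz = tangent_space_add_scaleR[OF assms, of r]
  have "h x (\<lambda>\<mu>. y \<mu> + r *\<^sub>R z \<mu>) (\<lambda>\<mu>. y \<mu> + r *\<^sub>R z \<mu>)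
      = h x (\<lambda>\<mu>. y \<mu> + r *\<^sub>R z \<mu>) y + r * h x (\<lambda>\<mu>. y \<mu> + r *\<^sub>R z \<mu>) z"
    by (simp add: inner_add_scaleR[OF assms yz] inner_sym[OF assms(1) yz] inner_sym[OF assms(2) yz])
  also have "\<dots> = h x y y + 2 * r * h x y z + r\<^sup>2 * h x z z"
    by (simp add: inner_add_scaleR[OF assms assms(1)] inner_add_scaleR[OF assms assms(2)]
        inner_sym[OF assms(2,1)] power2_eq_square algebra_simps)
  finally show ?thesis .
qed

lemma metric_continuous_on:
  assumes "\<kappa> \<in> \<A>" "x ` S \<subseteq> chart_img \<kappa>" "continuous_on S x" "continuous_on S a" "continuous_on S b"
  shows "continuous_on S (\<lambda>s. metric \<kappa> (x s) (a s) (b s))"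
proof -
  have "continuous_on S (\<lambda>s. metric \<kappa> (x s) (axis i 1) (axis j 1))" for i j
    by (rule continuous_on_compose2[OF smooth_on_continuous_on[OF smooth_metric[OF assms(1)]] assms(3,2)])
  then have "continuous_on S (\<lambda>s. \<Sum>i\<in>UNIV. \<Sum>j\<in>UNIV.
      a s $ i * b s $ j * metric \<kappa> (x s) (axis i 1) (axis j 1))"
    by (intro continuous_on_sum continuous_on_mult continuous_on_component assms)
  moreover have "metric \<kappa> (x s) (a s) (b s) = (\<Sum>i\<in>UNIV. \<Sum>j\<in>UNIV.
      a s $ i * b s $ j * metric \<kappa> (x s) (axis i 1) (axis j 1))" if "s \<in> S" for s
    using assms(2) that by (intro metric_expand[OF assms(1)]) auto
  ultimately show ?thesis by (simp cong: continuous_on_cong)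
qed

lemma metric_derivative_expand:
  assumes "\<kappa> \<in> \<A>" "\<xi> \<in> chart_img \<kappa>"
  shows "frechet_derivative (\<lambda>\<eta>. metric \<kappa> \<eta> u v) (at \<xi>) w = (\<Sum>i\<in>UNIV. \<Sum>j\<in>UNIV.
    u $ i * v $ j * frechet_derivative (\<lambda>\<eta>. metric \<kappa> \<eta> (axis i 1) (axis j 1)) (at \<xi>) w)"
proof -
  have "((\<lambda>\<eta>. \<Sum>i\<in>UNIV. \<Sum>j\<in>UNIV. u $ i * v $ j * metric \<kappa> \<eta> (axis i 1) (axis j 1)) has_derivative
     (\<lambda>w. \<Sum>i\<in>UNIV. \<Sum>j\<in>UNIV. u $ i * v $ j *
        frechet_derivative (\<lambda>\<eta>. metric \<kappa> \<eta> (axis i 1) (axis j 1)) (at \<xi>) w)) (at \<xi>)"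
    by (intro has_derivative_sum has_derivative_mult_right
        smooth_on_has_derivative[OF smooth_metric[OF assms(1)] assms(2)])
  then have "((\<lambda>\<eta>. metric \<kappa> \<eta> u v) has_derivative
     (\<lambda>w. \<Sum>i\<in>UNIV. \<Sum>j\<in>UNIV. u $ i * v $ j *
        frechet_derivative (\<lambda>\<eta>. metric \<kappa> \<eta> (axis i 1) (axis j 1)) (at \<xi>) w)) (at \<xi>)"
    by (rule has_derivative_transform_within_open[OF _ open_chart_img[OF assms(1)] assms(2)])
      (rule metric_expand[OF assms(1), symmetric])
  from fun_cong[OF frechet_derivative_at[OF this], of w] show ?thesis by (rule sym)
qed

text \<open>
  The product rule for a metric with moving base point and moving arguments. The components of a
  metric are smooth for fixed arguments only, hence the expansion over pairs of basis vectors.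
\<close>
lemma metric_along_curve:
  assumes "\<kappa> \<in> \<A>" "x t \<in> chart_img \<kappa>"
    and x: "(x has_vector_derivative x') (at t)"
    and a: "(a has_vector_derivative a') (at t)"
    and b: "(b has_vector_derivative b') (at t)"
  shows "((\<lambda>s. metric \<kappa> (x s) (a s) (b s)) has_real_derivative
     frechet_derivative (\<lambda>\<eta>. metric \<kappa> \<eta> (a t) (b t)) (at (x t)) x'
       + metric \<kappa> (x t) a' (b t) + metric \<kappa> (x t) (a t) b') (at t)"
proof -
  define G where "G i j \<eta> = metric \<kappa> \<eta> (axis i 1) (axis j 1)" for i j \<eta>
  define D where "D i j = frechet_derivative (G i j) (at (x t)) x'" for i j
  have G: "((\<lambda>s. G i j (x s)) has_real_derivative D i j) (at t)" for i j
  proof -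
    have g: "(G i j has_derivative frechet_derivative (G i j) (at (x t))) (at (x t))"
      unfolding G_def by (rule smooth_on_has_derivative[OF smooth_metric[OF assms(1)] assms(2)])
    from has_derivative_compose[of x _ t UNIV "G i j", OF x[unfolded has_vector_derivative_def] g]
    show ?thesis
      by (simp add: has_field_derivative_def D_def linear_scale[OF has_derivative_linear[OF g]] mult_commute_abs)
  qed
  have comp: "((\<lambda>s. f s $ i) has_real_derivative f' $ i) (at t)" if "(f has_vector_derivative f') (at t)"
    for f and f' :: "real ^ 'n" and i
    using bounded_linear.has_vector_derivative[OF bounded_linear_vec_nth that]
    by (simp add: has_real_derivative_iff_has_vector_derivative)
  have "((\<lambda>s. a s $ i * b s $ j * G i j (x s)) has_real_derivative
      a t $ i * b t $ j * D i j + a' $ i * b t $ j * G i j (x t) + a t $ i * b' $ j * G i j (x t)) (at t)" for i j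
    by (rule DERIV_cong[OF DERIV_mult[OF DERIV_mult[OF comp[OF a] comp[OF b]] G]]) (simp add: algebra_simps)
  then have "((\<lambda>s. \<Sum>i\<in>UNIV. \<Sum>j\<in>UNIV. a s $ i * b s $ j * G i j (x s)) has_real_derivative
      (\<Sum>i\<in>UNIV. \<Sum>j\<in>UNIV. a t $ i * b t $ j * D i j + a' $ i * b t $ j * G i j (x t)
        + a t $ i * b' $ j * G i j (x t))) (at t)"
    by (intro DERIV_sum)
  also have "(\<Sum>i\<in>UNIV. \<Sum>j\<in>UNIV. a t $ i * b t $ j * D i j + a' $ i * b t $ j * G i j (x t)
        + a t $ i * b' $ j * G i j (x t)) = frechet_derivative (\<lambda>\<eta>. metric \<kappa> \<eta> (a t) (b t)) (at (x t)) x'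
       + metric \<kappa> (x t) a' (b t) + metric \<kappa> (x t) (a t) b'"
    unfolding metric_derivative_expand[OF assms(1,2), of "a t" "b t"] metric_expand[OF assms(1,2), of a' "b t"]
      metric_expand[OF assms(1,2), of "a t" b'] D_def G_def
    by (simp add: sum.distrib)
  finally have deriv: "((\<lambda>s. \<Sum>i\<in>UNIV. \<Sum>j\<in>UNIV. a s $ i * b s $ j * G i j (x s)) has_real_derivative
      frechet_derivative (\<lambda>\<eta>. metric \<kappa> \<eta> (a t) (b t)) (at (x t)) x'
       + metric \<kappa> (x t) a' (b t) + metric \<kappa> (x t) (a t) b') (at t)" .
  have "isCont x t" using x has_vector_derivative_continuous by blast
  then have "\<forall>\<^sub>F s in nhds t. x s \<in> chart_img \<kappa>"
    using open_chart_img[OF assms(1)] assms(2)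
    by (simp add: eventually_nhds_conv_at isCont_def topological_tendstoD)
  then have ev: "\<forall>\<^sub>F s in nhds t. metric \<kappa> (x s) (a s) (b s) = (\<Sum>i\<in>UNIV. \<Sum>j\<in>UNIV. a s $ i * b s $ j * G i j (x s))"
    unfolding G_def by eventually_elim (rule metric_expand[OF assms(1)])
  show ?thesis by (rule iffD2[OF DERIV_cong_ev[OF refl ev refl] deriv])
qed

end

section \<open>The flow of a vector field and its differential\<close>

locale flow = atlas \<A>
  for \<A> :: "('a::{t2_space,second_countable_topology}, 'n::finite) chart set" +
  fixes W :: "'a \<Rightarrow> ('a, 'n) tvec" and \<phi> :: "real \<Rightarrow> 'a \<Rightarrow> 'a"
  assumes smooth_vector_field: "smooth_vector_field \<A> W"
    and global_flow: "global_flow \<A> W \<phi>"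
begin

lemma W_tangent [simp]: "W x \<in> tangent_space \<A> x"
  using smooth_vector_field by (simp add: smooth_vector_field_def)

lemma flow_zero [simp]: "\<phi> 0 x = x"
  using global_flow by (simp add: global_flow_def)

lemma flow_flow [simp]: "\<phi> s (\<phi> t x) = \<phi> (s + t) x"
  using global_flow by (simp add: global_flow_def)

lemma continuous_on_flow:
  assumes "continuous_on S f" "continuous_on S c"
  shows "continuous_on S (\<lambda>p. \<phi> (f p) (c p))"
proof -
  have "continuous_on UNIV (\<lambda>(t, x). \<phi> t x)" using global_flow by (simp add: global_flow_def)
  from continuous_on_compose2[OF this continuous_on_Pair[OF assms]] show ?thesis by simp
qed

definition region where
  "region \<kappa> \<mu> = {(t, \<xi>). \<xi> \<in> chart_img \<kappa> \<and> \<phi> t (chart_inv \<kappa> \<xi>) \<in> chart_dom \<mu>}"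

definition flow_coord where
  "flow_coord \<kappa> \<mu> = (\<lambda>(t, \<xi>). chart_map \<mu> (\<phi> t (chart_inv \<kappa> \<xi>)))"

lemma open_region:
  assumes "\<kappa> \<in> \<A>" "\<mu> \<in> \<A>"
  shows "open (region \<kappa> \<mu>)"
proof -
  have "continuous_on (UNIV \<times> chart_img \<kappa>) (\<lambda>p. \<phi> (fst p) (chart_inv \<kappa> (snd p)))"
    by (intro continuous_on_flow continuous_on_fst continuous_on_id
        continuous_on_compose2[OF continuous_on_chart_inv[OF assms(1)]] continuous_on_snd) auto
  from continuous_open_preimage[OF this open_Times[OF open_UNIV open_chart_img[OF assms(1)]] open_chart_dom[OF assms(2)]]
  show ?thesis by (rule back_subst[of "open"]) (auto simp: region_def)
qed

lemma smooth_flow_coord: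
  assumes "\<kappa> \<in> \<A>" "\<mu> \<in> \<A>"
  shows "smooth_on (region \<kappa> \<mu>) (flow_coord \<kappa> \<mu>)"
  using global_flow assms unfolding global_flow_def region_def flow_coord_def by blast

abbreviation flow_deriv where
  "flow_deriv \<kappa> \<mu> p \<equiv> frechet_derivative (flow_coord \<kappa> \<mu>) (at p)"

lemma flow_coord_has_derivative:
  assumes "\<kappa> \<in> \<A>" "\<mu> \<in> \<A>" "\<xi> \<in> chart_img \<kappa>" "\<phi> t (chart_inv \<kappa> \<xi>) \<in> chart_dom \<mu>"
  shows "(flow_coord \<kappa> \<mu> has_derivative flow_deriv \<kappa> \<mu> (t, \<xi>)) (at (t, \<xi>))"
  by (rule smooth_on_has_derivative[OF smooth_flow_coord[OF assms(1,2)]]) (use assms in \<open>simp add: region_def\<close>)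

lemma flow_space_derivative:
  assumes "\<kappa> \<in> \<A>" "\<mu> \<in> \<A>" "\<xi> \<in> chart_img \<kappa>" "\<phi> t (chart_inv \<kappa> \<xi>) \<in> chart_dom \<mu>"
  shows "((\<lambda>\<eta>. chart_map \<mu> (\<phi> t (chart_inv \<kappa> \<eta>))) has_derivative (\<lambda>u. flow_deriv \<kappa> \<mu> (t, \<xi>) (0, u))) (at \<xi>)"
proof -
  have "((\<lambda>\<eta>. (t, \<eta>)) has_derivative (\<lambda>u. (0, u))) (at \<xi>)"
    by (intro has_derivative_Pair has_derivative_const has_derivative_ident)
  from has_derivative_compose[of "\<lambda>\<eta>. (t, \<eta>)" _ \<xi> UNIV "flow_coord \<kappa> \<mu>", OF this flow_coord_has_derivative[OF assms]]
  show ?thesis by (simp add: flow_coord_def)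
qed

lemma flow_time_derivative:
  assumes "\<mu> \<in> \<A>" "\<phi> t x \<in> chart_dom \<mu>"
  shows "((\<lambda>s. chart_map \<mu> (\<phi> s x)) has_vector_derivative W (\<phi> t x) \<mu>) (at t)"
proof -
  obtain \<kappa> where \<kappa>: "\<kappa> \<in> \<A>" "x \<in> chart_dom \<kappa>" by (rule chart_around)
  let ?\<xi> = "chart_map \<kappa> x"
  have D: "(flow_coord \<kappa> \<mu> has_derivative flow_deriv \<kappa> \<mu> (t, ?\<xi>)) (at (t, ?\<xi>))"
    by (rule flow_coord_has_derivative) (use assms \<kappa> in auto)
  have "((\<lambda>s. (s, ?\<xi>)) has_derivative (\<lambda>u. (u, 0))) (at t)"
    by (intro has_derivative_Pair has_derivative_const has_derivative_ident)
  from has_derivative_compose[of "\<lambda>s. (s, ?\<xi>)" _ t UNIV "flow_coord \<kappa> \<mu>", OF this D]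
  have "(\<lambda>s. chart_map \<mu> (\<phi> s x)) differentiable (at t)"
    using \<kappa> by (intro differentiableI) (simp add: flow_coord_def)
  then have "((\<lambda>s. chart_map \<mu> (\<phi> s x)) has_vector_derivative
      vector_derivative (\<lambda>s. chart_map \<mu> (\<phi> s x)) (at t)) (at t)"
    by (simp add: vector_derivative_works)
  moreover have "velocity \<A> (\<lambda>s. \<phi> s x) UNIV t = W (\<phi> t x)"
    using global_flow unfolding global_flow_def by blast
  then have "vector_derivative (\<lambda>s. chart_map \<mu> (\<phi> s x)) (at t) = W (\<phi> t x) \<mu>"
    using assms by (auto simp: velocity_def o_def dest: fun_cong[of _ _ \<mu>])
  ultimately show ?thesis by simp
qed

lemma flow_deriv_time:
  assumes "\<kappa> \<in> \<A>" "\<mu> \<in> \<A>" "\<xi> \<in> chart_img \<kappa>" "\<phi> t (chart_inv \<kappa> \<xi>) \<in> chart_dom \<mu>"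
  shows "flow_deriv \<kappa> \<mu> (t, \<xi>) (1, 0) = W (\<phi> t (chart_inv \<kappa> \<xi>)) \<mu>"
proof -
  have D: "(flow_coord \<kappa> \<mu> has_derivative flow_deriv \<kappa> \<mu> (t, \<xi>)) (at (t, \<xi>))"
    by (rule flow_coord_has_derivative[OF assms])
  have "((\<lambda>s. (s, \<xi>)) has_derivative (\<lambda>u. u *\<^sub>R (1, 0))) (at t)"
    by (rule has_derivative_eq_rhs[OF has_derivative_Pair[OF has_derivative_ident has_derivative_const]]) auto
  from has_derivative_compose[of "\<lambda>s. (s, \<xi>)" _ t UNIV "flow_coord \<kappa> \<mu>", OF this D]
  have "((\<lambda>s. chart_map \<mu> (\<phi> s (chart_inv \<kappa> \<xi>))) has_vector_derivative flow_deriv \<kappa> \<mu> (t, \<xi>) (1, 0)) (at t)"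
    unfolding has_vector_derivative_def linear_scale[OF has_derivative_linear[OF D]]
    by (simp only: flow_coord_def prod.case)
  then show ?thesis
    by (rule vector_derivative_unique_at[OF _ flow_time_derivative[OF assms(2,4)]])
qed

text \<open>
  The differential of \<open>\<phi> t\<close>, applied to the tangent vector that has the coordinates \<open>u\<close> at the point
  with the coordinates \<open>\<xi>\<close>. For \<open>t = 0\<close> this is \<open>coord_vec\<close>.
\<close>
definition push where
  "push \<kappa> t \<xi> u = (\<lambda>\<mu>. if \<mu> \<in> \<A> \<and> \<phi> t (chart_inv \<kappa> \<xi>) \<in> chart_dom \<mu>
     then frechet_derivative (\<lambda>\<eta>. chart_map \<mu> (\<phi> t (chart_inv \<kappa> \<eta>))) (at \<xi>) u else 0)"

lemma push_apply:
  assumes "\<kappa> \<in> \<A>" "\<mu> \<in> \<A>" "\<xi> \<in> chart_img \<kappa>" "\<phi> t (chart_inv \<kappa> \<xi>) \<in> chart_dom \<mu>"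
  shows "push \<kappa> t \<xi> u \<mu> = flow_deriv \<kappa> \<mu> (t, \<xi>) (0, u)"
  using fun_cong[OF frechet_derivative_at[OF flow_space_derivative[OF assms]], of u] assms
  by (simp add: push_def)

lemma push_zero:
  assumes "\<kappa> \<in> \<A>" "x \<in> chart_dom \<kappa>"
  shows "push \<kappa> 0 (chart_map \<kappa> x) u = coord_vec \<A> \<kappa> (chart_map \<kappa> x) u"
  unfolding push_def coord_vec_def o_def flow_zero by (rule refl)

lemma push_tangent:
  assumes "\<kappa> \<in> \<A>" "\<xi> \<in> chart_img \<kappa>"
  shows "push \<kappa> t \<xi> u \<in> tangent_space \<A> (\<phi> t (chart_inv \<kappa> \<xi>))"
  unfolding tangent_space_def
proof (intro CollectI conjI ballI allI impI)
  fix \<mu> \<nu>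
  assume \<mu>\<nu>: "\<mu> \<in> \<A>" "\<nu> \<in> \<A>" "\<phi> t (chart_inv \<kappa> \<xi>) \<in> chart_dom \<mu>" "\<phi> t (chart_inv \<kappa> \<xi>) \<in> chart_dom \<nu>"
  let ?g = "\<lambda>\<eta>. \<phi> t (chart_inv \<kappa> \<eta>)"
  let ?U = "chart_img \<kappa> \<inter> ?g -` (chart_dom \<mu> \<inter> chart_dom \<nu>)"
  have "continuous_on (chart_img \<kappa>) ?g"
    by (intro continuous_on_flow continuous_on_const continuous_on_chart_inv assms)
  then have "open ?U"
    by (intro continuous_open_preimage open_chart_img open_Int open_chart_dom assms \<mu>\<nu>)
  then have "((\<lambda>\<eta>. chart_map \<nu> (?g \<eta>)) has_derivative
      (\<lambda>v. transition_deriv \<mu> \<nu> (chart_map \<mu> (?g \<xi>)) (flow_deriv \<kappa> \<mu> (t, \<xi>) (0, v)))) (at \<xi>)"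
    using \<mu>\<nu> assms
    by (intro change_of_chart[of \<mu> \<nu> ?U \<xi> ?g] flow_space_derivative) auto
  from has_derivative_unique[OF this flow_space_derivative[OF assms(1) \<mu>\<nu>(2) assms(2) \<mu>\<nu>(4)]]
  show "push \<kappa> t \<xi> u \<nu> = transition_deriv \<mu> \<nu> (chart_map \<mu> (?g \<xi>)) (push \<kappa> t \<xi> u \<mu>)"
    using \<mu>\<nu> assms by (simp add: push_apply fun_eq_iff)
qed (auto simp: push_def)

text \<open>
  Both sides are the velocity at \<open>s = 0\<close> of the curve \<open>\<phi> t (\<phi> s x) = \<phi> s (\<phi> t x)\<close>.
\<close>
lemma push_W:
  assumes "\<kappa> \<in> \<A>" "x \<in> chart_dom \<kappa>"
  shows "push \<kappa> t (chart_map \<kappa> x) (W x \<kappa>) = W (\<phi> t x)"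
proof -
  obtain \<mu> where \<mu>: "\<mu> \<in> \<A>" "\<phi> t x \<in> chart_dom \<mu>" by (rule chart_around)
  let ?\<xi> = "chart_map \<kappa> x"
  have D: "((\<lambda>\<eta>. chart_map \<mu> (\<phi> t (chart_inv \<kappa> \<eta>))) has_derivative (\<lambda>u. flow_deriv \<kappa> \<mu> (t, ?\<xi>) (0, u))) (at ?\<xi>)"
    using assms \<mu> by (intro flow_space_derivative) auto
  have x0: "((\<lambda>s. chart_map \<kappa> (\<phi> s x)) has_derivative (\<lambda>r. r *\<^sub>R W x \<kappa>)) (at 0)"
    using flow_time_derivative[of \<kappa> 0 x] assms by (simp add: has_vector_derivative_def)
  have "((\<lambda>s. chart_map \<mu> (\<phi> t (chart_inv \<kappa> (chart_map \<kappa> (\<phi> s x))))) has_derivative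
     (\<lambda>r. flow_deriv \<kappa> \<mu> (t, ?\<xi>) (0, r *\<^sub>R W x \<kappa>))) (at 0)"
    using has_derivative_compose[of "\<lambda>s. chart_map \<kappa> (\<phi> s x)" _ 0 UNIV
        "\<lambda>\<eta>. chart_map \<mu> (\<phi> t (chart_inv \<kappa> \<eta>))", OF x0] D by simp
  moreover have "open ((\<lambda>s. \<phi> s x) -` chart_dom \<kappa>)"
    by (intro open_vimage open_chart_dom assms continuous_on_flow continuous_on_id continuous_on_const)
  ultimately have "((\<lambda>s. chart_map \<mu> (\<phi> s (\<phi> t x))) has_derivative
     (\<lambda>r. flow_deriv \<kappa> \<mu> (t, ?\<xi>) (0, r *\<^sub>R W x \<kappa>))) (at 0)"
    by (rule has_derivative_transform_within_open) (use assms in \<open>auto simp: add.commute\<close>)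
  moreover have "((\<lambda>s. chart_map \<mu> (\<phi> s (\<phi> t x))) has_derivative (\<lambda>r. r *\<^sub>R W (\<phi> t x) \<mu>)) (at 0)"
    using flow_time_derivative[of \<mu> 0 "\<phi> t x"] \<mu> by (simp add: has_vector_derivative_def)
  ultimately have "(\<lambda>r. flow_deriv \<kappa> \<mu> (t, ?\<xi>) (0, r *\<^sub>R W x \<kappa>)) = (\<lambda>r. r *\<^sub>R W (\<phi> t x) \<mu>)"
    by (rule has_derivative_unique)
  from fun_cong[OF this, of 1] have "flow_deriv \<kappa> \<mu> (t, ?\<xi>) (0, W x \<kappa>) = W (\<phi> t x) \<mu>" by simp
  then have "push \<kappa> t ?\<xi> (W x \<kappa>) \<mu> = W (\<phi> t x) \<mu>"
    using assms \<mu> by (simp add: push_apply)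
  then show ?thesis
    using push_tangent[OF assms(1), of ?\<xi> t "W x \<kappa>"] assms
    by (intro tangent_eqI[OF _ W_tangent \<mu>]) auto
qed

text \<open>
  The curve is the image of \<open>(f s, c s)\<close> under the flow map, and the two partial derivatives of that
  map are \<open>W\<close> and \<open>push\<close>.
\<close>
lemma flow_along_curve_coord:
  assumes c: "open J" "smooth_curve_on \<A> J c" and f: "(f has_real_derivative r) (at t)" and t: "t \<in> J"
    and \<kappa>: "\<kappa> \<in> \<A>" "c t \<in> chart_dom \<kappa>" and \<mu>: "\<mu> \<in> \<A>" "\<phi> (f t) (c t) \<in> chart_dom \<mu>"
  shows "((\<lambda>s. chart_map \<mu> (\<phi> (f s) (c s))) has_vector_derivative
      push \<kappa> (f t) (chart_map \<kappa> (c t)) (velocity \<A> c J t \<kappa>) \<mu> + r *\<^sub>R W (\<phi> (f t) (c t)) \<mu>) (at t)"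
proof -
  let ?p = "(f t, chart_map \<kappa> (c t))" and ?v = "velocity \<A> c J t \<kappa>"
  have D: "(flow_coord \<kappa> \<mu> has_derivative flow_deriv \<kappa> \<mu> ?p) (at ?p)"
    by (rule flow_coord_has_derivative) (use \<kappa> \<mu> in auto)
  note lin = has_derivative_linear[OF D]
  have "((\<lambda>s. (f s, chart_map \<kappa> (c s))) has_derivative (\<lambda>u. (u * r, u *\<^sub>R ?v))) (at t)"
    using velocity_has_vector_derivative[OF c t \<kappa>] f
    by (intro has_derivative_Pair) (simp_all add: has_vector_derivative_def has_field_derivative_def mult_commute_abs)
  from has_derivative_compose[of "\<lambda>s. (f s, chart_map \<kappa> (c s))" _ t UNIV "flow_coord \<kappa> \<mu>", OF this D]
  have *: "((\<lambda>s. flow_coord \<kappa> \<mu> (f s, chart_map \<kappa> (c s))) has_derivative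
      (\<lambda>u. flow_deriv \<kappa> \<mu> ?p (u * r, u *\<^sub>R ?v))) (at t)" .
  have "flow_deriv \<kappa> \<mu> ?p (u * r, u *\<^sub>R ?v) = u *\<^sub>R (push \<kappa> (f t) (chart_map \<kappa> (c t)) ?v \<mu>
      + r *\<^sub>R W (\<phi> (f t) (c t)) \<mu>)" for u
  proof -
    have "(u * r, u *\<^sub>R ?v) = u *\<^sub>R ((0, ?v) + r *\<^sub>R (1, 0))" by simp
    then have "flow_deriv \<kappa> \<mu> ?p (u * r, u *\<^sub>R ?v)
        = u *\<^sub>R (flow_deriv \<kappa> \<mu> ?p (0, ?v) + r *\<^sub>R flow_deriv \<kappa> \<mu> ?p (1, 0))"
      by (simp only: linear_add[OF lin] linear_scale[OF lin])
    also have "flow_deriv \<kappa> \<mu> ?p (1, 0) = W (\<phi> (f t) (c t)) \<mu>"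
      using \<kappa> \<mu> by (subst flow_deriv_time) auto
    also have "flow_deriv \<kappa> \<mu> ?p (0, ?v) = push \<kappa> (f t) (chart_map \<kappa> (c t)) ?v \<mu>"
      using \<kappa> \<mu> by (subst push_apply) auto
    finally show ?thesis .
  qed
  with * have **: "((\<lambda>s. flow_coord \<kappa> \<mu> (f s, chart_map \<kappa> (c s))) has_vector_derivative
      push \<kappa> (f t) (chart_map \<kappa> (c t)) ?v \<mu> + r *\<^sub>R W (\<phi> (f t) (c t)) \<mu>) (at t)"
    unfolding has_vector_derivative_def by (simp only:)
  have "continuous_on J c" using c by (simp add: smooth_curve_on_def)
  then have "open {s \<in> J. c s \<in> chart_dom \<kappa>}" by (rule open_chart_preimage[OF _ c(1) \<kappa>(1)])
  with ** show ?thesis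
    by (rule has_vector_derivative_transform_within_open) (use t \<kappa> in \<open>auto simp: flow_coord_def\<close>)
qed

lemma smooth_curve_on_flow:
  assumes c: "open J" "smooth_curve_on \<A> J c" and f: "smooth_on J f"
  shows "smooth_curve_on \<A> J (\<lambda>t. \<phi> (f t) (c t))"
  unfolding smooth_curve_on_def
proof (intro conjI ballI)
  have cc: "continuous_on J c" using c by (simp add: smooth_curve_on_def)
  show cont: "continuous_on J (\<lambda>t. \<phi> (f t) (c t))"
    by (intro continuous_on_flow cc smooth_on_continuous_on f)
  fix \<mu> assume \<mu>: "\<mu> \<in> \<A>"
  show "smooth_on {t \<in> J. \<phi> (f t) (c t) \<in> chart_dom \<mu>} (chart_map \<mu> \<circ> (\<lambda>t. \<phi> (f t) (c t)))"
  proof (rule smooth_on_local)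
    fix t assume t: "t \<in> {t \<in> J. \<phi> (f t) (c t) \<in> chart_dom \<mu>}"
    obtain \<kappa> where \<kappa>: "\<kappa> \<in> \<A>" "c t \<in> chart_dom \<kappa>" by (rule chart_around)
    let ?U = "{t \<in> J. \<phi> (f t) (c t) \<in> chart_dom \<mu>} \<inter> {t \<in> J. c t \<in> chart_dom \<kappa>}"
    have U: "open ?U"
      by (intro open_Int open_chart_preimage[OF cont c(1) \<mu>] open_chart_preimage[OF cc c(1) \<kappa>(1)])
    have "smooth_on {t \<in> J. c t \<in> chart_dom \<kappa>} (chart_map \<kappa> \<circ> c)"
      using c(2) \<kappa> by (simp add: smooth_curve_on_def)
    then have "smooth_on ?U (chart_map \<kappa> \<circ> c)" by (rule smooth_on_subset) auto
    moreover have "smooth_on ?U f" by (rule smooth_on_subset[OF f]) auto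
    ultimately have pair: "smooth_on ?U (\<lambda>t. (f t, (chart_map \<kappa> \<circ> c) t))" by (intro smooth_on_Pair[OF U])
    have img: "(\<lambda>t. (f t, (chart_map \<kappa> \<circ> c) t)) ` ?U \<subseteq> region \<kappa> \<mu>"
      using \<kappa> by (auto simp: region_def)
    have "smooth_on ?U (\<lambda>t. flow_coord \<kappa> \<mu> (f t, (chart_map \<kappa> \<circ> c) t))"
      by (rule smooth_on_compose[OF U open_region[OF \<kappa>(1) \<mu>] img pair smooth_flow_coord[OF \<kappa>(1) \<mu>]])
    moreover have "smooth_on ?U (\<lambda>t. flow_coord \<kappa> \<mu> (f t, (chart_map \<kappa> \<circ> c) t)) \<longleftrightarrow>
        smooth_on ?U (chart_map \<mu> \<circ> (\<lambda>t. \<phi> (f t) (c t)))"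
      by (rule smooth_on_cong[OF U]) (use \<kappa> in \<open>auto simp: flow_coord_def\<close>)
    ultimately have "smooth_on ?U (chart_map \<mu> \<circ> (\<lambda>t. \<phi> (f t) (c t)))" by blast
    with U t \<kappa> show "\<exists>U. open U \<and> t \<in> U \<and> smooth_on U (chart_map \<mu> \<circ> (\<lambda>t. \<phi> (f t) (c t)))"
      by (intro exI[of _ ?U]) auto
  qed
qed

lemma velocity_flow:
  assumes c: "open J" "smooth_curve_on \<A> J c" and f: "smooth_on J f" "(f has_real_derivative r) (at t)"
    and t: "t \<in> J" and \<kappa>: "\<kappa> \<in> \<A>" "c t \<in> chart_dom \<kappa>"
  shows "velocity \<A> (\<lambda>s. \<phi> (f s) (c s)) J t = (\<lambda>\<mu>.
      push \<kappa> (f t) (chart_map \<kappa> (c t)) (velocity \<A> c J t \<kappa>) \<mu> + r *\<^sub>R W (\<phi> (f t) (c t)) \<mu>)"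
proof -
  obtain \<mu> where \<mu>: "\<mu> \<in> \<A>" "\<phi> (f t) (c t) \<in> chart_dom \<mu>" by (rule chart_around)
  have "push \<kappa> (f t) (chart_map \<kappa> (c t)) (velocity \<A> c J t \<kappa>) \<in> tangent_space \<A> (\<phi> (f t) (c t))"
    using push_tangent[OF \<kappa>(1) chart_map_in_img[OF \<kappa>]] \<kappa> by simp
  from tangent_space_add_scaleR[OF this W_tangent]
  have y: "(\<lambda>\<mu>. push \<kappa> (f t) (chart_map \<kappa> (c t)) (velocity \<A> c J t \<kappa>) \<mu> + r *\<^sub>R W (\<phi> (f t) (c t)) \<mu>)
      \<in> tangent_space \<A> (\<phi> (f t) (c t))" .
  have "continuous_on J (\<lambda>s. \<phi> (f s) (c s))"
    using smooth_curve_on_flow[OF c f(1)] by (simp add: smooth_curve_on_def)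
  then show ?thesis
    by (rule velocity_tangent_eqI[where c = "\<lambda>s. \<phi> (f s) (c s)", OF \<mu>(1) c(1) t _ \<mu>(2) y])
      (rule flow_along_curve_coord[OF c f(2) t \<kappa> \<mu>])
qed

end

section \<open>The flow of a unit Killing field\<close>

locale kropina_space = riemannian \<A> h + flow \<A> W \<phi>
  for \<A> :: "('a::{t2_space,second_countable_topology}, 'n::finite) chart set"
    and h :: "'a \<Rightarrow> ('a, 'n) tvec \<Rightarrow> ('a, 'n) tvec \<Rightarrow> real"
    and W :: "'a \<Rightarrow> ('a, 'n) tvec" and \<phi> :: "real \<Rightarrow> 'a \<Rightarrow> 'a" +
  assumes killing_field: "killing_field \<A> h W"
    and unit_field: "riem_norm h x (W x) = 1"
begin

lemma h_W_W [simp]: "h x (W x) (W x) = 1"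
  using unit_field[of x] by (simp add: riem_norm_def)

lemma killing_equation:
  assumes "\<kappa> \<in> \<A>" "\<xi> \<in> chart_img \<kappa>"
  defines "dw \<equiv> frechet_derivative (\<lambda>\<eta>. W (chart_inv \<kappa> \<eta>) \<kappa>) (at \<xi>)"
  shows "frechet_derivative (\<lambda>\<eta>. metric \<kappa> \<eta> u v) (at \<xi>) (W (chart_inv \<kappa> \<xi>) \<kappa>)
     + metric \<kappa> \<xi> (dw u) v + metric \<kappa> \<xi> u (dw v) = 0"
  using killing_field assms unfolding killing_field_def Let_def by blast

lemma smooth_W: "\<kappa> \<in> \<A> \<Longrightarrow> smooth_on (chart_img \<kappa>) (\<lambda>\<xi>. W (chart_inv \<kappa> \<xi>) \<kappa>)"
  using smooth_vector_field unfolding smooth_vector_field_def by blast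

text \<open>
  The flow equation differentiated with respect to the initial point. The time derivative and the
  space derivative are exchanged, which turns the equation into a linear one along the orbit.
\<close>
lemma flow_deriv_evolution:
  assumes "\<kappa> \<in> \<A>" "\<mu> \<in> \<A>" "\<xi> \<in> chart_img \<kappa>" "\<phi> t (chart_inv \<kappa> \<xi>) \<in> chart_dom \<mu>"
  shows "((\<lambda>s. flow_deriv \<kappa> \<mu> (s, \<xi>) (0, u)) has_vector_derivative
     frechet_derivative (\<lambda>\<eta>. W (chart_inv \<mu> \<eta>) \<mu>) (at (flow_coord \<kappa> \<mu> (t, \<xi>)))
       (flow_deriv \<kappa> \<mu> (t, \<xi>) (0, u))) (at t)"
proof -
  let ?R = "region \<kappa> \<mu>" and ?F = "flow_coord \<kappa> \<mu>" and ?w = "\<lambda>\<eta>. W (chart_inv \<mu> \<eta>) \<mu>"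
  note R = open_region[OF assms(1,2)] and F = smooth_flow_coord[OF assms(1,2)]
  have in_R: "(t, \<xi>) \<in> ?R" using assms by (simp add: region_def)
  have in_img: "?F (t, \<xi>) \<in> chart_img \<mu>" using assms by (simp add: flow_coord_def)
  have D: "((\<lambda>p. flow_deriv \<kappa> \<mu> p (0, u)) has_derivative
      frechet_derivative (\<lambda>p. flow_deriv \<kappa> \<mu> p (0, u)) (at (t, \<xi>))) (at (t, \<xi>))"
    by (rule smooth_on_has_derivative[OF smooth_on_derivative[OF F] in_R])
  have "((\<lambda>s. (s, \<xi>)) has_derivative (\<lambda>r. r *\<^sub>R (1, 0))) (at t)"
    by (rule has_derivative_eq_rhs[OF has_derivative_Pair[OF has_derivative_ident has_derivative_const]]) auto
  from has_derivative_compose[of "\<lambda>s. (s, \<xi>)" _ t UNIV "\<lambda>p. flow_deriv \<kappa> \<mu> p (0, u)", OF this D]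
  have 1: "((\<lambda>s. flow_deriv \<kappa> \<mu> (s, \<xi>) (0, u)) has_vector_derivative
      frechet_derivative (\<lambda>p. flow_deriv \<kappa> \<mu> p (0, u)) (at (t, \<xi>)) (1, 0)) (at t)"
    unfolding has_vector_derivative_def linear_scale[OF has_derivative_linear[OF D]] .
  have w: "(?w has_derivative frechet_derivative ?w (at (?F (t, \<xi>)))) (at (?F (t, \<xi>)))"
    by (rule smooth_on_has_derivative[OF smooth_W[OF assms(2)] in_img])
  have Fd: "(?F has_derivative flow_deriv \<kappa> \<mu> (t, \<xi>)) (at (t, \<xi>))"
    by (rule smooth_on_has_derivative[OF F in_R])
  from has_derivative_compose[of ?F _ "(t, \<xi>)" UNIV ?w, OF Fd w]
  have "((\<lambda>p. flow_deriv \<kappa> \<mu> p (1, 0)) has_derivative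
      (\<lambda>v. frechet_derivative ?w (at (?F (t, \<xi>))) (flow_deriv \<kappa> \<mu> (t, \<xi>) v))) (at (t, \<xi>))"
  proof (rule has_derivative_transform_within_open[OF _ R in_R])
    fix p assume "p \<in> ?R"
    then obtain s \<eta> where p: "p = (s, \<eta>)" "\<eta> \<in> chart_img \<kappa>" "\<phi> s (chart_inv \<kappa> \<eta>) \<in> chart_dom \<mu>"
      by (auto simp: region_def)
    then show "?w (?F p) = flow_deriv \<kappa> \<mu> p (1, 0)"
      using flow_deriv_time[OF assms(1,2) p(2,3)] assms by (simp add: flow_coord_def)
  qed
  from fun_cong[OF frechet_derivative_at[OF this], of "(0, u)"]
  have "frechet_derivative (\<lambda>p. flow_deriv \<kappa> \<mu> p (1, 0)) (at (t, \<xi>)) (0, u)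
     = frechet_derivative ?w (at (?F (t, \<xi>))) (flow_deriv \<kappa> \<mu> (t, \<xi>) (0, u))" by simp
  with 1 show ?thesis
    by (simp only: mixed_derivatives_commute[OF R F in_R, of "(0, u)" "(1, 0)"])
qed

text \<open>
  In a chart, the time derivative of the left-hand side is the Lie derivative of the metric
  evaluated at the two pushed vectors: the evolution equation of the differential of the flow
  supplies exactly the two terms of the Killing equation that contain derivatives of \<open>W\<close>. Hence the
  left-hand side is constant in time, and at time 0 it is the right-hand side.
\<close>
lemma push_isometry:
  assumes "\<kappa> \<in> \<A>" "x \<in> chart_dom \<kappa>"
  defines "\<xi> \<equiv> chart_map \<kappa> x"
  shows "h (\<phi> t x) (push \<kappa> t \<xi> u) (push \<kappa> t \<xi> v) = metric \<kappa> \<xi> u v"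
proof -
  define H where "H t = h (\<phi> t x) (push \<kappa> t \<xi> u) (push \<kappa> t \<xi> v)" for t
  have \<xi>: "\<xi> \<in> chart_img \<kappa>" "chart_inv \<kappa> \<xi> = x" using assms by (auto simp: \<xi>_def)
  have "(H has_real_derivative 0) (at t)" for t
  proof -
    obtain \<mu> where \<mu>: "\<mu> \<in> \<A>" "\<phi> t x \<in> chart_dom \<mu>" by (rule chart_around)
    define a where "a = (\<lambda>z s. flow_deriv \<kappa> \<mu> (s, \<xi>) (0, z))"
    define y where "y = (\<lambda>s. chart_map \<mu> (\<phi> s x))"
    let ?dw = "frechet_derivative (\<lambda>\<eta>. W (chart_inv \<mu> \<eta>) \<mu>) (at (y t))"
    have y: "(y has_vector_derivative W (chart_inv \<mu> (y t)) \<mu>) (at t)" "y t \<in> chart_img \<mu>"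
      using flow_time_derivative[OF \<mu>] \<mu> by (simp_all add: y_def)
    have a: "(a z has_vector_derivative ?dw (a z t)) (at t)" for z
      using flow_deriv_evolution[OF assms(1) \<mu>(1) \<xi>(1), of t z] \<mu> \<xi>
      by (simp add: a_def y_def flow_coord_def)
    have "((\<lambda>s. metric \<mu> (y s) (a u s) (a v s)) has_real_derivative
        frechet_derivative (\<lambda>\<eta>. metric \<mu> \<eta> (a u t) (a v t)) (at (y t)) (W (chart_inv \<mu> (y t)) \<mu>)
       + metric \<mu> (y t) (?dw (a u t)) (a v t) + metric \<mu> (y t) (a u t) (?dw (a v t))) (at t)"
      by (rule metric_along_curve[OF \<mu>(1) y(2,1) a a])
    then have deriv: "((\<lambda>s. metric \<mu> (y s) (a u s) (a v s)) has_real_derivative 0) (at t)"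
      by (simp only: killing_equation[OF \<mu>(1) y(2)])
    have "open ((\<lambda>s. \<phi> s x) -` chart_dom \<mu>)"
      by (intro open_vimage open_chart_dom \<mu> continuous_on_flow continuous_on_id continuous_on_const)
    moreover have "H s = metric \<mu> (y s) (a u s) (a v s)" if "s \<in> (\<lambda>s. \<phi> s x) -` chart_dom \<mu>" for s
    proof -
      have s: "\<phi> s x \<in> chart_dom \<mu>" using that by simp
      show ?thesis
        using push_tangent[OF assms(1) \<xi>(1), of s] \<xi> s \<mu>(1)
        by (simp add: H_def metric_tangent[OF _ _ \<mu>(1) s] push_apply[OF assms(1) \<mu>(1) \<xi>(1)] y_def a_def)
    qed
    ultimately show ?thesis
      using \<mu>(2) by (intro has_field_derivative_transform_within_open[OF deriv]) auto
  qed
  then have "H t = H 0" by (intro DERIV_isconst_all) blast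
  also have "H 0 = metric \<kappa> \<xi> u v"
    unfolding H_def metric_coord_def \<xi>(2) \<xi>_def push_zero[OF assms(1,2)] using assms by simp
  finally show ?thesis by (simp add: H_def)
qed

text \<open>
  The navigation identities. The velocity of \<open>\<phi> (f s) (c s)\<close> is the isometric image of the velocity
  of \<open>c\<close> plus \<open>r\<close> times \<open>W\<close>, and the flow preserves the unit field \<open>W\<close>. Everything that the comparison
  of the two geometries uses about the flow is contained in these identities.
\<close>
lemma
  assumes c: "open J" "smooth_curve_on \<A> J c" and f: "smooth_on J f" "(f has_real_derivative r) (at t)"
    and t: "t \<in> J"
  defines "v \<equiv> velocity \<A> c J t" and "v' \<equiv> velocity \<A> (\<lambda>s. \<phi> (f s) (c s)) J t"
  shows velocity_flow_tangent: "v' \<in> tangent_space \<A> (\<phi> (f t) (c t))"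
    and norm_velocity_flow: "h (\<phi> (f t) (c t)) v' v' = h (c t) v v + 2 * r * h (c t) v (W (c t)) + r\<^sup>2"
    and inner_W_velocity_flow: "h (\<phi> (f t) (c t)) v' (W (\<phi> (f t) (c t))) = h (c t) v (W (c t)) + r"
proof -
  obtain \<kappa> where \<kappa>: "\<kappa> \<in> \<A>" "c t \<in> chart_dom \<kappa>" by (rule chart_around)
  let ?\<xi> = "chart_map \<kappa> (c t)" and ?x = "\<phi> (f t) (c t)"
  let ?p = "push \<kappa> (f t) ?\<xi> (v \<kappa>)"
  have v: "v \<in> tangent_space \<A> (c t)" unfolding v_def by (rule velocity_tangent[OF c t])
  have p: "?p \<in> tangent_space \<A> ?x"
    using push_tangent[OF \<kappa>(1) chart_map_in_img[OF \<kappa>]] \<kappa> by simp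
  have v': "v' = (\<lambda>\<mu>. ?p \<mu> + r *\<^sub>R W ?x \<mu>)"
    unfolding v_def v'_def by (rule velocity_flow[OF c f t \<kappa>])
  have pp: "h ?x ?p ?p = h (c t) v v"
    by (simp add: push_isometry[OF \<kappa>] metric_tangent[OF v v \<kappa>])
  have "h ?x ?p (push \<kappa> (f t) ?\<xi> (W (c t) \<kappa>)) = h (c t) v (W (c t))"
    by (simp add: push_isometry[OF \<kappa>] metric_tangent[OF v W_tangent \<kappa>])
  then have pW: "h ?x ?p (W ?x) = h (c t) v (W (c t))"
    by (simp add: push_W[OF \<kappa>])
  show "v' \<in> tangent_space \<A> ?x"
    unfolding v' by (rule tangent_space_add_scaleR[OF p W_tangent])
  show "h ?x v' v' = h (c t) v v + 2 * r * h (c t) v (W (c t)) + r\<^sup>2"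
    unfolding v' by (simp add: norm_combination[OF p W_tangent] pp pW)
  show "h ?x v' (W ?x) = h (c t) v (W (c t)) + r"
    unfolding v' by (simp add: inner_add_scaleR[OF p W_tangent W_tangent] pW)
qed

lemma continuous_on_metric_velocity:
  assumes c: "open J" "smooth_curve_on \<A> J c"
  shows "continuous_on J (\<lambda>t. h (c t) (velocity \<A> c J t) (velocity \<A> c J t))" (is "continuous_on J ?N")
    and "continuous_on J (\<lambda>t. h (c t) (velocity \<A> c J t) (W (c t)))" (is "continuous_on J ?I")
proof -
  have "isCont ?N t \<and> isCont ?I t" if t: "t \<in> J" for t
  proof -
    obtain \<kappa> where \<kappa>: "\<kappa> \<in> \<A>" "c t \<in> chart_dom \<kappa>" by (rule chart_around)
    let ?U = "{t \<in> J. c t \<in> chart_dom \<kappa>}" and ?x = "chart_map \<kappa> \<circ> c"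
    let ?v = "\<lambda>s. frechet_derivative ?x (at s) 1"
    have cc: "continuous_on J c" using c by (simp add: smooth_curve_on_def)
    have U: "open ?U" by (rule open_chart_preimage[OF cc c(1) \<kappa>(1)])
    have x: "smooth_on ?U ?x" using c(2) \<kappa> by (simp add: smooth_curve_on_def)
    note cx = smooth_on_continuous_on[OF x] and cv = smooth_on_continuous_on[OF smooth_on_derivative[OF x, of 1]]
    have img: "?x ` ?U \<subseteq> chart_img \<kappa>" using \<kappa> by auto
    have cW: "continuous_on ?U (\<lambda>s. W (chart_inv \<kappa> (?x s)) \<kappa>)"
      by (rule continuous_on_compose2[OF smooth_on_continuous_on[OF smooth_W[OF \<kappa>(1)]] cx img])
    have vel: "velocity \<A> c J s \<kappa> = ?v s" if "s \<in> ?U" for s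
    proof (rule vector_derivative_unique_at)
      show "(?x has_vector_derivative velocity \<A> c J s \<kappa>) (at s)"
        using velocity_has_vector_derivative[OF c, of s \<kappa>] that \<kappa> by (simp add: o_def)
      show "(?x has_vector_derivative ?v s) (at s)"
        by (rule smooth_on_has_vector_derivative[OF x that])
    qed
    have tan: "velocity \<A> c J s \<in> tangent_space \<A> (c s)" if "s \<in> ?U" for s
      using velocity_tangent[OF c] that by blast
    have N: "?N s = metric \<kappa> (?x s) (?v s) (?v s)"
      and I: "?I s = metric \<kappa> (?x s) (?v s) (W (chart_inv \<kappa> (?x s)) \<kappa>)" if "s \<in> ?U" for s
    proof -
      have "c s \<in> chart_dom \<kappa>" using that by simp
      then show "?N s = metric \<kappa> (?x s) (?v s) (?v s)"
        "?I s = metric \<kappa> (?x s) (?v s) (W (chart_inv \<kappa> (?x s)) \<kappa>)"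
        using tan[OF that] vel[OF that] \<kappa>(1) by (simp_all add: metric_tangent[OF _ _ \<kappa>(1)])
    qed
    have "t \<in> ?U" using t \<kappa> by simp
    moreover have "continuous_on ?U ?N"
      by (rule continuous_on_eq[OF metric_continuous_on[OF \<kappa>(1) img cx cv cv] N[symmetric]])
    moreover have "continuous_on ?U ?I"
      by (rule continuous_on_eq[OF metric_continuous_on[OF \<kappa>(1) img cx cv cW] I[symmetric]])
    ultimately show ?thesis by (simp only: continuous_on_eq_continuous_at[OF U])
  qed
  then show "continuous_on J ?N" "continuous_on J ?I"
    by (auto intro: continuous_at_imp_continuous_on)
qed

end

section \<open>Curves, lengths and separations\<close>

lemma partition_mono:
  fixes \<tau> :: "nat \<Rightarrow> real"
  assumes "\<And>i. i < m \<Longrightarrow> \<tau> i < \<tau> (Suc i)" "i \<le> j" "j \<le> m"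
  shows "\<tau> i \<le> \<tau> j"
  using assms(2,3)
proof (induction j rule: dec_induct)
  case (step n)
  then show ?case using assms(1)[of n] by simp
qed simp

lemma partition_locate:
  fixes \<tau> :: "nat \<Rightarrow> real"
  assumes "\<tau> 0 \<le> t" "t \<le> \<tau> m" "t \<notin> \<tau> ` {..m}"
  shows "\<exists>i<m. \<tau> i < t \<and> t < \<tau> (Suc i)"
  using assms
proof (induction m)
  case 0
  then show ?case by auto
next
  case (Suc m)
  show ?case
  proof (cases "t \<le> \<tau> m")
    case True
    have "t \<notin> \<tau> ` {..m}" using Suc.prems(3) by (simp add: atMost_Suc)
    with Suc.IH[OF Suc.prems(1) True] obtain i where "i < m" "\<tau> i < t \<and> t < \<tau> (Suc i)" by blast
    then show ?thesis by (intro exI[of _ i]) simp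
  next
    case False
    moreover have "t \<noteq> \<tau> (Suc m)" using Suc.prems(3) by (auto simp: atMost_Suc)
    ultimately show ?thesis using Suc.prems(2) by (intro exI[of _ m]) simp
  qed
qed

context atlas
begin

lemma velocity_interior_cong:
  assumes "t \<in> interior S" "t \<in> interior T" "open U" "t \<in> U" "\<And>s. s \<in> U \<Longrightarrow> c s = c' s"
  shows "velocity \<A> c S t = velocity \<A> c' T t"
proof
  fix \<kappa> :: "('a, 'n) chart"
  have "vector_derivative (chart_map \<kappa> \<circ> c) (at t within S) = vector_derivative (chart_map \<kappa> \<circ> c') (at t within T)"
    unfolding at_within_interior[OF assms(1)] at_within_interior[OF assms(2)]
    by (rule vector_derivative_cong_eq) (use assms in \<open>auto simp: eventually_nhds\<close>)
  then show "velocity \<A> c S t \<kappa> = velocity \<A> c' T t \<kappa>"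
    using assms(4,5) by (simp add: velocity_def)
qed

lemma velocity_shift:
  "velocity \<A> (\<lambda>t. c (t - s)) {a + s..b + s} (t + s) = velocity \<A> c {a..b} t"
proof -
  have eq: "vector_derivative (chart_map \<kappa> \<circ> (\<lambda>t. c (t - s))) (at (t + s) within {a + s..b + s})
      = vector_derivative (chart_map \<kappa> \<circ> c) (at t within {a..b})" for \<kappa> :: "('a, 'n) chart"
    using has_vector_derivative_shift[of "chart_map \<kappa> \<circ> c" s _ t a b]
    by (simp add: vector_derivative_def o_def)
  show ?thesis
  proof
    fix \<kappa>
    show "velocity \<A> (\<lambda>t. c (t - s)) {a + s..b + s} (t + s) \<kappa> = velocity \<A> c {a..b} t \<kappa>"
      by (simp add: velocity_def eq)
  qed
qed

definition smooth_arc :: "('a \<Rightarrow> ('a, 'n) tvec set) \<Rightarrow> (real \<Rightarrow> 'a) \<Rightarrow> real \<Rightarrow> real \<Rightarrow> bool" where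
  "smooth_arc D c a b \<longleftrightarrow> a < b \<and>
     (\<exists>J e. open J \<and> {a..b} \<subseteq> J \<and> smooth_curve_on \<A> J e \<and> (\<forall>t\<in>{a..b}. e t = c t)) \<and>
     (\<forall>t\<in>{a..b}. velocity \<A> c {a..b} t \<in> D (c t))"

lemma piecewise_smooth_curve_iff:
  "piecewise_smooth_curve \<A> D c a b \<longleftrightarrow> a < b \<and> continuous_on {a..b} c \<and>
     (\<exists>m \<tau>. \<tau> 0 = a \<and> \<tau> m = b \<and> (\<forall>i<m. smooth_arc D c (\<tau> i) (\<tau> (Suc i))))"
  unfolding piecewise_smooth_curve_def smooth_arc_def by (rule refl)

lemma smooth_arcE:
  assumes "smooth_arc D c a b"
  obtains J e where "a < b" "open J" "{a..b} \<subseteq> J" "smooth_curve_on \<A> J e" "\<And>t. t \<in> {a..b} \<Longrightarrow> e t = c t"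
    "\<And>t. t \<in> {a..b} \<Longrightarrow> velocity \<A> c {a..b} t = velocity \<A> e J t"
    "\<And>t. t \<in> {a..b} \<Longrightarrow> velocity \<A> e J t \<in> D (e t)"
proof -
  obtain J e where *: "a < b" "open J" "{a..b} \<subseteq> J" "smooth_curve_on \<A> J e" "\<And>t. t \<in> {a..b} \<Longrightarrow> e t = c t"
    using assms unfolding smooth_arc_def by blast
  have v: "velocity \<A> c {a..b} t = velocity \<A> e J t" if "t \<in> {a..b}" for t
    by (rule velocity_within_eq[OF *(2,4,3,1) that *(5)])
  have "velocity \<A> e J t \<in> D (e t)" if "t \<in> {a..b}" for t
  proof -
    have "velocity \<A> c {a..b} t \<in> D (c t)" using assms that by (simp add: smooth_arc_def)
    then show ?thesis using v[OF that] *(5)[OF that] by simp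
  qed
  with * v show ?thesis by (rule that)
qed

lemma smooth_arcI:
  assumes "a < b" "open J" "{a..b} \<subseteq> J" "smooth_curve_on \<A> J e" "\<And>t. t \<in> {a..b} \<Longrightarrow> e t = c t"
    "\<And>t. t \<in> {a..b} \<Longrightarrow> velocity \<A> e J t \<in> D (e t)"
  shows "smooth_arc D c a b"
proof -
  have "velocity \<A> c {a..b} t \<in> D (c t)" if "t \<in> {a..b}" for t
    using velocity_within_eq[OF assms(2,4,3,1) that assms(5)] assms(5,6)[OF that] by simp
  then show ?thesis unfolding smooth_arc_def using assms(1-5) by blast
qed

lemma smooth_arc_cong:
  assumes "smooth_arc D c a b" "\<And>t. t \<in> {a..b} \<Longrightarrow> c' t = c t"
  shows "smooth_arc D c' a b"
  using assms(1)
proof (rule smooth_arcE)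
  fix J e
  assume "a < b" "open J" "{a..b} \<subseteq> J" "smooth_curve_on \<A> J e" "\<And>t. t \<in> {a..b} \<Longrightarrow> e t = c t"
    "\<And>t. t \<in> {a..b} \<Longrightarrow> velocity \<A> e J t \<in> D (e t)"
  then show ?thesis using assms(2) by (intro smooth_arcI[of a b J e c' D]) simp_all
qed

lemma smooth_arc_imp_continuous_on:
  assumes "smooth_arc D c a b"
  shows "continuous_on {a..b} c"
  using assms
proof (rule smooth_arcE)
  fix J e
  assume *: "{a..b} \<subseteq> J" "smooth_curve_on \<A> J e" "\<And>t. t \<in> {a..b} \<Longrightarrow> e t = c t"
  then have "continuous_on {a..b} e" by (auto simp: smooth_curve_on_def intro: continuous_on_subset)
  then show ?thesis using * by (rule_tac continuous_on_eq)
qed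

lemma smooth_arc_piecewise:
  assumes "smooth_arc D c a b"
  shows "piecewise_smooth_curve \<A> D c a b"
  unfolding piecewise_smooth_curve_iff
proof (intro conjI exI)
  show "a < b" using assms by (simp add: smooth_arc_def)
  show "continuous_on {a..b} c" by (rule smooth_arc_imp_continuous_on[OF assms])
  show "(if (0::nat) = 0 then a else b) = a" "(if Suc 0 = 0 then a else b) = b" by auto
  show "\<forall>i<Suc 0. smooth_arc D c (if i = 0 then a else b) (if Suc i = 0 then a else b)"
    using assms by auto
qed

lemma smooth_arc_shift:
  assumes "smooth_arc D c a b"
  shows "smooth_arc D (\<lambda>t. c (t - s)) (a + s) (b + s)"
  using assms
proof (rule smooth_arcE)
  fix J e
  assume J: "a < b" "open J" "{a..b} \<subseteq> J" and e: "smooth_curve_on \<A> J e" "\<And>t. t \<in> {a..b} \<Longrightarrow> e t = c t"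
  let ?K = "(\<lambda>t. t - s) -` J"
  have K: "open ?K" by (intro open_vimage J continuous_intros)
  have "smooth_on UNIV (\<lambda>t. t - s)"
    by (intro smooth_on_real_polynomial real_polynomial_function_diff real_polynomial_function.intros(2)
        real_polynomial_function.intros(1) bounded_linear_ident)
  then have "smooth_on ?K (\<lambda>t. t - s)" by (rule smooth_on_subset) simp
  then have sm: "smooth_curve_on \<A> ?K (\<lambda>t. e (t - s))"
    by (intro smooth_curve_on_reparametrize[OF J(2) e(1) K]) auto
  have "velocity \<A> (\<lambda>t. c (t - s)) {a + s..b + s} t \<in> D (c (t - s))" if "t \<in> {a + s..b + s}" for t
    using velocity_shift[of c s a b "t - s"] that assms by (auto simp: smooth_arc_def)
  moreover have "\<exists>J e. open J \<and> {a + s..b + s} \<subseteq> J \<and> smooth_curve_on \<A> J e \<and> (\<forall>t\<in>{a + s..b + s}. e t = c (t - s))"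
  proof (intro exI conjI)
    show "{a + s..b + s} \<subseteq> ?K" using J(3) by (auto simp: subset_eq)
    show "\<forall>t\<in>{a + s..b + s}. e (t - s) = c (t - s)" using e(2) by auto
  qed (fact K sm)+
  ultimately show ?thesis unfolding smooth_arc_def using J(1) by auto
qed

lemma piecewise_smooth_curve_shift:
  assumes "piecewise_smooth_curve \<A> D c a b"
  shows "piecewise_smooth_curve \<A> D (\<lambda>t. c (t - s)) (a + s) (b + s)"
proof -
  obtain m \<tau> where *: "a < b" "continuous_on {a..b} c" "\<tau> 0 = a" "\<tau> m = b"
    "\<And>i. i < m \<Longrightarrow> smooth_arc D c (\<tau> i) (\<tau> (Suc i))"
    using assms unfolding piecewise_smooth_curve_iff by blast
  have "continuous_on {a + s..b + s} (\<lambda>t. c (t - s))"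
    by (intro continuous_on_compose2[OF *(2)] continuous_intros) auto
  then show ?thesis
    unfolding piecewise_smooth_curve_iff
    using * smooth_arc_shift[of D c _ _ s]
    by (intro conjI exI[of _ m] exI[of _ "\<lambda>i. \<tau> i + s"]) auto
qed

lemma curve_length_shift:
  "curve_length \<A> F (\<lambda>t. c (t - s)) (a + s) (b + s) = curve_length \<A> F c a b"
proof -
  let ?g = "\<lambda>t. F (c t) (velocity \<A> c {a..b} t)"
  let ?f = "\<lambda>t. F (c (t - s)) (velocity \<A> (\<lambda>t. c (t - s)) {a + s..b + s} t)"
  have f: "?f = (\<lambda>t. ?g (t - s))" using velocity_shift[of c s a b "t - s" for t] by simp
  have "(?f has_integral i) {a + s..b + s} \<longleftrightarrow> (?g has_integral i) {a..b}" for i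
    using has_integral_affinity_iff[of 1 ?g "- s" i a b] unfolding f by simp
  then show ?thesis unfolding curve_length_def integral_def integrable_on_def by simp
qed

lemma piecewise_smooth_curve_join:
  assumes "piecewise_smooth_curve \<A> D c1 a b" "piecewise_smooth_curve \<A> D c2 b d" "c1 b = c2 b"
  shows "piecewise_smooth_curve \<A> D (\<lambda>t. if t \<le> b then c1 t else c2 t) a d" (is "piecewise_smooth_curve _ _ ?c _ _")
proof -
  obtain m \<tau> where 1: "a < b" "continuous_on {a..b} c1" "\<tau> 0 = a" "\<tau> m = b"
    "\<And>i. i < m \<Longrightarrow> smooth_arc D c1 (\<tau> i) (\<tau> (Suc i))"
    using assms(1) unfolding piecewise_smooth_curve_iff by blast
  obtain n \<sigma> where 2: "b < d" "continuous_on {b..d} c2" "\<sigma> 0 = b" "\<sigma> n = d"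
    "\<And>i. i < n \<Longrightarrow> smooth_arc D c2 (\<sigma> i) (\<sigma> (Suc i))"
    using assms(2) unfolding piecewise_smooth_curve_iff by blast
  have lt1: "\<tau> i < \<tau> (Suc i)" if "i < m" for i using 1(5)[OF that] by (simp add: smooth_arc_def)
  have lt2: "\<sigma> i < \<sigma> (Suc i)" if "i < n" for i using 2(5)[OF that] by (simp add: smooth_arc_def)
  have cont: "continuous_on {a..d} ?c"
    using 1(1,2) 2(1,2) assms(3)
    by (intro continuous_on_cases_le continuous_on_id) (auto elim: continuous_on_subset)
  define \<upsilon> where "\<upsilon> i = (if i \<le> m then \<tau> i else \<sigma> (i - m))" for i
  have "smooth_arc D ?c (\<upsilon> i) (\<upsilon> (Suc i))" if "i < m + n" for i
  proof (cases "i < m")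
    case True
    have "\<tau> (Suc i) \<le> b" using partition_mono[of m \<tau> "Suc i" m, OF lt1] True 1(4) by simp
    then show ?thesis
      using smooth_arc_cong[OF 1(5)[OF True], of ?c] True by (simp add: \<upsilon>_def)
  next
    case False
    then have i: "i - m < n" "\<upsilon> i = \<sigma> (i - m)" "\<upsilon> (Suc i) = \<sigma> (Suc (i - m))"
      using that 1(4) 2(3) by (auto simp: \<upsilon>_def Suc_diff_le)
    have "b \<le> \<sigma> (i - m)" using partition_mono[of n \<sigma> 0 "i - m", OF lt2] i(1) 2(3) by simp
    then have "?c t = c2 t" if "t \<in> {\<sigma> (i - m)..\<sigma> (Suc (i - m))}" for t
      using that assms(3) by (cases "t = b") auto
    then show ?thesis unfolding i(2,3) by (rule smooth_arc_cong[OF 2(5)[OF i(1)]])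
  qed
  moreover have "0 < n" using 2(1,3,4) by (cases n) auto
  then have "\<upsilon> 0 = a" "\<upsilon> (m + n) = d" using 1(3) 2(4) by (simp_all add: \<upsilon>_def)
  ultimately show ?thesis
    unfolding piecewise_smooth_curve_iff using 1(1) 2(1) cont
    by (intro conjI exI[of _ "m + n"] exI[of _ \<upsilon>]) auto
qed

text \<open>
  Only an inequality is claimed, which suffices for infima: if the joined speed is not integrable,
  then its integral is 0 by convention.
\<close>
lemma curve_length_join:
  assumes "a < b" "b < d" and nonneg: "0 \<le> curve_length \<A> F c1 a b" "0 \<le> curve_length \<A> F c2 b d"
  shows "curve_length \<A> F (\<lambda>t. if t \<le> b then c1 t else c2 t) a d
     \<le> curve_length \<A> F c1 a b + curve_length \<A> F c2 b d"
proof -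
  let ?c = "\<lambda>t. if t \<le> b then c1 t else c2 t"
  let ?g = "\<lambda>t. F (?c t) (velocity \<A> ?c {a..d} t)"
  have "velocity \<A> ?c {a..d} t = velocity \<A> c1 {a..b} t" if "t \<in> {a..b} - {a, b}" for t
    by (rule velocity_interior_cong[of _ _ _ "{a<..<b}"]) (use that assms in auto)
  then have i1: "integral {a..b} ?g = curve_length \<A> F c1 a b"
    unfolding curve_length_def by (intro integral_spike[of "{a, b}"]) auto
  have "velocity \<A> ?c {a..d} t = velocity \<A> c2 {b..d} t" if "t \<in> {b..d} - {b, d}" for t
    by (rule velocity_interior_cong[of _ _ _ "{b<..<d}"]) (use that assms in auto)
  then have i2: "integral {b..d} ?g = curve_length \<A> F c2 b d"
    unfolding curve_length_def by (intro integral_spike[of "{b, d}"]) auto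
  show ?thesis
  proof (cases "?g integrable_on {a..d}")
    case True
    then show ?thesis
      using Henstock_Kurzweil_Integration.integral_combine[of a b d ?g] assms(1,2) i1 i2
      by (simp add: curve_length_def)
  next
    case False
    then show ?thesis using nonneg by (simp add: curve_length_def not_integrable_integral)
  qed
qed

lemma velocity_subinterval:
  assumes "a \<le> a'" "b' \<le> b" "t \<in> {a'<..<b'}"
  shows "velocity \<A> c {a..b} t = velocity \<A> c {a'..b'} t"
  by (rule velocity_interior_cong[of _ _ _ UNIV]) (use assms in auto)

text \<open>
  At the break points the velocity with respect to the whole interval is an arbitrary value, so that
  the speed is known to be nonnegative only off a finite set.
\<close>
lemma curve_length_nonneg:
  assumes "piecewise_smooth_curve \<A> D c a b" and nonneg: "\<And>x y. y \<in> D x \<Longrightarrow> 0 \<le> F x y"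
  shows "0 \<le> curve_length \<A> F c a b"
proof -
  obtain m \<tau> where *: "\<tau> 0 = a" "\<tau> m = b" "\<And>i. i < m \<Longrightarrow> smooth_arc D c (\<tau> i) (\<tau> (Suc i))"
    using assms(1) unfolding piecewise_smooth_curve_iff by blast
  have lt: "\<tau> i < \<tau> (Suc i)" if "i < m" for i using *(3)[OF that] by (simp add: smooth_arc_def)
  let ?g = "\<lambda>t. F (c t) (velocity \<A> c {a..b} t)"
  have "0 \<le> ?g t" if t: "t \<in> {a..b} - \<tau> ` {..m}" for t
  proof -
    obtain i where i: "i < m" "\<tau> i < t" "t < \<tau> (Suc i)"
      using partition_locate[of \<tau> t m] t * by auto
    have "a \<le> \<tau> i" "\<tau> (Suc i) \<le> b"
      using partition_mono[of m \<tau> 0 i, OF lt] partition_mono[of m \<tau> "Suc i" m, OF lt] i *(1,2) by auto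
    then have "velocity \<A> c {a..b} t = velocity \<A> c {\<tau> i..\<tau> (Suc i)} t"
      using i by (intro velocity_subinterval) auto
    then show ?thesis using *(3)[OF i(1)] i nonneg by (simp add: smooth_arc_def)
  qed
  then have spike: "integral {a..b} ?g = integral {a..b} (\<lambda>t. \<bar>?g t\<bar>)"
    by (intro integral_spike[of "\<tau> ` {..m}"]) auto
  have "0 \<le> integral {a..b} (\<lambda>t. \<bar>?g t\<bar>)"
  proof (cases "(\<lambda>t. \<bar>?g t\<bar>) integrable_on {a..b}")
    case True
    then show ?thesis by (intro Henstock_Kurzweil_Integration.integral_nonneg) auto
  qed (simp add: not_integrable_integral)
  with spike show ?thesis by (simp add: curve_length_def)
qed

lemma curve_length_le:
  assumes "a \<le> b" "0 \<le> k" "\<And>t. t \<in> {a..b} \<Longrightarrow> F (c t) (velocity \<A> c {a..b} t) \<le> k"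
  shows "curve_length \<A> F c a b \<le> k * (b - a)"
proof (cases "(\<lambda>t. F (c t) (velocity \<A> c {a..b} t)) integrable_on {a..b}")
  case True
  have "curve_length \<A> F c a b \<le> integral {a..b} (\<lambda>t. k)"
    unfolding curve_length_def by (intro integral_le True assms) auto
  then show ?thesis using assms(1) by (simp add: mult.commute)
next
  case False
  then show ?thesis using assms by (simp add: curve_length_def not_integrable_integral)
qed

lemma curve_length_const:
  assumes "a \<le> b" "\<And>t. t \<in> {a..b} \<Longrightarrow> F (c t) (velocity \<A> c {a..b} t) = k"
  shows "curve_length \<A> F c a b = k * (b - a)"
proof -
  have "curve_length \<A> F c a b = integral {a..b} (\<lambda>t. k)"
    unfolding curve_length_def by (intro integral_cong) (simp add: assms)
  then show ?thesis using assms(1) by (simp add: mult.commute)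
qed

lemma curve_length_partition:
  assumes \<tau>: "\<tau> 0 = a" "\<tau> m = b" and arcs: "\<And>i. i < m \<Longrightarrow> smooth_arc D c (\<tau> i) (\<tau> (Suc i))"
    and cont: "\<And>i. i < m \<Longrightarrow> continuous_on {\<tau> i..\<tau> (Suc i)} (\<lambda>t. F (c t) (velocity \<A> c {\<tau> i..\<tau> (Suc i)} t))"
  shows "curve_length \<A> F c a b = (\<Sum>i<m. curve_length \<A> F c (\<tau> i) (\<tau> (Suc i)))"
proof -
  let ?g = "\<lambda>t. F (c t) (velocity \<A> c {a..b} t)"
  have lt: "\<tau> i < \<tau> (Suc i)" if "i < m" for i using arcs[OF that] by (simp add: smooth_arc_def)
  have piece: "(?g has_integral curve_length \<A> F c (\<tau> i) (\<tau> (Suc i))) {\<tau> i..\<tau> (Suc i)}" if i: "i < m" for i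
  proof -
    have "a \<le> \<tau> i" "\<tau> (Suc i) \<le> b"
      using partition_mono[of m \<tau> 0 i, OF lt] partition_mono[of m \<tau> "Suc i" m, OF lt] i \<tau> by auto
    then have "velocity \<A> c {a..b} t = velocity \<A> c {\<tau> i..\<tau> (Suc i)} t"
      if "t \<in> {\<tau> i..\<tau> (Suc i)} - {\<tau> i, \<tau> (Suc i)}" for t
      using that by (intro velocity_subinterval) auto
    moreover have "((\<lambda>t. F (c t) (velocity \<A> c {\<tau> i..\<tau> (Suc i)} t)) has_integral
        curve_length \<A> F c (\<tau> i) (\<tau> (Suc i))) {\<tau> i..\<tau> (Suc i)}"
      unfolding curve_length_def by (intro integrable_integral integrable_continuous_real cont i)
    ultimately show ?thesis
      by (intro has_integral_spike_finite[of "{\<tau> i, \<tau> (Suc i)}" _ ?g]) auto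
  qed
  have "(?g has_integral (\<Sum>i<k. curve_length \<A> F c (\<tau> i) (\<tau> (Suc i)))) {a..\<tau> k}" if "k \<le> m" for k
    using that
  proof (induction k)
    case 0
    then show ?case using \<tau>(1) by (simp add: has_integral_refl)
  next
    case (Suc k)
    have "a \<le> \<tau> k" using partition_mono[of m \<tau> 0 k, OF lt] Suc.prems \<tau>(1) by simp
    moreover have "\<tau> k \<le> \<tau> (Suc k)" using lt[of k] Suc.prems by simp
    ultimately show ?case
      using has_integral_combine[OF _ _ Suc.IH piece[of k]] Suc.prems by simp
  qed
  from this[of m] show ?thesis using \<tau>(2) by (simp add: curve_length_def integral_unique)
qed

lemma separation_self [simp]: "separation \<A> D F p p = 0"
  by (simp add: separation_def)

lemma separation_le:
  assumes "piecewise_smooth_curve \<A> D c a b" "curve_length \<A> F c a b \<le> r" "0 \<le> r"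
  shows "separation \<A> D F (c a) (c b) \<le> ereal r"
proof (cases "c a = c b")
  case False
  then have "separation \<A> D F (c a) (c b) \<le> ereal (curve_length \<A> F c a b)"
    unfolding separation_def using assms(1) by (auto intro!: Inf_lower)
  also have "\<dots> \<le> ereal r" using assms(2) by simp
  finally show ?thesis .
qed (use assms in simp)

lemma separation_lessE:
  assumes "separation \<A> D F p q < ereal r" "p \<noteq> q"
  obtains c a b where "piecewise_smooth_curve \<A> D c a b" "c a = p" "c b = q" "curve_length \<A> F c a b < r"
proof -
  have "Inf {ereal (curve_length \<A> F c a b) | c a b. piecewise_smooth_curve \<A> D c a b \<and> c a = p \<and> c b = q} < ereal r"
    using assms by (simp add: separation_def)
  then show ?thesis unfolding Inf_less_iff using that by auto
qed

text \<open>
  If the two end points coincide, then the separation is 0 by definition, and the join of two curves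
  is a closed curve; this is why lengths have to be known to be nonnegative.
\<close>
lemma separation_triangle_less:
  assumes nonneg: "\<And>x y. y \<in> D x \<Longrightarrow> 0 \<le> F x y"
    and \<alpha>: "separation \<A> D F p q < ereal \<alpha>" and \<beta>: "separation \<A> D F q r < ereal \<beta>"
  shows "separation \<A> D F p r < ereal (\<alpha> + \<beta>)"
proof (cases "p = q \<or> q = r")
  case True
  then show ?thesis
  proof
    assume "p = q"
    then have "ereal \<beta> \<le> ereal (\<alpha> + \<beta>)" using \<alpha> by (simp add: zero_ereal_def)
    with \<open>p = q\<close> \<beta> show ?thesis using less_le_trans by blast
  next
    assume "q = r"
    then have "ereal \<alpha> \<le> ereal (\<alpha> + \<beta>)" using \<beta> by (simp add: zero_ereal_def)
    with \<open>q = r\<close> \<alpha> show ?thesis using less_le_trans by blast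
  qed
next
  case False
  obtain c1 a b where 1: "piecewise_smooth_curve \<A> D c1 a b" "c1 a = p" "c1 b = q" "curve_length \<A> F c1 a b < \<alpha>"
    using separation_lessE[OF \<alpha>] False by metis
  obtain c2 a' b' where 2: "piecewise_smooth_curve \<A> D c2 a' b'" "c2 a' = q" "c2 b' = r" "curve_length \<A> F c2 a' b' < \<beta>"
    using separation_lessE[OF \<beta>] False by metis
  define s where "s = b - a'"
  define c3 where "c3 = (\<lambda>t. c2 (t - s))"
  define d where "d = b' + s"
  have 3: "piecewise_smooth_curve \<A> D c3 b d" "c3 b = q" "c3 d = r" "curve_length \<A> F c3 b d < \<beta>"
    using piecewise_smooth_curve_shift[OF 2(1), of s] curve_length_shift[of F c2 s a' b'] 2
    by (simp_all add: c3_def d_def s_def)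
  let ?c = "\<lambda>t. if t \<le> b then c1 t else c3 t"
  have lt: "a < b" "b < d" using 1(1) 3(1) by (auto simp: piecewise_smooth_curve_def)
  have j: "piecewise_smooth_curve \<A> D ?c a d"
    by (rule piecewise_smooth_curve_join[OF 1(1) 3(1)]) (simp add: 1 3)
  have n: "0 \<le> curve_length \<A> F c1 a b" "0 \<le> curve_length \<A> F c3 b d"
    using curve_length_nonneg[OF 1(1), of F] curve_length_nonneg[OF 3(1), of F] nonneg by auto
  have "separation \<A> D F (?c a) (?c d) \<le> ereal (curve_length \<A> F c1 a b + curve_length \<A> F c3 b d)"
    using n by (intro separation_le[OF j curve_length_join[OF lt n]]) simp
  also have "\<dots> < ereal (\<alpha> + \<beta>)" using 1(4) 3(4) by simp
  finally show ?thesis using lt 1(2) 3(3) by simp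
qed

lemma separation_triangle:
  assumes nonneg: "\<And>x y. y \<in> D x \<Longrightarrow> 0 \<le> F x y"
    and \<alpha>: "separation \<A> D F p q \<le> ereal \<alpha>" and \<beta>: "separation \<A> D F q r \<le> ereal \<beta>"
  shows "separation \<A> D F p r \<le> ereal (\<alpha> + \<beta>)"
proof (rule ereal_le_epsilon2)
  fix e :: real assume e: "0 < e"
  have "separation \<A> D F p q < ereal (\<alpha> + e/2)" "separation \<A> D F q r < ereal (\<beta> + e/2)"
    using e by (auto intro: le_less_trans[OF \<alpha>] le_less_trans[OF \<beta>])
  from separation_triangle_less[OF nonneg this]
  have "separation \<A> D F p r < ereal ((\<alpha> + e/2) + (\<beta> + e/2))" .
  moreover have "(\<alpha> + e/2) + (\<beta> + e/2) = \<alpha> + \<beta> + e" by simp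
  ultimately show "separation \<A> D F p r \<le> ereal (\<alpha> + \<beta>) + ereal e"
    by (metis less_imp_le plus_ereal.simps(1))
qed

end

section \<open>Dragging curves along the flow\<close>

context flow
begin

text \<open>
  The time \<open>f\<close> is the one provided by \<open>smooth_majorant_primitive\<close>: it grows by \<open>r\<close>, and its
  derivative exceeds the \<open>F\<close>-speed of \<open>c\<close> everywhere. What dragging along the flow does to velocities is
  left to a pointwise hypothesis, of which both directions of the comparison below are instances.
  The sign \<open>\<sigma>\<close> is the direction of the flow. The weight \<open>\<theta>\<close> measures how far the new speed
  stays below the derivative of \<open>f\<close>; for \<open>\<theta> < 1\<close> the new length is strictly less than \<open>r\<close>.
\<close>
lemma flow_transfer_arc:
  fixes \<sigma> \<theta> r s :: real
  assumes arc: "smooth_arc D c a b"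
    and cont: "continuous_on {a..b} (\<lambda>t. F (c t) (velocity \<A> c {a..b} t))"
    and r: "curve_length \<A> F c a b < r"
    and nonneg: "\<And>x y. y \<in> D x \<Longrightarrow> 0 \<le> F x y" and \<theta>: "0 \<le> \<theta>" "\<theta> \<le> 1"
    and transfer: "\<And>J e f t q. open J \<Longrightarrow> smooth_curve_on \<A> J e \<Longrightarrow> smooth_on J f \<Longrightarrow> t \<in> J \<Longrightarrow>
      (f has_real_derivative q) (at t) \<Longrightarrow> velocity \<A> e J t \<in> D (e t) \<Longrightarrow> F (e t) (velocity \<A> e J t) < q \<Longrightarrow>
      velocity \<A> (\<lambda>s. \<phi> (\<sigma> * f s) (e s)) J t \<in> D' (\<phi> (\<sigma> * f t) (e t)) \<and>
      F' (\<phi> (\<sigma> * f t) (e t)) (velocity \<A> (\<lambda>s. \<phi> (\<sigma> * f s) (e s)) J t)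
        \<le> \<theta> * q + (1 - \<theta>) * F (e t) (velocity \<A> e J t)"
  obtains c' where "smooth_arc D' c' a b" "c' a = \<phi> (\<sigma> * s) (c a)" "c' b = \<phi> (\<sigma> * (s + r)) (c b)"
    "curve_length \<A> F' c' a b \<le> \<theta> * r + (1 - \<theta>) * curve_length \<A> F c a b"
proof -
  let ?u = "\<lambda>t. F (c t) (velocity \<A> c {a..b} t)"
  obtain J e where J: "a < b" "open J" "{a..b} \<subseteq> J" and e: "smooth_curve_on \<A> J e" "\<And>t. t \<in> {a..b} \<Longrightarrow> e t = c t"
    "\<And>t. t \<in> {a..b} \<Longrightarrow> velocity \<A> c {a..b} t = velocity \<A> e J t"
    "\<And>t. t \<in> {a..b} \<Longrightarrow> velocity \<A> e J t \<in> D (e t)"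
    using smooth_arcE[OF arc] by metis
  have "integral {a..b} ?u < r" using r by (simp add: curve_length_def)
  from smooth_majorant_primitive[OF J(1) cont this, of s]
  obtain f g where f: "smooth_on UNIV f" "\<And>t. (f has_real_derivative g t) (at t)"
    and g: "\<And>t. t \<in> {a..b} \<Longrightarrow> ?u t < g t" "continuous_on {a..b} g" and fab: "f a = s" "f b = s + r"
    by blast
  define c' where "c' t = \<phi> (\<sigma> * f t) (e t)" for t
  have fJ: "smooth_on J f" by (rule smooth_on_subset[OF f(1)]) simp
  have sm: "smooth_curve_on \<A> J c'"
    unfolding c'_def by (rule smooth_curve_on_flow[OF J(2) e(1) smooth_on_cmult[OF J(2) fJ]])
  have tr: "velocity \<A> c' J t \<in> D' (c' t) \<and> F' (c' t) (velocity \<A> c' J t) \<le> \<theta> * g t + (1 - \<theta>) * ?u t"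
    if t: "t \<in> {a..b}" for t
  proof -
    have "F (e t) (velocity \<A> e J t) < g t" using g(1)[OF t] e(2,3)[OF t] by simp
    from transfer[OF J(2) e(1) fJ _ f(2) e(4)[OF t] this] show ?thesis
      using t J(3) e(2,3)[OF t] unfolding c'_def by auto
  qed
  have arc': "smooth_arc D' c' a b"
    by (rule smooth_arcI[OF J sm]) (use tr in auto)
  have vel: "velocity \<A> c' {a..b} t = velocity \<A> c' J t" if "t \<in> {a..b}" for t
    by (rule velocity_within_eq[OF J(2) sm J(3,1) that]) simp
  have "(g has_integral r) {a..b}"
    using fundamental_theorem_of_calculus[of a b f g] J(1) f(2) fab
    by (simp add: has_real_derivative_iff_has_vector_derivative has_vector_derivative_at_within)
  moreover have "(?u has_integral curve_length \<A> F c a b) {a..b}"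
    unfolding curve_length_def by (intro integrable_integral integrable_continuous_real cont)
  ultimately have bound: "((\<lambda>t. \<theta> * g t + (1 - \<theta>) * ?u t) has_integral
      (\<theta> * r + (1 - \<theta>) * curve_length \<A> F c a b)) {a..b}"
    by (intro has_integral_add has_integral_mult_right)
  have "curve_length \<A> F' c' a b \<le> \<theta> * r + (1 - \<theta>) * curve_length \<A> F c a b"
  proof (cases "(\<lambda>t. F' (c' t) (velocity \<A> c' {a..b} t)) integrable_on {a..b}")
    case True
    show ?thesis
      unfolding curve_length_def[of \<A> F' c']
      by (rule has_integral_le[OF integrable_integral[OF True] bound]) (use tr vel in auto)
  next
    case False
    have "0 \<le> curve_length \<A> F c a b"
      using curve_length_nonneg[OF smooth_arc_piecewise[OF arc], of F] nonneg by auto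
    then show ?thesis
      using False r \<theta> by (simp add: curve_length_def[of \<A> F' c'] not_integrable_integral)
  qed
  moreover have "c' a = \<phi> (\<sigma> * s) (c a)" "c' b = \<phi> (\<sigma> * (s + r)) (c b)"
    using J(1) e(2)[of a] e(2)[of b] fab by (simp_all add: c'_def)
  ultimately show ?thesis using arc' that by blast
qed

text \<open>
  The pieces of a curve are dragged one after the other, each starting at the flow time at which the
  preceding one stopped, and the triangle inequality joins them in the target structure.
\<close>
lemma flow_transfer_separation:
  fixes \<sigma> \<theta> r :: real
  assumes cont: "\<And>c a b. smooth_arc D c a b \<Longrightarrow> continuous_on {a..b} (\<lambda>t. F (c t) (velocity \<A> c {a..b} t))"
    and nonneg: "\<And>x y. y \<in> D x \<Longrightarrow> 0 \<le> F x y" and nonneg': "\<And>x y. y \<in> D' x \<Longrightarrow> 0 \<le> F' x y"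
    and \<theta>: "0 \<le> \<theta>" "\<theta> \<le> 1"
    and transfer: "\<And>J e f t q. open J \<Longrightarrow> smooth_curve_on \<A> J e \<Longrightarrow> smooth_on J f \<Longrightarrow> t \<in> J \<Longrightarrow>
      (f has_real_derivative q) (at t) \<Longrightarrow> velocity \<A> e J t \<in> D (e t) \<Longrightarrow> F (e t) (velocity \<A> e J t) < q \<Longrightarrow>
      velocity \<A> (\<lambda>s. \<phi> (\<sigma> * f s) (e s)) J t \<in> D' (\<phi> (\<sigma> * f t) (e t)) \<and>
      F' (\<phi> (\<sigma> * f t) (e t)) (velocity \<A> (\<lambda>s. \<phi> (\<sigma> * f s) (e s)) J t)
        \<le> \<theta> * q + (1 - \<theta>) * F (e t) (velocity \<A> e J t)"
    and "p \<noteq> q" "separation \<A> D F p q < ereal r"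
  obtains L where "L < r" "separation \<A> D' F' p (\<phi> (\<sigma> * r) q) \<le> ereal (\<theta> * r + (1 - \<theta>) * L)"
proof -
  obtain c a b where c: "piecewise_smooth_curve \<A> D c a b" "c a = p" "c b = q" "curve_length \<A> F c a b < r"
    using separation_lessE[OF assms(8,7)] by metis
  obtain m \<tau> where \<tau>: "a < b" "\<tau> 0 = a" "\<tau> m = b" "\<And>i. i < m \<Longrightarrow> smooth_arc D c (\<tau> i) (\<tau> (Suc i))"
    using c(1) unfolding piecewise_smooth_curve_iff by blast
  have m: "0 < m" using \<tau>(1-3) by (cases m) auto
  define L where "L i = curve_length \<A> F c (\<tau> i) (\<tau> (Suc i))" for i
  define total where "total = curve_length \<A> F c a b"
  \<comment> \<open>Each of the \<open>m\<close> pieces may use the same share of the slack between the length and \<open>r\<close>.\<close>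
  define \<delta> where "\<delta> = (r - total) / m"
  have \<delta>: "0 < \<delta>" using c(4) m by (simp add: \<delta>_def total_def)
  have total: "total = (\<Sum>i<m. L i)"
    unfolding total_def L_def by (rule curve_length_partition[of \<tau> a m b D, OF \<tau>(2,3,4) cont[OF \<tau>(4)]])
  have "separation \<A> D' F' p (\<phi> (\<sigma> * (\<Sum>i<k. L i + \<delta>)) (c (\<tau> k)))
      \<le> ereal (\<Sum>i<k. \<theta> * (L i + \<delta>) + (1 - \<theta>) * L i)" if "k \<le> m" for k
    using that
  proof (induction k)
    case 0
    then show ?case using c(2) \<tau>(2) by (simp add: zero_ereal_def)
  next
    case (Suc k)
    then have k: "k < m" by simp
    let ?s = "\<Sum>i<k. L i + \<delta>"
    have Lk: "curve_length \<A> F c (\<tau> k) (\<tau> (Suc k)) < L k + \<delta>" using \<delta> by (simp add: L_def)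
    obtain c' where c': "smooth_arc D' c' (\<tau> k) (\<tau> (Suc k))" "c' (\<tau> k) = \<phi> (\<sigma> * ?s) (c (\<tau> k))"
      "c' (\<tau> (Suc k)) = \<phi> (\<sigma> * (?s + (L k + \<delta>))) (c (\<tau> (Suc k)))"
      "curve_length \<A> F' c' (\<tau> k) (\<tau> (Suc k)) \<le> \<theta> * (L k + \<delta>) + (1 - \<theta>) * L k"
      using flow_transfer_arc[OF \<tau>(4)[OF k] cont[OF \<tau>(4)[OF k]] Lk nonneg \<theta> transfer, of ?s]
      unfolding L_def by blast
    have "0 \<le> curve_length \<A> F' c' (\<tau> k) (\<tau> (Suc k))"
      using curve_length_nonneg[OF smooth_arc_piecewise[OF c'(1)], of F'] nonneg' by auto
    then have "separation \<A> D' F' (c' (\<tau> k)) (c' (\<tau> (Suc k))) \<le> ereal (\<theta> * (L k + \<delta>) + (1 - \<theta>) * L k)"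
      using c'(4) by (intro separation_le[OF smooth_arc_piecewise[OF c'(1)]]) auto
    then show ?case
      using separation_triangle[of D' F', OF nonneg' Suc.IH] k
      unfolding c'(2,3) by (simp add: sum.lessThan_Suc)
  qed
  from this[of m] have "separation \<A> D' F' p (\<phi> (\<sigma> * (\<Sum>i<m. L i + \<delta>)) q)
      \<le> ereal (\<theta> * (\<Sum>i<m. L i + \<delta>) + (1 - \<theta>) * total)"
    by (simp only: \<tau>(3) c(3) total sum.distrib[of "\<lambda>i. \<theta> * (L i + \<delta>)"] sum_distrib_left[symmetric] order_refl)
  moreover have "(\<Sum>i<m. L i + \<delta>) = r"
    using m total by (simp add: sum.distrib \<delta>_def)
  ultimately show ?thesis using that[of total] c(4) by (simp add: total_def)
qed

lemma smooth_curve_on_flow_line: "smooth_curve_on \<A> UNIV (\<lambda>s. \<phi> s x)"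
proof -
  have "smooth_curve_on \<A> UNIV (\<lambda>s. x)"
    by (auto simp: smooth_curve_on_def o_def intro: smooth_on_const)
  then show ?thesis
    by (rule smooth_curve_on_flow[OF open_UNIV]) (rule smooth_on_bounded_linear[OF bounded_linear_ident])
qed

lemma velocity_flow_line: "velocity \<A> (\<lambda>s. \<phi> s x) UNIV t = W (\<phi> t x)"
  using global_flow unfolding global_flow_def by blast

end

section \<open>Comparison of the Kropina and the Riemannian separation\<close>

context kropina_space
begin

abbreviation "K \<equiv> kropina h W"
abbreviation "KD \<equiv> kropina_dom \<A> h W"
abbreviation "N \<equiv> riem_norm h"
abbreviation "T \<equiv> tangent_space \<A>"

lemma N_nonneg: "y \<in> T x \<Longrightarrow> 0 \<le> N x y"
  using inner_nonneg by (simp add: riem_norm_def)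

lemma N_square: "y \<in> T x \<Longrightarrow> (N x y)\<^sup>2 = h x y y"
  using inner_nonneg by (simp add: riem_norm_def)

lemma KD_iff: "y \<in> KD x \<longleftrightarrow> y \<in> T x \<and> 0 < h x y (W x)"
  by (simp add: kropina_dom_def)

lemma K_eq: "y \<in> T x \<Longrightarrow> K x y = h x y y / (2 * h x y (W x))"
  by (simp add: kropina_def N_square)

lemma K_nonneg: "y \<in> KD x \<Longrightarrow> 0 \<le> K x y"
  using inner_nonneg[of y x] by (simp add: KD_iff K_eq)

lemma inner_W_le_N:
  assumes "y \<in> T x"
  shows "\<bar>h x y (W x)\<bar> \<le> N x y"
proof -
  have "(\<lambda>\<mu>. y \<mu> + (- h x y (W x)) *\<^sub>R W x \<mu>) \<in> T x"
    by (rule tangent_space_add_scaleR[OF assms W_tangent])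
  from inner_nonneg[OF this] have "0 \<le> h x y y - (h x y (W x))\<^sup>2"
    unfolding norm_combination[OF assms W_tangent] by (simp add: power2_eq_square algebra_simps)
  then have "\<bar>h x y (W x)\<bar>\<^sup>2 \<le> (N x y)\<^sup>2" by (simp add: N_square[OF assms])
  then show ?thesis by (rule power2_le_imp_le[OF _ N_nonneg[OF assms]])
qed

lemma continuous_on_arc:
  assumes "smooth_arc D c a b" "\<And>x. D x \<subseteq> T x"
  shows "continuous_on {a..b} (\<lambda>t. h (c t) (velocity \<A> c {a..b} t) (velocity \<A> c {a..b} t))"
    and "continuous_on {a..b} (\<lambda>t. h (c t) (velocity \<A> c {a..b} t) (W (c t)))"
proof -
  obtain J e where J: "open J" "{a..b} \<subseteq> J" "smooth_curve_on \<A> J e" "\<And>t. t \<in> {a..b} \<Longrightarrow> e t = c t"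
    "\<And>t. t \<in> {a..b} \<Longrightarrow> velocity \<A> c {a..b} t = velocity \<A> e J t"
    using smooth_arcE[OF assms(1)] by metis
  show "continuous_on {a..b} (\<lambda>t. h (c t) (velocity \<A> c {a..b} t) (velocity \<A> c {a..b} t))"
    by (rule continuous_on_eq[OF continuous_on_subset[OF continuous_on_metric_velocity(1)[OF J(1,3)] J(2)]])
      (simp add: J(4,5))
  show "continuous_on {a..b} (\<lambda>t. h (c t) (velocity \<A> c {a..b} t) (W (c t)))"
    by (rule continuous_on_eq[OF continuous_on_subset[OF continuous_on_metric_velocity(2)[OF J(1,3)] J(2)]])
      (simp add: J(4,5))
qed

lemma continuous_on_N_arc:
  assumes "smooth_arc T c a b"
  shows "continuous_on {a..b} (\<lambda>t. N (c t) (velocity \<A> c {a..b} t))"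
  unfolding riem_norm_def by (intro continuous_on_real_sqrt continuous_on_arc[OF assms]) simp

lemma continuous_on_K_arc:
  assumes "smooth_arc KD c a b"
  shows "continuous_on {a..b} (\<lambda>t. K (c t) (velocity \<A> c {a..b} t))"
proof -
  have KD: "velocity \<A> c {a..b} t \<in> KD (c t)" if "t \<in> {a..b}" for t
    using assms that by (simp add: smooth_arc_def)
  have "2 * h (c t) (velocity \<A> c {a..b} t) (W (c t)) \<noteq> 0" if "t \<in> {a..b}" for t
    using KD[OF that] by (simp add: KD_iff)
  then have "continuous_on {a..b} (\<lambda>t. h (c t) (velocity \<A> c {a..b} t) (velocity \<A> c {a..b} t) /
      (2 * h (c t) (velocity \<A> c {a..b} t) (W (c t))))"
    by (intro continuous_on_divide continuous_on_mult continuous_on_const continuous_on_arc[OF assms])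
      (auto simp: KD_iff)
  then show ?thesis
    by (rule continuous_on_eq) (use KD in \<open>simp add: KD_iff K_eq\<close>)
qed

text \<open>
  The field \<open>W\<close> has Kropina speed 1/2, so that the flow line costs only half of the flow time.
\<close>
lemma kropina_flow_line:
  assumes "0 < r"
  shows "separation \<A> KD K p (\<phi> r p) \<le> ereal (r / 2)"
proof -
  let ?c = "\<lambda>s. \<phi> s p"
  have W: "W x \<in> KD x" for x by (simp add: KD_iff)
  have arc: "smooth_arc KD ?c 0 r"
    by (rule smooth_arcI[of 0 r UNIV ?c ?c KD])
      (use assms smooth_curve_on_flow_line W in \<open>auto simp: velocity_flow_line\<close>)
  have "velocity \<A> ?c {0..r} t = W (?c t)" if "t \<in> {0..r}" for t
    using velocity_within_eq[OF open_UNIV smooth_curve_on_flow_line subset_UNIV assms that, of p ?c]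
    by (simp add: velocity_flow_line)
  then have "curve_length \<A> K ?c 0 r \<le> (1/2) * (r - 0)"
    using assms by (intro curve_length_le) (auto simp: K_eq)
  then have "separation \<A> KD K (?c 0) (?c r) \<le> ereal (r / 2)"
    using assms by (intro separation_le[OF smooth_arc_piecewise[OF arc]]) auto
  then show ?thesis by simp
qed

lemma inner_scaleR:
  assumes "y \<in> T x"
  shows "h x (\<lambda>\<mu>. r *\<^sub>R y \<mu>) (\<lambda>\<mu>. r *\<^sub>R y \<mu>) = r\<^sup>2 * h x y y"
proof -
  have "(\<lambda>\<mu>. r *\<^sub>R y \<mu>) = (\<lambda>\<mu>. y \<mu> + (r - 1) *\<^sub>R y \<mu>)"
    by (simp add: scaleR_left_diff_distrib)
  then show ?thesis
    by (simp only: norm_combination[OF assms assms]) (simp add: power2_eq_square algebra_simps)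
qed

lemma riemannian_flow_line:
  assumes "0 \<le> r"
  shows "separation \<A> T N p (\<phi> (- r) p) \<le> ereal r"
proof (cases "r = 0")
  case True
  then show ?thesis by (simp add: zero_ereal_def)
next
  case False
  then have r: "0 < r" using assms by simp
  let ?c = "\<lambda>s. \<phi> (- s) p"
  have g: "smooth_on UNIV (uminus :: real \<Rightarrow> real)" "\<And>t :: real. (uminus has_real_derivative - 1) (at t)"
    by (auto intro!: smooth_on_bounded_linear bounded_linear_minus bounded_linear_ident derivative_eq_intros)
  have sm: "smooth_curve_on \<A> UNIV ?c"
    by (rule smooth_curve_on_reparametrize[OF open_UNIV smooth_curve_on_flow_line open_UNIV g(1) subset_UNIV])
  have v: "velocity \<A> ?c UNIV t = (\<lambda>\<mu>. (- 1) *\<^sub>R W (?c t) \<mu>)" for t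
    using velocity_reparametrize[OF open_UNIV smooth_curve_on_flow_line open_UNIV g(1) subset_UNIV UNIV_I g(2), of p t]
    by (simp only: velocity_flow_line)
  have arc: "smooth_arc T ?c 0 r"
    by (rule smooth_arcI[of 0 r UNIV ?c ?c T]) (use r sm velocity_tangent[OF open_UNIV sm] in auto)
  have "N (?c t) (velocity \<A> ?c {0..r} t) = 1" if "t \<in> {0..r}" for t
    using velocity_within_eq[OF open_UNIV sm subset_UNIV r that, of ?c]
    by (simp only: v riem_norm_def inner_scaleR[OF W_tangent]) simp
  then have "curve_length \<A> N ?c 0 r \<le> 1 * (r - 0)"
    using r by (intro curve_length_le) auto
  then have "separation \<A> T N (?c 0) (?c r) \<le> ereal r"
    using r by (intro separation_le[OF smooth_arc_piecewise[OF arc]]) auto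
  then show ?thesis by simp
qed

text \<open>
  Suppose that the time \<open>f\<close> grows faster than the Kropina length of a curve with velocity \<open>y\<close>. Dragging
  the curve back changes \<open>|y|\<^sup>2\<close> into \<open>|y|\<^sup>2 - 2 f' h(y, W) + f'\<^sup>2\<close>, and this is at most
  \<open>f'\<^sup>2\<close>, because \<open>F(y) \<le> f'\<close> means \<open>|y|\<^sup>2 \<le> 2 f' h(y, W)\<close>.
\<close>
lemma riemannian_le_kropina:
  assumes "separation \<A> KD K p q < ereal r" "0 < r"
  shows "separation \<A> T N p (\<phi> (- r) q) \<le> ereal r"
proof (cases "p = q")
  case True
  then show ?thesis using riemannian_flow_line[of r p] assms(2) by simp
next
  case False
  show ?thesis
  proof (rule flow_transfer_separation[of KD K T N 1 "-1" p q r])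
    fix J e f t q
    assume J: "open J" "smooth_curve_on \<A> J e" "smooth_on J f" "t \<in> J" "(f has_real_derivative q) (at t)"
      and KD: "velocity \<A> e J t \<in> KD (e t)" and q: "K (e t) (velocity \<A> e J t) < q"
    let ?v = "velocity \<A> e J t" and ?v' = "velocity \<A> (\<lambda>s. \<phi> (- 1 * f s) (e s)) J t"
    let ?x' = "\<phi> (- 1 * f t) (e t)"
    have f': "smooth_on J (\<lambda>s. - 1 * f s)" "((\<lambda>s. - 1 * f s) has_real_derivative - q) (at t)"
      using smooth_on_cmult[OF J(1,3), of "- 1"] DERIV_cmult[OF J(5), of "- 1"] by simp_all
    have T: "?v' \<in> T ?x'" by (rule velocity_flow_tangent[OF J(1,2) f' J(4)])
    have v: "?v \<in> T (e t)" "0 < h (e t) ?v (W (e t))" using KD by (auto simp: KD_iff)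
    have q0: "0 < q" using q K_nonneg[OF KD] by linarith
    have "h (e t) ?v ?v \<le> 2 * q * h (e t) ?v (W (e t))"
      using q v by (simp add: K_eq divide_less_eq mult_ac)
    then have "h ?x' ?v' ?v' \<le> q\<^sup>2"
      using norm_velocity_flow[OF J(1,2) f' J(4)] by simp
    then have "(N ?x' ?v')\<^sup>2 \<le> q\<^sup>2" by (simp only: N_square[OF T])
    then have "N ?x' ?v' \<le> q" by (rule power2_le_imp_le) (use q0 in simp)
    with T show "?v' \<in> T ?x' \<and> N ?x' ?v' \<le> 1 * q + (1 - 1) * K (e t) ?v" by simp
  next
    fix L assume "separation \<A> T N p (\<phi> (- 1 * r) q) \<le> ereal (1 * r + (1 - 1) * L)"
    then show ?thesis by simp
  qed (use assms False in \<open>auto intro: continuous_on_K_arc K_nonneg N_nonneg\<close>)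
qed

text \<open>
  If the time \<open>f\<close> grows faster than the Riemannian length, then the dragged velocity has inner product
  \<open>f' + h(y, W) \<ge> f' - |y| > 0\<close> with \<open>W\<close>. So the dragged curve is admissible even where \<open>y\<close> is a
  negative multiple of \<open>W\<close> or vanishes. Its Kropina speed is at most the mean of \<open>f'\<close> and \<open>|y|\<close>, so the inequality is strict.
\<close>
lemma kropina_less_riemannian:
  assumes "separation \<A> T N p q < ereal r" "0 < r"
  shows "separation \<A> KD K p (\<phi> r q) < ereal r"
proof (cases "p = q")
  case True
  then have "separation \<A> KD K p (\<phi> r q) \<le> ereal (r / 2)" using kropina_flow_line[OF assms(2)] by simp
  also have "\<dots> < ereal r" using assms(2) by simp
  finally show ?thesis .
next
  case False
  show ?thesis
  proof (rule flow_transfer_separation[of T N KD K "1/2" 1 p q r])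
    fix J e f t q
    assume J: "open J" "smooth_curve_on \<A> J e" "smooth_on J f" "t \<in> J" "(f has_real_derivative q) (at t)"
      and v: "velocity \<A> e J t \<in> T (e t)" and q: "N (e t) (velocity \<A> e J t) < q"
    let ?v = "velocity \<A> e J t" and ?v' = "velocity \<A> (\<lambda>s. \<phi> (1 * f s) (e s)) J t"
    let ?x' = "\<phi> (1 * f t) (e t)"
    define n where "n = N (e t) ?v"
    define w where "w = h (e t) ?v (W (e t))"
    have f': "smooth_on J (\<lambda>s. 1 * f s)" "((\<lambda>s. 1 * f s) has_real_derivative q) (at t)"
      using J(3,5) by simp_all
    have T: "?v' \<in> T ?x'" by (rule velocity_flow_tangent[OF J(1,2) f' J(4)])
    have n: "0 \<le> n" "n < q" "\<bar>w\<bar> \<le> n" "n\<^sup>2 = h (e t) ?v ?v"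
      using N_nonneg[OF v] q inner_W_le_N[OF v] N_square[OF v] by (simp_all add: n_def w_def)
    have hW: "h ?x' ?v' (W ?x') = w + q"
      unfolding w_def by (rule inner_W_velocity_flow[OF J(1,2) f' J(4)])
    have hv: "h ?x' ?v' ?v' = n\<^sup>2 + 2 * q * w + q\<^sup>2"
      unfolding n(4) w_def by (rule norm_velocity_flow[OF J(1,2) f' J(4)])
    have pos: "0 < w + q" using n by linarith
    have KD: "?v' \<in> KD ?x'" using T hW pos by (simp add: KD_iff)
    \<comment> \<open>The asserted bound on the speed is this inequality, multiplied out.\<close>
    have "0 \<le> (q - n) * (n - w)" using n by (intro mult_nonneg_nonneg) linarith+
    then have "n\<^sup>2 + 2 * q * w + q\<^sup>2 \<le> (q + n) * (w + q)"
      by (simp add: power2_eq_square algebra_simps)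
    then have "(n\<^sup>2 + 2 * q * w + q\<^sup>2) / (2 * (w + q)) \<le> (q + n) / 2"
    proof -
      assume "n\<^sup>2 + 2 * q * w + q\<^sup>2 \<le> (q + n) * (w + q)"
      then have "(n\<^sup>2 + 2 * q * w + q\<^sup>2) / (2 * (w + q)) \<le> (q + n) * (w + q) / (2 * (w + q))"
        using pos by (intro divide_right_mono) auto
      also have "\<dots> = (q + n) / 2"
        by (rule nonzero_mult_divide_mult_cancel_right) (use pos in simp)
      finally show ?thesis .
    qed
    moreover have "K ?x' ?v' = (n\<^sup>2 + 2 * q * w + q\<^sup>2) / (2 * (w + q))"
      by (simp only: K_eq[OF T] hW hv)
    moreover have "1/2 * q + (1 - 1/2) * n = (q + n) / 2" by simp
    ultimately show "?v' \<in> KD ?x' \<and> K ?x' ?v' \<le> 1/2 * q + (1 - 1/2) * N (e t) ?v"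
      using KD unfolding n_def[symmetric] by (simp only:)
  next
    fix L assume "L < r" "separation \<A> KD K p (\<phi> (1 * r) q) \<le> ereal (1/2 * r + (1 - 1/2) * L)"
    then show ?thesis by (auto elim!: le_less_trans)
  qed (use assms False in \<open>auto intro: continuous_on_N_arc K_nonneg N_nonneg\<close>)
qed

end

section \<open>Cutting corners\<close>

context atlas
begin

lemma smooth_curve_on_chart:
  assumes "open J" "\<kappa> \<in> \<A>" "smooth_on J \<eta>" "\<eta> ` J \<subseteq> chart_img \<kappa>"
  shows "smooth_curve_on \<A> J (\<lambda>t. chart_inv \<kappa> (\<eta> t))"
  unfolding smooth_curve_on_def
proof (intro conjI ballI)
  show cont: "continuous_on J (\<lambda>t. chart_inv \<kappa> (\<eta> t))"
    by (rule continuous_on_compose2[OF continuous_on_chart_inv[OF assms(2)] smooth_on_continuous_on[OF assms(3)] assms(4)])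
  fix \<mu> assume \<mu>: "\<mu> \<in> \<A>"
  have "smooth_on {t \<in> J. chart_inv \<kappa> (\<eta> t) \<in> chart_dom \<mu>} (\<lambda>t. (chart_map \<mu> \<circ> chart_inv \<kappa>) (\<eta> t))"
  proof (rule smooth_on_compose[OF open_chart_preimage[OF cont assms(1) \<mu>]
        open_overlap[OF assms(2) open_chart_dom[OF \<mu>]] _ _ smooth_transition[OF assms(2) \<mu>]])
    show "\<eta> ` {t \<in> J. chart_inv \<kappa> (\<eta> t) \<in> chart_dom \<mu>} \<subseteq> chart_img \<kappa> \<inter> chart_inv \<kappa> -` chart_dom \<mu>"
      using assms(4) by auto
    show "smooth_on {t \<in> J. chart_inv \<kappa> (\<eta> t) \<in> chart_dom \<mu>} \<eta>"
      by (rule smooth_on_subset[OF assms(3)]) auto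
  qed
  then show "smooth_on {t \<in> J. chart_inv \<kappa> (\<eta> t) \<in> chart_dom \<mu>} (chart_map \<mu> \<circ> (\<lambda>t. chart_inv \<kappa> (\<eta> t)))"
    by (simp add: o_def)
qed

lemma velocity_chart_curve:
  assumes "open J" "\<kappa> \<in> \<A>" "smooth_on J \<eta>" "\<eta> ` J \<subseteq> chart_img \<kappa>" "t \<in> J"
    and "(\<eta> has_vector_derivative v) (at t)"
  shows "velocity \<A> (\<lambda>t. chart_inv \<kappa> (\<eta> t)) J t \<kappa> = v"
proof -
  have dom: "chart_inv \<kappa> (\<eta> t) \<in> chart_dom \<kappa>" using assms by auto
  have "((\<lambda>s. chart_map \<kappa> (chart_inv \<kappa> (\<eta> s))) has_vector_derivative
      velocity \<A> (\<lambda>t. chart_inv \<kappa> (\<eta> t)) J t \<kappa>) (at t)"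
    using velocity_has_vector_derivative[where c = "\<lambda>t. chart_inv \<kappa> (\<eta> t)",
        OF assms(1) smooth_curve_on_chart[OF assms(1-4)] assms(5,2) dom] .
  then have "(\<eta> has_vector_derivative velocity \<A> (\<lambda>t. chart_inv \<kappa> (\<eta> t)) J t \<kappa>) (at t)"
    by (rule has_vector_derivative_transform_within_open[OF _ assms(1,5)]) (use assms(2,4) in auto)
  then show ?thesis by (rule vector_derivative_unique_at[OF _ assms(6)])
qed

text \<open>
  Only the values of a curve on its domain matter, so that \<open>\<rho>\<close> may be given by the same formula also
  outside the domain of \<open>P\<close>.
\<close>
lemma cut_point_cong:
  assumes I: "open I" "is_interval I" "0 \<in> I" and c: "smooth_curve_on \<A> I c"
    and eq: "\<And>t. t \<in> I \<Longrightarrow> c' t = c t"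
  shows "cut_point \<A> D F I c' l \<longleftrightarrow> cut_point \<A> D F I c l"
proof -
  have "minimizing \<A> D F c' 0 t \<longleftrightarrow> minimizing \<A> D F c 0 t" if t: "t \<in> I" "0 < t" for t
  proof -
    have sub: "{0..t} \<subseteq> I"
    proof
      fix s assume "s \<in> {0..t}"
      then show "s \<in> I" using mem_is_interval_1_I[OF I(2,3) t(1), of s] by simp
    qed
    have e: "c s = c' s" if "s \<in> {0..t}" for s
      using eq[of s] subsetD[OF sub that] by simp
    have "F (c' s) (velocity \<A> c' {0..t} s) = F (c s) (velocity \<A> c {0..t} s)" if s: "s \<in> {0..t}" for s
      by (simp only: velocity_within_eq[OF I(1) c sub t(2) s e] velocity_within_eq[OF I(1) c sub t(2) s refl] e[OF s])
    then have "curve_length \<A> F c' 0 t = curve_length \<A> F c 0 t"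
      unfolding curve_length_def by (rule integral_cong)
    then show ?thesis using eq[OF I(3)] eq[OF t(1)] by (simp add: minimizing_def)
  qed
  then have "{t \<in> I. 0 < t \<and> minimizing \<A> D F c' 0 t} = {t \<in> I. 0 < t \<and> minimizing \<A> D F c 0 t}"
    by (intro Collect_cong conj_cong refl)
  then show ?thesis unfolding cut_point_def by (simp only:)
qed

end

context riemannian
begin


text \<open>
  The straight segment in the chart has the constant coordinate velocity \<open>z - y\<close>.
\<close>
lemma separation_le_chart_segment:
  assumes \<kappa>: "\<kappa> \<in> \<A>" and U: "open U" "convex U" "U \<subseteq> chart_img \<kappa>" and y: "y \<in> U" "z \<in> U"
    and k: "0 \<le> k" "\<And>\<xi>. \<xi> \<in> U \<Longrightarrow> metric \<kappa> \<xi> (z - y) (z - y) \<le> k\<^sup>2"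
  shows "separation \<A> (tangent_space \<A>) (riem_norm h) (chart_inv \<kappa> y) (chart_inv \<kappa> z) \<le> ereal k"
proof -
  define \<eta> where "\<eta> t = y + t *\<^sub>R (z - y)" for t :: real
  define J where "J = \<eta> -` U"
  define c where "c t = chart_inv \<kappa> (\<eta> t)" for t
  have J: "open J"
    unfolding J_def \<eta>_def by (intro open_vimage U continuous_intros)
  have seg: "{0..1} \<subseteq> J"
  proof
    fix t :: real assume t: "t \<in> {0..1}"
    have "(1 - t) *\<^sub>R y + t *\<^sub>R z \<in> U" by (rule convexD_alt[OF U(2) y]) (use t in auto)
    moreover have "(1 - t) *\<^sub>R y + t *\<^sub>R z = \<eta> t" by (simp add: \<eta>_def algebra_simps)
    ultimately show "t \<in> J" by (simp add: J_def)
  qed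
  have "smooth_on J (\<lambda>t. t *\<^sub>R (z - y))"
    by (rule smooth_on_bounded_linear) (rule bounded_linear_scaleR_left)
  from smooth_on_add[OF J smooth_on_const this] have sm: "smooth_on J \<eta>" by (simp add: \<eta>_def[abs_def])
  have img: "\<eta> ` J \<subseteq> chart_img \<kappa>" using U(3) by (auto simp: J_def)
  have d: "(\<eta> has_vector_derivative (z - y)) (at t)" for t
    unfolding \<eta>_def by (auto intro!: derivative_eq_intros)
  have c: "smooth_curve_on \<A> J c"
    unfolding c_def by (rule smooth_curve_on_chart[OF J \<kappa> sm img])
  have vel: "velocity \<A> c J t \<kappa> = z - y" if "t \<in> J" for t
    unfolding c_def by (rule velocity_chart_curve[OF J \<kappa> sm img that d])
  have arc: "smooth_arc (tangent_space \<A>) c 0 1"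
    by (rule smooth_arcI[OF _ J seg c]) (use velocity_tangent[OF J c] seg in auto)
  have "riem_norm h (c t) (velocity \<A> c {0..1} t) \<le> k" if t: "t \<in> {0..1}" for t
  proof -
    have tJ: "t \<in> J" using t seg by blast
    have "\<eta> t \<in> U" using tJ by (simp add: J_def)
    have dom: "c t \<in> chart_dom \<kappa>" "chart_map \<kappa> (c t) = \<eta> t"
      using \<kappa> img tJ by (auto simp: c_def)
    have "velocity \<A> c {0..1} t = velocity \<A> c J t"
      by (rule velocity_within_eq[OF J c seg _ t]) auto
    then have "h (c t) (velocity \<A> c {0..1} t) (velocity \<A> c {0..1} t) = metric \<kappa> (\<eta> t) (z - y) (z - y)"
      using metric_tangent[OF velocity_tangent[OF J c tJ] velocity_tangent[OF J c tJ] \<kappa> dom(1)]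
      by (simp add: dom(2) vel[OF tJ])
    also have "\<dots> \<le> k\<^sup>2" by (rule k(2)[OF \<open>\<eta> t \<in> U\<close>])
    finally show ?thesis using k(1) by (simp add: riem_norm_def real_le_lsqrt)
  qed
  then have "curve_length \<A> (riem_norm h) c 0 1 \<le> k * (1 - 0)" using k(1) by (intro curve_length_le) auto
  then have "separation \<A> (tangent_space \<A>) (riem_norm h) (c 0) (c 1) \<le> ereal k"
    using k(1) by (intro separation_le[OF smooth_arc_piecewise[OF arc]]) auto
  then show ?thesis by (simp add: c_def \<eta>_def)
qed

text \<open>
  Close to the corner, the straight segment in a chart from \<open>c1 \<epsilon>\<close> to \<open>c2 \<epsilon>\<close> has coordinate velocity
  \<open>\<epsilon> (v2 - v1)\<close> up to \<open>o(\<epsilon>)\<close>, and the metric along it is almost the metric at the corner.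
\<close>
lemma corner_shortcut:
  assumes \<kappa>: "\<kappa> \<in> \<A>" and c: "c1 0 = c2 0" "c2 0 \<in> chart_dom \<kappa>"
    and cont: "isCont c1 0" "isCont c2 0"
    and d: "((\<lambda>s. chart_map \<kappa> (c1 s)) has_vector_derivative v1) (at 0)"
      "((\<lambda>s. chart_map \<kappa> (c2 s)) has_vector_derivative v2) (at 0)"
    and k: "0 \<le> k" "metric \<kappa> (chart_map \<kappa> (c2 0)) (v2 - v1) (v2 - v1) < k\<^sup>2"
  shows "\<forall>\<^sub>F \<epsilon> in at_right 0. separation \<A> (tangent_space \<A>) (riem_norm h) (c1 \<epsilon>) (c2 \<epsilon>) \<le> ereal (k * \<epsilon>)"
proof -
  let ?y1 = "\<lambda>s. chart_map \<kappa> (c1 s)" and ?y2 = "\<lambda>s. chart_map \<kappa> (c2 s)"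
  let ?\<xi> = "chart_map \<kappa> (c2 0)" and ?Z = "\<lambda>\<epsilon>. (1 / \<epsilon>) *\<^sub>R (?y2 \<epsilon> - ?y1 \<epsilon>)"
  have \<xi>: "?\<xi> \<in> chart_img \<kappa>" using \<kappa> c(2) by simp
  \<comment> \<open>The bound \<open>k\<close> is strict at the corner, hence it persists for nearby base points and vectors.\<close>
  let ?S = "chart_img \<kappa> \<times> UNIV" and ?q = "\<lambda>p. metric \<kappa> (fst p) (snd p) (snd p)"
  have S: "open ?S" by (intro open_Times open_chart_img \<kappa> open_UNIV)
  have "continuous_on ?S ?q"
    by (rule metric_continuous_on[OF \<kappa>]) (auto intro!: continuous_intros)
  from continuous_open_preimage[OF this S open_lessThan[of "k\<^sup>2"]]
  have "open (?S \<inter> ?q -` {..<k\<^sup>2})" .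
  moreover have "(?\<xi>, v2 - v1) \<in> ?S \<inter> ?q -` {..<k\<^sup>2}" using \<xi> k(2) by simp
  ultimately obtain A B where AB: "open A" "open B" "(?\<xi>, v2 - v1) \<in> A \<times> B" "A \<times> B \<subseteq> ?S \<inter> ?q -` {..<k\<^sup>2}"
    by (rule open_prod_elim)
  then obtain \<delta> where \<delta>: "0 < \<delta>" "ball ?\<xi> \<delta> \<subseteq> A" using openE[OF AB(1)] by auto
  let ?U = "ball ?\<xi> \<delta>"
  have U: "?U \<subseteq> chart_img \<kappa>" using \<delta>(2) AB(3,4) by auto
  have "((\<lambda>s. ?y2 s - ?y1 s) has_vector_derivative v2 - v1) (at 0)"
    by (intro has_vector_derivative_diff d)
  then have "(?Z \<longlongrightarrow> v2 - v1) (at 0)"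
    by (rule difference_quotient_tendsto) (simp add: c(1))
  then have "(?Z \<longlongrightarrow> v2 - v1) (at_right 0)"
    by (rule tendsto_mono[OF at_le, rotated]) simp
  then have e1: "\<forall>\<^sub>F \<epsilon> in at_right 0. ?Z \<epsilon> \<in> B"
    by (rule topological_tendstoD) (use AB in auto)
  have right: "(f \<longlongrightarrow> f 0) (at_right (0::real))" if "isCont f 0" for f :: "real \<Rightarrow> 'z::topological_space"
    using that unfolding isCont_def by (rule tendsto_mono[OF at_le, rotated]) simp
  have y_cont: "isCont ?y1 0" "isCont ?y2 0" using d has_vector_derivative_continuous by blast+
  have e2: "\<forall>\<^sub>F \<epsilon> in at_right 0. ?y1 \<epsilon> \<in> ?U" "\<forall>\<^sub>F \<epsilon> in at_right 0. ?y2 \<epsilon> \<in> ?U"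
    by (rule topological_tendstoD[OF right[OF y_cont(1)] open_ball], use \<delta>(1) c(1) in simp,
        rule topological_tendstoD[OF right[OF y_cont(2)] open_ball], use \<delta>(1) in simp)
  have e3: "\<forall>\<^sub>F \<epsilon> in at_right 0. c1 \<epsilon> \<in> chart_dom \<kappa>" "\<forall>\<^sub>F \<epsilon> in at_right 0. c2 \<epsilon> \<in> chart_dom \<kappa>"
    by (rule topological_tendstoD[OF right[OF cont(1)] open_chart_dom[OF \<kappa>]], use c in simp,
        rule topological_tendstoD[OF right[OF cont(2)] open_chart_dom[OF \<kappa>]], use c in simp)
  have e4: "\<forall>\<^sub>F \<epsilon> in at_right 0. (0::real) < \<epsilon>" by (rule eventually_at_right_less)
  from e1 e2 e3 e4 show ?thesis
  proof eventually_elim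
    case (elim \<epsilon>)
    have "metric \<kappa> \<xi> (?y2 \<epsilon> - ?y1 \<epsilon>) (?y2 \<epsilon> - ?y1 \<epsilon>) \<le> (k * \<epsilon>)\<^sup>2" if "\<xi> \<in> ?U" for \<xi>
    proof -
      have "(\<xi>, ?Z \<epsilon>) \<in> A \<times> B" using that \<delta>(2) elim(1) by auto
      then have q: "\<xi> \<in> chart_img \<kappa>" "metric \<kappa> \<xi> (?Z \<epsilon>) (?Z \<epsilon>) < k\<^sup>2" using AB(4) by auto
      note B = bilinear_metric[OF \<kappa> q(1)]
      define z where "z = ?Z \<epsilon>"
      have y: "?y2 \<epsilon> - ?y1 \<epsilon> = \<epsilon> *\<^sub>R z" using elim(6) by (simp add: z_def)
      have "metric \<kappa> \<xi> (\<epsilon> *\<^sub>R z) (\<epsilon> *\<^sub>R z) = \<epsilon>\<^sup>2 * metric \<kappa> \<xi> z z"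
        by (simp add: bilinear_lmul[OF B] bilinear_rmul[OF B] power2_eq_square)
      also have "\<dots> \<le> \<epsilon>\<^sup>2 * k\<^sup>2" using q(2) unfolding z_def by (intro mult_left_mono) auto
      finally show ?thesis by (simp add: y power_mult_distrib mult.commute)
    qed
    then have "separation \<A> (tangent_space \<A>) (riem_norm h) (chart_inv \<kappa> (?y1 \<epsilon>)) (chart_inv \<kappa> (?y2 \<epsilon>)) \<le> ereal (k * \<epsilon>)"
      using elim k(1) by (intro separation_le_chart_segment[OF \<kappa> open_ball convex_ball U]) auto
    then show ?case using elim \<kappa> by simp
  qed
qed

end

section \<open>Cut points\<close>

context kropina_space
begin

context
  fixes I :: "real set" and P \<rho> :: "real \<Rightarrow> 'a"
  assumes I: "open I" "is_interval I" "0 \<in> I"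
    and smooth_P: "smooth_curve_on \<A> I P"
    and P_admissible: "\<And>t. t \<in> I \<Longrightarrow> velocity \<A> P I t \<in> kropina_dom \<A> h W (P t)"
    and P_unit: "\<And>t. t \<in> I \<Longrightarrow> kropina h W (P t) (velocity \<A> P I t) = 1"
    and \<rho>_def: "\<And>t. \<rho> t = \<phi> (- t) (P t)"
begin

lemma interval_subset:
  assumes "a \<in> I" "b \<in> I"
  shows "{a..b} \<subseteq> I"
proof
  fix s assume "s \<in> {a..b}"
  then show "s \<in> I" using mem_is_interval_1_I[OF I(2) assms, of s] by simp
qed

lemma smooth_\<rho>: "smooth_curve_on \<A> I \<rho>"
proof -
  have "smooth_curve_on \<A> I (\<lambda>t. \<phi> (- t) (P t))"
    by (rule smooth_curve_on_flow[OF I(1) smooth_P])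
      (rule smooth_on_bounded_linear[OF bounded_linear_minus[OF bounded_linear_ident]])
  then show ?thesis by (simp add: \<rho>_def[abs_def])
qed

text \<open>
  Unit Kropina speed means \<open>|y|\<^sup>2 = 2 h(y, W)\<close>. By the navigation identities with \<open>f t = - t\<close>, the
  curve \<open>\<rho>\<close> then has unit speed, and admissibility of \<open>y\<close> says that the velocity of \<open>\<rho>\<close> is never
  \<open>- W\<close>.
\<close>
lemma \<rho>_velocity:
  assumes "t \<in> I"
  defines "v \<equiv> velocity \<A> \<rho> I t"
  shows "h (\<rho> t) v v = 1" "- 1 < h (\<rho> t) v (W (\<rho> t))"
proof -
  let ?p = "velocity \<A> P I t"
  have m: "smooth_on I (uminus :: real \<Rightarrow> real)" "(uminus has_real_derivative - 1) (at t)"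
    by (auto intro!: smooth_on_bounded_linear bounded_linear_minus bounded_linear_ident derivative_eq_intros)
  have \<rho>: "\<rho> = (\<lambda>t. \<phi> (- t) (P t))" using \<rho>_def by blast
  have p: "?p \<in> T (P t)" "0 < h (P t) ?p (W (P t))" using P_admissible[OF assms(1)] by (simp_all add: KD_iff)
  have "h (P t) ?p ?p = 2 * h (P t) ?p (W (P t))"
    using P_unit[OF assms(1)] p by (simp add: K_eq field_simps)
  then show "h (\<rho> t) v v = 1"
    using norm_velocity_flow[OF I(1) smooth_P m assms(1)] unfolding v_def \<rho> by simp
  show "- 1 < h (\<rho> t) v (W (\<rho> t))"
    using inner_W_velocity_flow[OF I(1) smooth_P m assms(1)] p(2) unfolding v_def \<rho> by simp
qed

lemma
  assumes "a < b" "a \<in> I" "b \<in> I"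
  shows P_arc: "smooth_arc KD P a b" and P_length: "curve_length \<A> K P a b = b - a"
    and \<rho>_arc: "smooth_arc T \<rho> a b" and \<rho>_length: "curve_length \<A> N \<rho> a b = b - a"
proof -
  note ab = interval_subset[OF assms(2,3)]
  show "smooth_arc KD P a b"
    by (rule smooth_arcI[OF assms(1) I(1) ab smooth_P]) (use P_admissible ab in auto)
  show "smooth_arc T \<rho> a b"
    by (rule smooth_arcI[OF assms(1) I(1) ab smooth_\<rho>]) (use velocity_tangent[OF I(1) smooth_\<rho>] ab in auto)
  have "K (P t) (velocity \<A> P {a..b} t) = 1" if "t \<in> {a..b}" for t
    using velocity_within_eq[OF I(1) smooth_P ab assms(1) that refl] P_unit[of t] ab that by auto
  then show "curve_length \<A> K P a b = b - a"
    using curve_length_const[of a b K P 1] assms(1) by simp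
  have "N (\<rho> t) (velocity \<A> \<rho> {a..b} t) = 1" if "t \<in> {a..b}" for t
    using velocity_within_eq[OF I(1) smooth_\<rho> ab assms(1) that refl] \<rho>_velocity(1)[of t] ab that
    by (auto simp: riem_norm_def)
  then show "curve_length \<A> N \<rho> a b = b - a"
    using curve_length_const[of a b N \<rho> 1] assms(1) by simp
qed

lemma \<rho>_separation_le:
  assumes "a \<le> b" "a \<in> I" "b \<in> I"
  shows "separation \<A> T N (\<rho> a) (\<rho> b) \<le> ereal (b - a)"
proof (cases "a = b")
  case False
  then show ?thesis
    using assms by (intro separation_le[OF smooth_arc_piecewise[OF \<rho>_arc]]) (auto simp: \<rho>_length)
qed (simp add: zero_ereal_def)

lemma P_separation_le:
  assumes "a < b" "a \<in> I" "b \<in> I"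
  shows "separation \<A> KD K (P a) (P b) \<le> ereal (b - a)"
  using assms by (intro separation_le[OF smooth_arc_piecewise[OF P_arc]]) (auto simp: P_length)

lemma minimizing_P_iff:
  "t \<in> I \<Longrightarrow> 0 < t \<Longrightarrow> minimizing \<A> KD K P 0 t \<longleftrightarrow> separation \<A> KD K (P 0) (P t) = ereal t"
  using P_length[of 0 t] I(3) by (auto simp: minimizing_def)

lemma minimizing_\<rho>_iff:
  "t \<in> I \<Longrightarrow> 0 < t \<Longrightarrow> minimizing \<A> T N \<rho> 0 t \<longleftrightarrow> separation \<A> T N (\<rho> 0) (\<rho> t) = ereal t"
  using \<rho>_length[of 0 t] I(3) by (auto simp: minimizing_def)

lemma flow_\<rho>: "\<phi> s (\<rho> t) = \<phi> (s - t) (P t)"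
  by (simp add: \<rho>_def)

lemma \<rho>_zero: "\<rho> 0 = P 0"
  by (simp add: \<rho>_def)

text \<open>
  Arriving at \<open>\<rho> s\<close> along the reversed flow line and leaving along \<open>\<rho>\<close> makes a genuine corner, since
  the velocity of \<open>\<rho>\<close> is not \<open>- W\<close>. So the two steps of length \<open>\<epsilon>\<close> can be replaced by one that is
  shorter than \<open>2 \<epsilon>\<close> by a definite factor.
\<close>
lemma corner_at_\<rho>:
  assumes "s \<in> I"
  obtains k where "0 \<le> k" "k < 2"
    "\<forall>\<^sub>F \<epsilon> in at_right 0. separation \<A> T N (\<phi> \<epsilon> (\<rho> s)) (\<rho> (s + \<epsilon>)) \<le> ereal (k * \<epsilon>)"
proof -
  obtain \<kappa> where \<kappa>: "\<kappa> \<in> \<A>" "\<rho> s \<in> chart_dom \<kappa>" by (rule chart_around)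
  define v where "v = velocity \<A> \<rho> I s"
  let ?w = "W (\<rho> s)" and ?m = "metric \<kappa> (chart_map \<kappa> (\<rho> s))"
  have v: "v \<in> T (\<rho> s)" unfolding v_def by (rule velocity_tangent[OF I(1) smooth_\<rho> assms])
  have "?m (v \<kappa> - ?w \<kappa>) (v \<kappa> - ?w \<kappa>) = h (\<rho> s) (\<lambda>\<mu>. v \<mu> + (- 1) *\<^sub>R ?w \<mu>) (\<lambda>\<mu>. v \<mu> + (- 1) *\<^sub>R ?w \<mu>)"
    using tangent_space_add_scaleR[OF v W_tangent, of "- 1"] by (simp add: metric_tangent[OF _ _ \<kappa>])
  also have "\<dots> = 2 - 2 * h (\<rho> s) v ?w"
    using \<rho>_velocity(1)[OF assms] by (simp only: norm_combination[OF v W_tangent]) (simp add: v_def)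
  also have "\<dots> < 4" using \<rho>_velocity(2)[OF assms] by (simp add: v_def)
  finally have "sqrt (?m (v \<kappa> - ?w \<kappa>) (v \<kappa> - ?w \<kappa>)) < 2"
    using real_sqrt_less_mono[of _ 4] by fastforce
  then obtain k where k: "sqrt (?m (v \<kappa> - ?w \<kappa>) (v \<kappa> - ?w \<kappa>)) < k" "k < 2" "0 \<le> k"
    using dense[of "max 0 (sqrt (?m (v \<kappa> - ?w \<kappa>) (v \<kappa> - ?w \<kappa>)))" 2] by auto
  then have k2: "?m (v \<kappa> - ?w \<kappa>) (v \<kappa> - ?w \<kappa>) < k\<^sup>2"
    using real_less_rsqrt[of _ "?m (v \<kappa> - ?w \<kappa>) (v \<kappa> - ?w \<kappa>)"] real_sqrt_less_iff[of _ "k\<^sup>2"] by simp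
  have cont_\<rho>: "isCont \<rho> s"
    using smooth_\<rho> I(1) assms by (auto simp: smooth_curve_on_def continuous_on_eq_continuous_at)
  have shift: "((\<lambda>e. s + e) has_real_derivative 1) (at 0)"
    by (auto intro!: derivative_eq_intros)
  have "\<forall>\<^sub>F \<epsilon> in at_right 0. separation \<A> T N (\<phi> \<epsilon> (\<rho> s)) (\<rho> (s + \<epsilon>)) \<le> ereal (k * \<epsilon>)"
  proof (rule corner_shortcut[OF \<kappa>(1), where ?c1.0 = "\<lambda>\<epsilon>. \<phi> \<epsilon> (\<rho> s)" and ?c2.0 = "\<lambda>\<epsilon>. \<rho> (s + \<epsilon>)"
        and ?v1.0 = "?w \<kappa>" and ?v2.0 = "v \<kappa>"])
    show "isCont (\<lambda>\<epsilon>. \<phi> \<epsilon> (\<rho> s)) 0"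
      using smooth_curve_on_flow_line[of "\<rho> s"] by (simp add: smooth_curve_on_def continuous_on_eq_continuous_at)
    show "isCont (\<lambda>\<epsilon>. \<rho> (s + \<epsilon>)) 0"
      by (rule isCont_o2[where f = "\<lambda>\<epsilon>. s + \<epsilon>" and g = \<rho>]) (use cont_\<rho> in simp_all)
    show "((\<lambda>e. chart_map \<kappa> (\<phi> e (\<rho> s))) has_vector_derivative ?w \<kappa>) (at 0)"
      using flow_time_derivative[OF \<kappa>(1), of 0 "\<rho> s"] \<kappa>(2) by simp
    have "((\<lambda>u. chart_map \<kappa> (\<rho> u)) has_vector_derivative v \<kappa>) (at (s + 0))"
      using velocity_has_vector_derivative[OF I(1) smooth_\<rho> assms \<kappa>] by (simp add: v_def)
    then show "((\<lambda>e. chart_map \<kappa> (\<rho> (s + e))) has_vector_derivative v \<kappa>) (at 0)"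
      using vector_diff_chain_at[of "\<lambda>e. s + e" 1 0 "\<lambda>u. chart_map \<kappa> (\<rho> u)"] shift
      by (simp add: o_def has_real_derivative_iff_has_vector_derivative)
  qed (use \<kappa> k k2 in auto)
  with k show ?thesis by (intro that) auto
qed

text \<open>
  A shortcut for \<open>\<rho>\<close> is dragged along the flow to a shortcut for \<open>P\<close>.
\<close>
lemma \<rho>_minimizing_if_P_minimizing:
  assumes t: "t \<in> I" "0 < t" and "separation \<A> KD K (P 0) (P t) = ereal t"
  shows "separation \<A> T N (\<rho> 0) (\<rho> t) = ereal t"
proof (rule ccontr)
  assume "separation \<A> T N (\<rho> 0) (\<rho> t) \<noteq> ereal t"
  then have "separation \<A> T N (\<rho> 0) (\<rho> t) < ereal t"
    using \<rho>_separation_le[of 0 t] t I(3) by (simp add: order_less_le)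
  from kropina_less_riemannian[OF this t(2)] show False
    using assms(3) by (simp add: flow_\<rho> \<rho>_zero)
qed

text \<open>
  A shortcut for \<open>P\<close> up to time \<open>s\<close> saves time, and dragging it back leads, in a time \<open>r < s\<close>, to the
  point \<open>\<phi> (s - r) (\<rho> s)\<close> downstream of \<open>\<rho> s\<close>. Returning along the flow line for the time \<open>s - r\<close>
  and continuing along \<open>\<rho>\<close> is a path to \<open>\<rho> t\<close> of length \<open>t\<close>. It has a corner at \<open>\<rho> s\<close>, so it can be
  shortened, contrary to the minimality of \<open>\<rho>\<close>.
\<close>
lemma P_minimizing_before_\<rho>_minimizing:
  assumes t: "t \<in> I" and s: "0 < s" "s < t" and min: "separation \<A> T N (\<rho> 0) (\<rho> t) = ereal t"
  shows "separation \<A> KD K (P 0) (P s) = ereal s"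
proof (rule ccontr)
  assume ne: "separation \<A> KD K (P 0) (P s) \<noteq> ereal s"
  have sI: "s \<in> I" using interval_subset[OF I(3) t] s by auto
  have "separation \<A> KD K (P 0) (P s) < ereal s"
    using P_separation_le[OF s(1) I(3) sI] ne by (simp add: order_less_le)
  then have "max 0 (separation \<A> KD K (P 0) (P s)) < ereal s" using s(1) by simp
  then obtain r where r: "max 0 (separation \<A> KD K (P 0) (P s)) < ereal r" "ereal r < ereal s"
    using ereal_dense2 by blast
  then have r': "0 < r" "r < s" "separation \<A> KD K (P 0) (P s) < ereal r" by auto
  obtain k where k: "0 \<le> k" "k < 2"
    "\<forall>\<^sub>F \<epsilon> in at_right 0. separation \<A> T N (\<phi> \<epsilon> (\<rho> s)) (\<rho> (s + \<epsilon>)) \<le> ereal (k * \<epsilon>)"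
    by (rule corner_at_\<rho>[OF sI])
  have "\<forall>\<^sub>F \<epsilon> in at_right 0. \<epsilon> \<in> {0<..<min (s - r) (t - s)}"
    using r'(2) s(2) by (intro eventually_at_right_real) simp
  with k(3) have "\<forall>\<^sub>F \<epsilon> in at_right 0. separation \<A> T N (\<phi> \<epsilon> (\<rho> s)) (\<rho> (s + \<epsilon>)) \<le> ereal (k * \<epsilon>)
      \<and> \<epsilon> \<in> {0<..<min (s - r) (t - s)}"
    by (rule eventually_conj)
  from eventually_happens'[OF trivial_limit_at_right_real this]
  obtain \<epsilon> where \<epsilon>: "0 < \<epsilon>" "\<epsilon> < s - r" "\<epsilon> < t - s"
    "separation \<A> T N (\<phi> \<epsilon> (\<rho> s)) (\<rho> (s + \<epsilon>)) \<le> ereal (k * \<epsilon>)"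
    by auto
  note tri = separation_triangle[of T N, OF N_nonneg]
  have 1: "separation \<A> T N (\<rho> 0) (\<phi> (s - r) (\<rho> s)) \<le> ereal r"
    using riemannian_le_kropina[OF r'(3,1)] by (simp add: flow_\<rho> \<rho>_zero)
  have 2: "separation \<A> T N (\<phi> (s - r) (\<rho> s)) (\<phi> \<epsilon> (\<rho> s)) \<le> ereal (s - r - \<epsilon>)"
    using riemannian_flow_line[of "s - r - \<epsilon>" "\<phi> (s - r) (\<rho> s)"] \<epsilon>(2) by simp
  have 3: "separation \<A> T N (\<rho> (s + \<epsilon>)) (\<rho> t) \<le> ereal (t - (s + \<epsilon>))"
    using interval_subset[OF I(3) t] s \<epsilon>(1,3) t by (intro \<rho>_separation_le) auto
  have "separation \<A> T N (\<rho> 0) (\<rho> t) \<le> ereal (r + (s - r - \<epsilon>) + k * \<epsilon> + (t - (s + \<epsilon>)))"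
    by (rule tri[OF _ tri[OF _ tri[OF _ 1 2] \<epsilon>(4)] 3])
  moreover have "k * \<epsilon> < 2 * \<epsilon>" using k(2) \<epsilon>(1) by simp
  ultimately show False using min by simp
qed

text \<open>
  The sets of minimizing times differ by at most the supremum of the larger one.
\<close>
lemma cut_point_iff:
  "cut_point \<A> KD K I P l \<longleftrightarrow> cut_point \<A> T N I \<rho> l"
proof -
  let ?M = "{t \<in> I. 0 < t \<and> minimizing \<A> KD K P 0 t}" and ?R = "{t \<in> I. 0 < t \<and> minimizing \<A> T N \<rho> 0 t}"
  have "?M \<subseteq> ?R"
    using \<rho>_minimizing_if_P_minimizing by (auto simp: minimizing_P_iff minimizing_\<rho>_iff)
  then have "Sup (ereal ` ?M) \<le> Sup (ereal ` ?R)" by (intro Sup_subset_mono image_mono)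
  moreover have "Sup (ereal ` ?R) \<le> Sup (ereal ` ?M)"
  proof (rule SUP_least)
    fix t assume t: "t \<in> ?R"
    show "ereal t \<le> Sup (ereal ` ?M)"
    proof (rule dense_le)
      fix x assume "x < ereal t"
      then have "max 0 x < ereal t" using t by simp
      then obtain s where s: "max 0 x < ereal s" "ereal s < ereal t" using ereal_dense2 by blast
      then have s': "0 < s" "s < t" by auto
      have "s \<in> I" using interval_subset[OF I(3), of t] t s' by auto
      then have "s \<in> ?M"
        using P_minimizing_before_\<rho>_minimizing[of t s] t s' by (auto simp: minimizing_P_iff minimizing_\<rho>_iff)
      then have "ereal s \<le> Sup (ereal ` ?M)" by (intro Sup_upper imageI)
      moreover have "x < ereal s" using s(1) by simp
      ultimately show "x \<le> Sup (ereal ` ?M)" by simp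
    qed
  qed
  ultimately show ?thesis unfolding cut_point_def by (simp add: antisym)
qed

end

end

theorem proposition7p5:
  fixes \<A> :: "('a::{t2_space,second_countable_topology}, 'n::finite) chart set"
    and h :: "'a \<Rightarrow> ('a, 'n) tvec \<Rightarrow> ('a, 'n) tvec \<Rightarrow> real"
    and W :: "'a \<Rightarrow> ('a, 'n) tvec"
    and \<phi> :: "real \<Rightarrow> 'a \<Rightarrow> 'a"
    and I :: "real set"
    and P \<rho> :: "real \<Rightarrow> 'a"
    and l :: real
  assumes "smooth_atlas \<A>"
    and "riemannian_metric \<A> h"
    and "riem_complete \<A> h"
    and "killing_field \<A> h W"
    and "\<And>x. riem_norm h x (W x) = 1"
    and "global_flow \<A> W \<phi>"
    and "open I" and "is_interval I" and "0 \<in> I"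
    and "finsler_geodesic \<A> (kropina_dom \<A> h W) (kropina h W) I P"
    and "\<And>t. t \<in> I \<Longrightarrow> kropina h W (P t) (velocity \<A> P I t) = 1"
    and "\<And>t. t \<in> I \<Longrightarrow> \<rho> t = \<phi> (- t) (P t)"
    and "0 < l" and "l \<in> I"
  shows "cut_point \<A> (kropina_dom \<A> h W) (kropina h W) I P l \<longleftrightarrow>
         cut_point \<A> (tangent_space \<A>) (riem_norm h) I \<rho> l"
proof -
  interpret kropina_space \<A> h W \<phi>
    by unfold_locales (use assms in \<open>simp_all add: killing_field_def\<close>)
  let ?\<rho> = "\<lambda>t. \<phi> (- t) (P t)"
  have P: "smooth_curve_on \<A> I P" "\<And>t. t \<in> I \<Longrightarrow> velocity \<A> P I t \<in> kropina_dom \<A> h W (P t)"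
    using assms(10) by (auto simp: finsler_geodesic_def)
  note facts = assms(7-9) P assms(11)
  have "smooth_curve_on \<A> I ?\<rho>"
    by (rule smooth_\<rho>[of I P ?\<rho>]) (use facts in simp_all)
  then have "cut_point \<A> (tangent_space \<A>) (riem_norm h) I \<rho> l \<longleftrightarrow>
      cut_point \<A> (tangent_space \<A>) (riem_norm h) I ?\<rho> l"
    by (rule cut_point_cong[OF assms(7-9) _ assms(12)])
  moreover have "cut_point \<A> (kropina_dom \<A> h W) (kropina h W) I P l \<longleftrightarrow>
      cut_point \<A> (tangent_space \<A>) (riem_norm h) I ?\<rho> l"
    by (rule cut_point_iff) (use facts in simp_all)
  ultimately show ?thesis by simp
qed

end
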